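(* Let $\beta=r/m$ be a fixed positive number with $0<\beta<1$. Then, with $r=\beta m$ an integer, we have, as $m\to\infty$, \[F_{m,r}(x)=(1+x)^m\left[\frac12\,\mathrm{erfc}\!\left(\sqrt{m}\,\rho(\beta,x)\right)+\frac{A(\beta,x)}{\sqrt{2m\pi}}\,e^{-m\rho(\beta,x)^2}\right](1+o(1)).\] In addition, a full expansion in descending powers of $m$ exists. These estimates hold uniformly for $\beta$ in any compact subinterval of $(0,1)$ and $x$ in any compact domain of $\mathbb{C}\setminus(-\infty,0]$.
   Context: \[F_{m,r}(x)=\sum_{l=0}^r\binom{m}{l}x^l.\] The complementary error function is $\mathrm{erfc}(x)=\frac{2}{\sqrt{\pi}}\int_x^\infty e^{-t^2}\,dt$ (extended to an entire function). Define \[\rho(\beta,x)=\sqrt{\log(1+x)-\beta\log x-h(\beta)},\qquad h(\beta)=-\beta\log\beta-(1-\beta)\log(1-\beta),\] \[A(\beta,x)=\frac{1}{\sqrt{\beta(1-\beta)}\left(1-\frac{\beta}{x(1-\beta)}\right)}-\frac{1}{\sqrt2\,\rho(\beta,x)},\] with principal branches of the logarithms. The radicand in $\rho(\beta,x)$ has a quadratic zero at $x=\beta/(1-\beta)$, and the sign of the square root is chosen so that $\rho(\beta,x)$ is analytic in $x$ near that point, with $\rho(\beta,x)>0$ for real $x>\beta/(1-\beta)$ (hence $\rho(\beta,x)<0$ for $0<x<\beta/(1-\beta)$). $A(\beta,x)$ is extended by continuity at $x=\beta/(1-\beta)$. "A full expansion in descending powers of $m$ exists" means that the leading-order approximation extends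 to a complete asymptotic expansion in descending powers of $m$.
   Formalization: The uniform estimate with factor 1+o(1) is proved outside discs of radius δ/m (any δ>0) around the zeros of F_{m,r}, where it fails; on all of the compact set, uniformity is that of the expansion, with remainder O(m^{-N}) added to the coefficient A of the exponential term. *)

theory Defs
  imports "HOL-Complex_Analysis.Complex_Analysis"
begin

definition F :: "nat \<Rightarrow> nat \<Rightarrow> complex \<Rightarrow> complex" where
  "F m r x = (\<Sum>l=0..r. of_nat (m choose l) * x ^ l)"

definition erfc_real :: "real \<Rightarrow> real" where
  "erfc_real x = 2 / sqrt pi * integral {x..} (\<lambda>t. exp (- t\<^sup>2))"

text \<open>The entire extension exists, and it is unique by the identity theorem.\<close>

definition erfc :: "complex \<Rightarrow> complex" where
  "erfc = (THE f. f holomorphic_on UNIV \<and>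
                  (\<forall>x::real. f (of_real x) = of_real (erfc_real x)))"

definition slit_plane :: "complex set" where
  "slit_plane = - \<real>\<^sub>\<le>\<^sub>0"

definition h :: "real \<Rightarrow> real" where
  "h \<beta> = - \<beta> * ln \<beta> - (1 - \<beta>) * ln (1 - \<beta>)"

definition saddle :: "real \<Rightarrow> real" where
  "saddle \<beta> = \<beta> / (1 - \<beta>)"

definition radicand :: "real \<Rightarrow> complex \<Rightarrow> complex" where
  "radicand \<beta> x = Ln (1 + x) - of_real \<beta> * Ln x - of_real (h \<beta>)"

text \<open>
  The principal square root of the radicand is not analytic near the saddle point, where the
  radicand has a double zero. For \<open>0 < \<beta> < 1\<close> this is its only zero in the slit plane (indeed the
  radicand takes no value in \<open>[0, \<infinity>)\<close> off the real axis), so there is an analytic square root on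
  the whole slit plane. Its values on the slit plane are determined by the sign condition, since
  the slit plane is connected; values on the cut are irrelevant.
\<close>

definition rho :: "real \<Rightarrow> complex \<Rightarrow> complex" where
  "rho \<beta> = (SOME g. g holomorphic_on slit_plane \<and>
                    (\<forall>x\<in>slit_plane. (g x)\<^sup>2 = radicand \<beta> x) \<and>
                    (\<forall>t::real. t > saddle \<beta> \<longrightarrow>
                       Im (g (of_real t)) = 0 \<and> Re (g (of_real t)) > 0))"

definition A_formula :: "real \<Rightarrow> complex \<Rightarrow> complex" where
  "A_formula \<beta> x =
     1 / (of_real (sqrt (\<beta> * (1 - \<beta>))) * (1 - of_real \<beta> / (x * of_real (1 - \<beta>))))
     - 1 / (of_real (sqrt 2) * rho \<beta> x)"

definition A :: "real \<Rightarrow> complex \<Rightarrow> complex" where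
  "A \<beta> x = (if x = of_real (saddle \<beta>)
             then Lim (at (of_real (saddle \<beta>))) (A_formula \<beta>)
             else A_formula \<beta> x)"

text \<open>
  The right-hand side of the estimate, with the coefficient of the exponential term as the
  parameter \<open>c\<close>: the leading-order approximation is the case \<open>c = A \<beta> x\<close>, and in the full
  expansion \<open>c\<close> is a truncated series in descending powers of \<open>m\<close> plus a remainder.

  The zeros of \<open>F m r\<close> with \<open>r / m\<close> fixed accumulate on a curve in the slit plane that passes
  through the saddle point, and they are not exact zeros of the approximation. A factor
  \<open>1 + o(1)\<close> is therefore uniform only outside small discs around the zeros of \<open>F m r\<close>; without
  exception sets, uniformity is that of the remainder inside \<open>c\<close>.
\<close>

definition approx :: "nat \<Rightarrow> real \<Rightarrow> complex \<Rightarrow> complex \<Rightarrow> complex" where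
  "approx m \<beta> x c =
     (1 + x) ^ m *
       (1/2 * erfc (of_real (sqrt (real m)) * rho \<beta> x)
        + c / of_real (sqrt (2 * real m * pi)) * exp (- of_nat m * (rho \<beta> x)\<^sup>2))"

end

theory Submission
  imports Defs "HOL-Probability.Distributions" "HOL-Real_Asymp.Real_Asymp"
begin

text \<open>
  Write \<open>Q\<close> for the radicand, \<open>s\<close> for the saddle point and \<open>w = exp (- m * Q)\<close> for the weight, which
  equals \<open>x ^ r * exp (m * h \<beta>) / (1 + x) ^ m\<close>. The normalised sum \<open>F / (1 + x) ^ m\<close> and the function
  \<open>erfc (sqrt m * \<rho>) / 2\<close> both have derivatives that are \<open>w\<close> times an explicit factor, because
  \<open>(1 + x) * F' = m * F - (m - r) * (m choose r) * x ^ r\<close> and \<open>\<rho>\<^sup>2 = Q\<close>. Their difference therefore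
  satisfies a first-order equation, and solving it formally by \<open>w / sqrt (2 * pi * m)\<close> times a
  series in \<open>1 / m\<close> determines the coefficients recursively. Each step divides by \<open>Q'\<close>, which
  vanishes exactly at \<open>s\<close>; the requirement that the coefficients be analytic there also determines
  the asymptotic series of the binomial coefficient, term by term. The coefficient of order zero
  is \<open>A\<close>.

  The truncated expansion leaves an error with a derivative of the form \<open>w\<close> times a small factor
  (\<open>has_field_derivative_truncation_error\<close>). This is integrated along paths on which \<open>w\<close> decreases
  towards the end: from \<open>x\<close> along the circle around the origin to the positive axis, since
  \<open>norm (1 + x)\<close> is largest there for given \<open>norm x\<close>, and then along the axis away from \<open>s\<close>
  (\<open>truncation_error_path_bound\<close>). At the ends of the axis Chernoff's bound for the binomial sum and
  the Gaussian bound for the error function show that nothing is left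
  (\<open>cdf_error_of_real\<close>). The same two end points show, without Stirling's formula, that the binomial
  coefficient has the predicted series: otherwise the error could not be small at both ends
  (\<open>stirling_error_bound\<close>). All constants are uniform, because boundedness on compact sets
  is preserved by the two operations that produce the coefficients, differentiation and division
  by \<open>Q'\<close> (\<open>uniform_family_deriv\<close>, \<open>uniform_family_divided_diff\<close>).

  A relative error requires a lower bound for the approximation in units of \<open>w / sqrt m\<close>. At a fixed
  point it follows from the asymptotic behaviour of the complementary error function
  (\<open>scaled_approx_lower_bound\<close>). Away from the zeros of \<open>F\<close> it follows from the differential
  equation once more: in the scale \<open>1 / m\<close> the equation of the scaled sum has bounded coefficients
  and an inhomogeneity bounded away from zero, so if the sum is small at a point, then it is nearly
  a linear function with large slope and has a zero close by
  (\<open>nonvanishing_solution_lower_bound\<close>).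
\<close>

section \<open>The complementary error function\<close>

lemma has_integral_gaussian_half_line:
  "((\<lambda>t::real. exp (- (t - x)\<^sup>2)) has_integral sqrt pi / 2) {x..}"
proof -
  have "has_bochner_integral lborel
      (\<lambda>t. indicator {0..} (- x + 1 * t) *\<^sub>R exp (- (- x + 1 * t)\<^sup>2)) ((sqrt pi / 2) /\<^sub>R \<bar>1\<bar>)"
    using gaussian_moment_0
    by (subst lborel_has_bochner_integral_real_affine_iff[symmetric]) auto
  moreover have "(\<lambda>t. indicator {0..} (- x + 1 * t) *\<^sub>R exp (- (- x + 1 * t)\<^sup>2))
      = (\<lambda>t. indicator {x..} t *\<^sub>R exp (- (t - x)\<^sup>2))"
    by (auto simp: fun_eq_iff indicator_def)
  ultimately have *: "has_bochner_integral lborel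
      (\<lambda>t. indicator {x..} t *\<^sub>R exp (- (t - x)\<^sup>2)) (sqrt pi / 2)"
    by simp
  have "set_integrable lborel {x..} (\<lambda>t::real. exp (- (t - x)\<^sup>2))"
    using * has_bochner_integral_iff unfolding set_integrable_def by blast
  moreover have "(LINT t:{x..}|lborel. exp (- (t - x)\<^sup>2)) = sqrt pi / 2"
    using * has_bochner_integral_iff unfolding set_lebesgue_integral_def by blast
  ultimately show ?thesis
    using set_borel_integral_eq_integral[of "{x..}" "\<lambda>t::real. exp (- (t - x)\<^sup>2)"]
    by (metis has_integral_integral)
qed

lemma gaussian_integrable_on_half_line:
  "(\<lambda>t::real. exp (- t\<^sup>2)) integrable_on {x..}"
proof -
  have *: "(\<lambda>t::real. exp (- t\<^sup>2)) integrable_on {min x 0..}"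
  proof -
    have "{min x 0..0} \<inter> {0::real..} \<subseteq> {0}" by auto
    then have null: "negligible ({min x 0..0} \<inter> {0::real..})" by (rule negligible_subset[rotated]) simp
    have split: "{min x 0..} = {min x 0..0} \<union> {0::real..}" by auto
    have left: "(\<lambda>t::real. exp (- t\<^sup>2)) integrable_on {min x 0..0}"
      by (intro integrable_continuous_real continuous_intros)
    have right: "(\<lambda>t::real. exp (- t\<^sup>2)) integrable_on {0..}"
      using has_integral_gaussian_half_line[of 0] by (auto simp: integrable_on_def)
    show ?thesis by (rule integrable_Un'[OF left right null split])
  qed
  have "(\<lambda>t::real. exp (- t\<^sup>2)) absolutely_integrable_on {min x 0..}"
    using * by (intro nonnegative_absolutely_integrable_1) auto
  then have "(\<lambda>t::real. exp (- t\<^sup>2)) absolutely_integrable_on {x..}"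
    by (rule set_integrable_subset) auto
  then show ?thesis
    using absolutely_integrable_on_def by blast
qed

lemma erfc_real_diff:
  assumes "x \<le> y"
  shows "erfc_real x - erfc_real y = 2 / sqrt pi * integral {x..y} (\<lambda>t. exp (- t\<^sup>2))"
proof -
  have "((\<lambda>t::real. exp (- t\<^sup>2)) has_integral
        (integral {x..y} (\<lambda>t. exp (- t\<^sup>2)) + integral {y..} (\<lambda>t. exp (- t\<^sup>2)))) ({x..y} \<union> {y..})"
  proof (rule has_integral_Un)
    show "((\<lambda>t. exp (- t\<^sup>2)) has_integral integral {x..y} (\<lambda>t. exp (- t\<^sup>2))) {x..y}"
      by (intro integrable_integral integrable_continuous_real continuous_intros)
    have "{x..y} \<inter> {y..} = {y}" using assms by auto
    then show "negligible ({x..y} \<inter> {y..})" by simp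
  qed (intro integrable_integral gaussian_integrable_on_half_line)
  moreover have "{x..y} \<union> {y..} = {x..}" using assms by auto
  ultimately have "integral {x..} (\<lambda>t. exp (- t\<^sup>2)) =
      integral {x..y} (\<lambda>t. exp (- t\<^sup>2)) + integral {y..} (\<lambda>t::real. exp (- t\<^sup>2))"
    by (simp add: integral_unique)
  then show ?thesis
    unfolding erfc_real_def by (simp add: algebra_simps)
qed

lemma erfc_real_0: "erfc_real 0 = 1"
  unfolding erfc_real_def using has_integral_gaussian_half_line[of 0]
  by (simp add: integral_unique)

lemma erfc_real_nonneg: "erfc_real x \<ge> 0"
  unfolding erfc_real_def
  by (intro mult_nonneg_nonneg Henstock_Kurzweil_Integration.integral_nonneg
        gaussian_integrable_on_half_line) auto

text \<open>
  An entire function with derivative \<open>- 2 / sqrt pi * exp (- z\<^sup>2)\<close> and value \<open>1\<close> at the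
  origin restricts to the real function; the identity theorem makes it the only extension.
\<close>

lemma
  shows erfc_of_real: "erfc (of_real x) = of_real (erfc_real x)"
    and has_field_derivative_erfc:
      "(erfc has_field_derivative (- 2 / of_real (sqrt pi) * exp (- z\<^sup>2))) (at z)"
proof -
  obtain g where g: "\<And>z::complex. (g has_field_derivative (exp (- z\<^sup>2))) (at z)"
  proof -
    have "(\<lambda>z::complex. exp (- z\<^sup>2)) holomorphic_on UNIV"
      by (intro holomorphic_intros)
    then show thesis
      using holomorphic_convex_primitive'[of UNIV "\<lambda>z::complex. exp (- z\<^sup>2)"] that by auto
  qed
  define c where "c = complex_of_real (2 / sqrt pi)"
  define f where "f z = 1 - c * (g z - g 0)" for z
  have f': "(f has_field_derivative (- c * exp (- z\<^sup>2))) (at z)" for z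
    unfolding f_def by (auto intro!: derivative_eq_intros g)
  have hol: "f holomorphic_on UNIV"
    using f' by (auto simp: holomorphic_on_def field_differentiable_def)
  have FTC: "f (of_real x) - f (of_real y)
      = of_real (2 / sqrt pi * integral {x..y} (\<lambda>t. exp (- t\<^sup>2)))" if "x \<le> y" for x y
  proof -
    have "((\<lambda>t. - c * exp (- (of_real t)\<^sup>2)) has_integral f (of_real y) - f (of_real x)) {x..y}"
    proof (rule fundamental_theorem_of_calculus[OF that])
      fix t
      show "((\<lambda>x. f (complex_of_real x)) has_vector_derivative - c * exp (- (complex_of_real t)\<^sup>2))
              (at t within {x..y})"
        using has_vector_derivative_real_field[OF f'[of "of_real t"], of "{x..y}"] .
    qed
    moreover have "((\<lambda>t. - c * of_real (exp (- t\<^sup>2))) has_integral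
        - c * of_real (integral {x..y} (\<lambda>t. exp (- t\<^sup>2)))) {x..y}"
      by (intro has_integral_mult_right has_integral_of_real integrable_integral
            integrable_continuous_real continuous_intros)
    ultimately have "f (of_real y) - f (of_real x) = - c * of_real (integral {x..y} (\<lambda>t. exp (- t\<^sup>2)))"
      by (intro has_integral_unique) (simp_all add: exp_of_real[symmetric])
    then show ?thesis by (simp add: c_def algebra_simps)
  qed
  have f0: "f 0 = 1" by (simp add: f_def)
  have f_real: "f (of_real x) = of_real (erfc_real x)" for x
  proof (cases "x \<le> 0")
    case True
    have "f (of_real x) - f (of_real 0) = of_real (erfc_real x - erfc_real 0)"
      unfolding FTC[OF True] erfc_real_diff[OF True] ..
    then show ?thesis using f0 by (simp add: erfc_real_0 algebra_simps)
  next
    case False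
    then have le: "0 \<le> x" by simp
    have "f (of_real 0) - f (of_real x) = of_real (erfc_real 0 - erfc_real x)"
      unfolding FTC[OF le] erfc_real_diff[OF le] ..
    then show ?thesis using f0 by (simp add: erfc_real_0 algebra_simps)
  qed
  have eq: "erfc = f"
    unfolding erfc_def
  proof (rule the_equality)
    fix k assume k: "k holomorphic_on UNIV \<and> (\<forall>x::real. k (of_real x) = of_real (erfc_real x))"
    show "k = f"
    proof
      fix z
      have "k z - f z = 0"
      proof (rule analytic_continuation[of "\<lambda>z. k z - f z" UNIV "\<real>" 0])
        show "(\<lambda>z. k z - f z) holomorphic_on UNIV"
          using k hol by (auto intro: holomorphic_intros)
        show "(0::complex) islimpt \<real>"
        proof (rule islimptI)
          fix T :: "complex set" assume "0 \<in> T" "open T"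
          then obtain e where e: "e > 0" "ball 0 e \<subseteq> T" by (meson openE)
          then have "of_real (e/2) \<in> T" by (auto simp: subset_iff)
          then show "\<exists>y\<in>\<real>. y \<in> T \<and> y \<noteq> 0" using e
            by (intro bexI[of _ "of_real (e/2)"]) auto
        qed
      qed (use k f_real in \<open>auto elim!: Reals_cases\<close>)
      then show "k z = f z" by simp
    qed
  qed (use hol f_real in auto)
  show "erfc (of_real x) = of_real (erfc_real x)"
    using f_real by (simp add: eq)
  show "(erfc has_field_derivative (- 2 / of_real (sqrt pi) * exp (- z\<^sup>2))) (at z)"
    using f'[of z] by (simp add: eq c_def)
qed

lemmas has_field_derivative_erfc' [derivative_intros] =
  has_field_derivative_erfc[THEN DERIV_chain2]

text \<open>
  The function \<open>erfc (- z) + erfc z\<close> has derivative zero.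
\<close>

lemma erfc_minus: "erfc (- z) = 2 - erfc z"
proof -
  have "((\<lambda>z. erfc (- z) + erfc z) has_field_derivative 0) (at w)" for w
    by (auto intro!: derivative_eq_intros)
  then obtain c where "\<And>w. erfc (- w) + erfc w = c"
    using has_field_derivative_zero_constant[of UNIV "\<lambda>z. erfc (- z) + erfc z"] by auto
  from this[of z] this[of 0] have "erfc (- z) + erfc z = erfc 0 + erfc 0" by simp
  moreover have "erfc 0 = 1" using erfc_of_real[of 0] erfc_real_0 by simp
  ultimately show ?thesis by (simp add: algebra_simps)
qed

text \<open>
  For \<open>t \<ge> x \<ge> 0\<close> one has \<open>t\<^sup>2 \<ge> x\<^sup>2 + (t - x)\<^sup>2\<close>, which compares the tail with a translated
  half-line Gaussian.
\<close>

lemma erfc_real_le_exp: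
  assumes "x \<ge> 0"
  shows "erfc_real x \<le> exp (- x\<^sup>2)"
proof -
  have le: "exp (- t\<^sup>2) \<le> exp (- x\<^sup>2) * exp (- (t - x)\<^sup>2)" if "t \<in> {x..}" for t
  proof -
    have "t\<^sup>2 = x\<^sup>2 + (t - x)\<^sup>2 + 2 * x * (t - x)"
      by (simp add: power2_eq_square algebra_simps)
    then have "t\<^sup>2 \<ge> x\<^sup>2 + (t - x)\<^sup>2" using assms that by simp
    then show ?thesis by (simp flip: exp_add)
  qed
  have shifted: "((\<lambda>t. exp (- x\<^sup>2) * exp (- (t - x)\<^sup>2)) has_integral exp (- x\<^sup>2) * (sqrt pi / 2)) {x..}"
    by (intro has_integral_mult_right has_integral_gaussian_half_line)
  have "integral {x..} (\<lambda>t. exp (- t\<^sup>2)) \<le> exp (- x\<^sup>2) * (sqrt pi / 2)"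
    using has_integral_le[OF integrable_integral[OF gaussian_integrable_on_half_line] shifted le] .
  then show ?thesis unfolding erfc_real_def by (simp add: field_simps)
qed

section \<open>The slit plane and the radicand\<close>

lemma open_slit_plane: "open slit_plane"
  unfolding slit_plane_def by (simp add: open_Compl)

lemma slit_plane_iff: "x \<in> slit_plane \<longleftrightarrow> Im x \<noteq> 0 \<or> Re x > 0"
  by (auto simp: slit_plane_def complex_nonpos_Reals_iff)

lemma of_real_in_slit_plane [simp]: "complex_of_real t \<in> slit_plane \<longleftrightarrow> t > 0"
  by (simp add: slit_plane_iff)

lemma slit_plane_nonzero:
  assumes "x \<in> slit_plane"
  shows "x \<noteq> 0" "1 + x \<noteq> 0" "x \<notin> \<real>\<^sub>\<le>\<^sub>0" "1 + x \<notin> \<real>\<^sub>\<le>\<^sub>0"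
  using assms by (auto simp: slit_plane_iff complex_nonpos_Reals_iff complex_eq_iff)

lemma abs_Im_Ln_less_pi: "\<bar>Im (Ln x)\<bar> < pi" if "x \<in> slit_plane"
proof -
  note nz = slit_plane_nonzero[OF that]
  have "Im (Ln x) \<noteq> pi"
    using nz Im_Ln_eq_pi[of x] by (auto simp: complex_nonpos_Reals_iff)
  then show ?thesis using nz mpi_less_Im_Ln[of x] Im_Ln_le_pi[of x] by linarith
qed

lemma exp_in_slit_plane: "exp w \<in> slit_plane" if "\<bar>Im w\<bar> < pi"
proof (cases "Im w = 0")
  case True
  then show ?thesis by (simp add: slit_plane_iff Re_exp)
next
  case False
  moreover have "- pi < Im w" "Im w < pi" using that by linarith+
  ultimately have "sin (Im w) \<noteq> 0" using sin_eq_0_pi by blast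
  then show ?thesis by (simp add: slit_plane_iff Im_exp)
qed

lemma starlike_slit_plane: "starlike slit_plane"
proof -
  have "\<real>\<^sub>\<le>\<^sub>0 = complex_of_real ` {..0}"
    by (auto simp: nonpos_Reals_def)
  then show ?thesis
    using starlike_slotted_complex_plane_left[of 0] by (simp add: slit_plane_def)
qed

lemma simply_connected_slit_plane: "simply_connected slit_plane"
  using starlike_slit_plane by (rule starlike_imp_simply_connected)

lemma saddle_pos: "0 < \<beta> \<Longrightarrow> \<beta> < 1 \<Longrightarrow> saddle \<beta> > 0"
  by (simp add: saddle_def)

lemma saddle_in_slit_plane:
  "0 < \<beta> \<Longrightarrow> \<beta> < 1 \<Longrightarrow> complex_of_real (saddle \<beta>) \<in> slit_plane"
  by (simp add: saddle_pos)

lemma saddle_eqs: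
  assumes "0 < \<beta>" "\<beta> < 1"
  shows "1 + saddle \<beta> = 1 / (1 - \<beta>)" "saddle \<beta> * (1 - \<beta>) = \<beta>"
  using assms by (auto simp: saddle_def field_simps)

lemma holomorphic_radicand: "radicand \<beta> holomorphic_on slit_plane"
  unfolding radicand_def[abs_def] using slit_plane_nonzero
  by (auto intro!: holomorphic_intros)

text \<open>The only critical point of the radicand is the saddle point.\<close>

lemma has_field_derivative_radicand:
  assumes "0 < \<beta>" "\<beta> < 1" "x \<in> slit_plane"
  shows "(radicand \<beta> has_field_derivative
           of_real (1 - \<beta>) * (x - of_real (saddle \<beta>)) / (x * (1 + x))) (at x)"
proof -
  have "(radicand \<beta> has_field_derivative (1 / (1 + x) - of_real \<beta> / x)) (at x)"
    unfolding radicand_def[abs_def] using slit_plane_nonzero[OF assms(3)]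
    by (auto intro!: derivative_eq_intros simp: field_simps)
  also have "1 / (1 + x) - of_real \<beta> / x = (of_real (1 - \<beta>) * x - of_real \<beta>) / (x * (1 + x))"
    using slit_plane_nonzero[OF assms(3)] by (simp add: divide_simps) (simp add: algebra_simps)
  also have "of_real (1 - \<beta>) * x - of_real \<beta> = of_real (1 - \<beta>) * (x - of_real (saddle \<beta>))"
    using saddle_eqs(2)[OF assms(1,2)] by (metis mult.commute of_real_mult right_diff_distrib)
  finally show ?thesis .
qed

definition real_radicand :: "real \<Rightarrow> real \<Rightarrow> real" where
  "real_radicand \<beta> t = ln (1 + t) - \<beta> * ln t - h \<beta>"

lemma radicand_of_real: "t > 0 \<Longrightarrow> radicand \<beta> (of_real t) = of_real (real_radicand \<beta> t)"
  using Ln_of_real[of t] Ln_of_real[of "1 + t"] by (simp add: radicand_def real_radicand_def)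

lemma Re_radicand:
  assumes "x \<in> slit_plane"
  shows "Re (radicand \<beta> x) = ln (norm (1 + x)) - \<beta> * ln (norm x) - h \<beta>"
  using slit_plane_nonzero[OF assms] by (simp add: radicand_def)

lemma has_real_derivative_real_radicand:
  assumes "0 < \<beta>" "\<beta> < 1" "t > 0"
  shows "(real_radicand \<beta> has_real_derivative (1 - \<beta>) * (t - saddle \<beta>) / (t * (1 + t))) (at t)"
proof -
  have "(real_radicand \<beta> has_real_derivative (1 / (1 + t) - \<beta> / t)) (at t)"
    unfolding real_radicand_def[abs_def] using assms
    by (auto intro!: derivative_eq_intros simp: field_simps)
  also have "1 / (1 + t) - \<beta> / t = ((1 - \<beta>) * t - \<beta>) / (t * (1 + t))"
    using assms by (simp add: divide_simps) (simp add: algebra_simps)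
  also have "(1 - \<beta>) * t - \<beta> = (1 - \<beta>) * (t - saddle \<beta>)"
    using saddle_eqs(2)[OF assms(1,2)] by (simp add: algebra_simps)
  finally show ?thesis .
qed

lemma real_radicand_saddle:
  assumes "0 < \<beta>" "\<beta> < 1"
  shows "real_radicand \<beta> (saddle \<beta>) = 0"
proof -
  have e: "ln (1 + saddle \<beta>) = - ln (1 - \<beta>)" "ln (saddle \<beta>) = ln \<beta> - ln (1 - \<beta>)"
    using assms saddle_eqs[OF assms] by (simp_all add: ln_div saddle_def)
  show ?thesis unfolding real_radicand_def h_def e by (simp add: algebra_simps)
qed

lemma real_radicand_strict_mono:
  assumes "0 < \<beta>" "\<beta> < 1" "saddle \<beta> \<le> t" "t < u"
  shows "real_radicand \<beta> t < real_radicand \<beta> u"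
proof (rule DERIV_pos_imp_increasing_open[OF assms(4)])
  have s: "saddle \<beta> > 0" by (rule saddle_pos[OF assms(1,2)])
  show "\<exists>y. (real_radicand \<beta> has_real_derivative y) (at x) \<and> y > 0" if "t < x" "x < u" for x
    using that assms s has_real_derivative_real_radicand[of \<beta> x]
    by (intro exI[of _ "(1 - \<beta>) * (x - saddle \<beta>) / (x * (1 + x))"]) auto
  show "continuous_on {t..u} (real_radicand \<beta>)"
    using assms s
    by (auto intro!: continuous_at_imp_continuous_on DERIV_isCont has_real_derivative_real_radicand)
qed

lemma real_radicand_strict_antimono:
  assumes "0 < \<beta>" "\<beta> < 1" "u \<le> saddle \<beta>" "0 < t" "t < u"
  shows "real_radicand \<beta> t > real_radicand \<beta> u"
proof (rule DERIV_neg_imp_decreasing_open[OF assms(5)])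
  show "\<exists>y. (real_radicand \<beta> has_real_derivative y) (at x) \<and> y < 0" if "t < x" "x < u" for x
    using that assms has_real_derivative_real_radicand[of \<beta> x]
    by (intro exI[of _ "(1 - \<beta>) * (x - saddle \<beta>) / (x * (1 + x))"])
      (auto intro!: divide_neg_pos mult_pos_neg)
  show "continuous_on {t..u} (real_radicand \<beta>)"
    using assms
    by (auto intro!: continuous_at_imp_continuous_on DERIV_isCont has_real_derivative_real_radicand)
qed

lemma real_radicand_pos:
  assumes "0 < \<beta>" "\<beta> < 1" "t > 0" "t \<noteq> saddle \<beta>"
  shows "real_radicand \<beta> t > 0"
  using real_radicand_strict_mono[of \<beta> "saddle \<beta>" t] assms real_radicand_saddle[of \<beta>]
    real_radicand_strict_antimono[of \<beta> "saddle \<beta>" t] by (cases "t < saddle \<beta>") auto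

text \<open>
  The numerator \<open>x * cos x - sin x\<close> of the derivative vanishes at \<open>0\<close> and decreases, its own
  derivative being \<open>- x * sin x\<close>.
\<close>

lemma sinc_strict_antimono:
  assumes "0 < (a::real)" "a < b" "b < pi"
  shows "sin b / b < sin a / a"
proof (rule DERIV_neg_imp_decreasing_open[OF assms(2)])
  fix x assume x: "a < x" "x < b"
  have "x * cos x - sin x < 0 * cos 0 - sin 0"
  proof (rule DERIV_neg_imp_decreasing_open[of 0 x])
    show "\<exists>y. ((\<lambda>x. x * cos x - sin x) has_real_derivative y) (at z) \<and> y < 0"
      if "0 < z" "z < x" for z
    proof (intro exI conjI)
      show "((\<lambda>x. x * cos x - sin x) has_real_derivative (- z * sin z)) (at z)"
        by (auto intro!: derivative_eq_intros)
      show "- z * sin z < 0" using that x assms by (simp add: sin_gt_zero)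
    qed
  qed (use x assms in \<open>auto intro!: continuous_intros\<close>)
  then have "(x * cos x - sin x) / x\<^sup>2 < 0"
    using x assms by (simp add: divide_neg_pos)
  moreover have "((\<lambda>x. sin x / x) has_real_derivative (x * cos x - sin x) / x\<^sup>2) (at x)"
    using x assms by (auto intro!: derivative_eq_intros simp: power2_eq_square)
  ultimately show "\<exists>y. ((\<lambda>x. sin x / x) has_real_derivative y) (at x) \<and> y < 0" by blast
qed (use assms in \<open>auto intro!: continuous_intros\<close>)

text \<open>
  If the radicand vanishes at \<open>x\<close> with argument \<open>t\<close>, then \<open>1 + x\<close> has argument \<open>\<beta> * t\<close>, and the
  triangle with vertices \<open>0\<close>, \<open>1\<close>, \<open>1 + x\<close> has known angles. The law of sines expresses both
  moduli through \<open>t\<close>, and the real part of the equation becomes a relation between the values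
  of \<open>ln (sin t / t)\<close> at \<open>t\<close>, \<open>\<beta> * t\<close> and \<open>(1 - \<beta>) * t\<close> that contradicts monotonicity.
\<close>

lemma radicand_nonzero_off_real:
  assumes b: "0 < \<beta>" "\<beta> < 1" and x: "Im x \<noteq> 0"
  shows "radicand \<beta> x \<noteq> 0"
proof
  assume 0: "radicand \<beta> x = 0"
  have xs: "x \<in> slit_plane" using x by (simp add: slit_plane_iff)
  note nz = slit_plane_nonzero[OF xs]
  define \<theta> where "\<theta> = Im (Ln x)"
  define R where "R = norm x"
  define r1 where "r1 = norm (1 + x)"
  have R: "R > 0" and r1: "r1 > 0" using nz by (auto simp: R_def r1_def)
  have xe: "x = of_real R * exp (\<i> * of_real \<theta>)"
  proof -
    have "x = exp (Ln x)" using nz by simp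
    also have "Ln x = of_real (ln R) + \<i> * of_real \<theta>"
      using nz by (simp add: complex_eq_iff \<theta>_def R_def)
    finally show ?thesis using R by (simp add: exp_add exp_of_real)
  qed
  have L: "Ln (1 + x) = of_real \<beta> * Ln x + of_real (h \<beta>)"
    using 0 by (simp add: radicand_def algebra_simps)
  have lnr1: "ln r1 = \<beta> * ln R + h \<beta>"
    using arg_cong[OF L, of Re] nz by (simp add: r1_def R_def)
  have "1 + x = exp (Ln (1 + x))" using nz by simp
  also have "Ln (1 + x) = of_real (ln r1) + \<i> * of_real (\<beta> * \<theta>)"
    using nz arg_cong[OF L, of Im] by (simp add: complex_eq_iff \<theta>_def r1_def)
  finally have xe1: "1 + x = of_real r1 * exp (\<i> * of_real (\<beta> * \<theta>))"
    using r1 by (simp add: exp_add exp_of_real)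
  have im: "R * sin \<theta> = r1 * sin (\<beta> * \<theta>)" and re: "1 + R * cos \<theta> = r1 * cos (\<beta> * \<theta>)"
    using arg_cong[OF xe1, of Im] arg_cong[OF xe1, of Re] xe
    by (simp_all add: Re_exp Im_exp)
  have im': "sin \<theta> = r1 * sin ((1 - \<beta>) * \<theta>)"
  proof -
    have "r1 * sin ((1 - \<beta>) * \<theta>) = sin \<theta> * (r1 * cos (\<beta> * \<theta>)) - cos \<theta> * (r1 * sin (\<beta> * \<theta>))"
      by (simp add: left_diff_distrib sin_diff algebra_simps)
    also have "\<dots> = sin \<theta>" by (simp add: algebra_simps flip: im re)
    finally show ?thesis by simp
  qed
  define t where "t = \<bar>\<theta>\<bar>"
  have "\<theta> \<noteq> 0" using xe x by auto
  moreover have "\<bar>\<theta>\<bar> < pi" unfolding \<theta>_def by (rule abs_Im_Ln_less_pi[OF xs])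
  ultimately have t: "0 < t" "t < pi" by (auto simp: t_def)
  have im2: "R * sin t = r1 * sin (\<beta> * t)" and im2': "sin t = r1 * sin ((1 - \<beta>) * t)"
    using im im' by (auto simp: t_def abs_if)
  have bt: "0 < \<beta> * t" "\<beta> * t < t" "0 < (1 - \<beta>) * t" "(1 - \<beta>) * t < t" using b t by auto
  then have "\<beta> * t < pi" "(1 - \<beta>) * t < pi" using t by linarith+
  have pos: "sin t > 0" "sin (\<beta> * t) > 0" "sin ((1 - \<beta>) * t) > 0"
    using bt t \<open>\<beta> * t < pi\<close> \<open>(1 - \<beta>) * t < pi\<close> by (auto intro!: sin_gt_zero)
  define k where "k u = ln (sin u / u)" for u :: real
  have lnsin: "ln (sin t) = k t + ln t" "ln (sin (\<beta> * t)) = k (\<beta> * t) + ln \<beta> + ln t"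
    "ln (sin ((1 - \<beta>) * t)) = k ((1 - \<beta>) * t) + ln (1 - \<beta>) + ln t"
    unfolding k_def using pos t b by (simp_all add: ln_div ln_mult)
  have e1: "ln R + ln (sin t) = ln r1 + ln (sin (\<beta> * t))"
    using arg_cong[OF im2, of ln] R r1 pos by (simp add: ln_mult)
  have e2: "ln (sin t) = ln r1 + ln (sin ((1 - \<beta>) * t))"
    using arg_cong[OF im2', of ln] r1 pos by (simp add: ln_mult)
  have "k t = (1 - \<beta>) * k ((1 - \<beta>) * t) + \<beta> * k (\<beta> * t)"
  proof -
    have "ln R = ln (sin (\<beta> * t)) - ln (sin ((1 - \<beta>) * t))" using e1 e2 by simp
    then have "ln (sin t) = \<beta> * (ln (sin (\<beta> * t)) - ln (sin ((1 - \<beta>) * t))) + h \<beta> + ln (sin ((1 - \<beta>) * t))"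
      using e2 lnr1 by simp
    then show ?thesis unfolding lnsin h_def by (simp add: algebra_simps)
  qed
  moreover have "k t < k (\<beta> * t)" "k t < k ((1 - \<beta>) * t)"
    unfolding k_def using sinc_strict_antimono bt t pos by (auto intro!: ln_less_cancel_iff[THEN iffD2])
  then have "(1 - \<beta>) * k t < (1 - \<beta>) * k ((1 - \<beta>) * t)" "\<beta> * k t < \<beta> * k (\<beta> * t)"
    using b by auto
  ultimately show False by (simp add: algebra_simps)
qed

lemma radicand_eq_0_iff:
  assumes "0 < \<beta>" "\<beta> < 1" "x \<in> slit_plane"
  shows "radicand \<beta> x = 0 \<longleftrightarrow> x = of_real (saddle \<beta>)"
proof (cases "Im x = 0")
  case True
  then obtain t where t: "x = of_real t" by (metis complex_is_Real_iff Reals_cases)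
  then have "t > 0" using assms by simp
  have "real_radicand \<beta> t = 0 \<longleftrightarrow> t = saddle \<beta>"
    using real_radicand_pos[OF assms(1,2) \<open>t > 0\<close>] real_radicand_saddle[OF assms(1,2)] by force
  then show ?thesis using radicand_of_real[OF \<open>t > 0\<close>] t by simp
qed (use radicand_nonzero_off_real assms in auto)

section \<open>Divided differences\<close>

definition divided_diff :: "(complex \<Rightarrow> complex) \<Rightarrow> complex \<Rightarrow> complex \<Rightarrow> complex" where
  "divided_diff f a x = (if x = a then deriv f a else (f x - f a) / (x - a))"

text \<open>
  The singularity at the base point is removable, which is how the coefficients of the expansion
  extend analytically across the saddle point.
\<close>

lemma holomorphic_divided_diff:
  assumes "f holomorphic_on S" "open S" "a \<in> S"
  shows "divided_diff f a holomorphic_on S"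
  unfolding divided_diff_def[abs_def] using pole_lemma[of f S a] assms by (simp add: interior_open)

lemma divided_diff_mult: "(x - a) * divided_diff f a x = f x - f a"
  by (simp add: divided_diff_def)

lemma holomorphic_eq_at_point:
  assumes "f holomorphic_on S" "g holomorphic_on S" "open S" "a \<in> S"
    and eq: "\<And>x. x \<in> S \<Longrightarrow> x \<noteq> a \<Longrightarrow> f x = g x"
  shows "f a = g a"
proof -
  have "(f \<longlongrightarrow> f a) (at a)" "(g \<longlongrightarrow> g a) (at a)"
    using assms by (auto simp: isCont_def[symmetric]
        dest!: holomorphic_on_imp_continuous_on simp: continuous_on_eq_continuous_at)
  moreover have "eventually (\<lambda>x. x \<in> S \<and> x \<noteq> a) (at a)"
    using assms by (simp add: eventually_at_topological) blast
  then have "eventually (\<lambda>x. f x = g x) (at a)"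
    by eventually_elim (use eq in auto)
  ultimately show ?thesis
    by (metis LIM_unique tendsto_cong)
qed

section \<open>The analytic square root of the radicand\<close>

text \<open>
  The factor left after the double zero at the saddle point has been removed. It has no zeros, so
  it has an analytic square root on the simply connected slit plane.
\<close>

definition radicand_quotient :: "real \<Rightarrow> complex \<Rightarrow> complex" where
  "radicand_quotient \<beta> =
     divided_diff (divided_diff (radicand \<beta>) (of_real (saddle \<beta>))) (of_real (saddle \<beta>))"

lemma square_eq_pos_real:
  assumes "(z::complex)\<^sup>2 = of_real p" "p > 0"
  shows "Im z = 0" "Re z \<noteq> 0" "z = of_real (Re z)"
proof -
  have re: "Re z * Re z - Im z * Im z = p" and im: "Re z * Im z = 0"
    using assms(1) by (auto simp: power2_eq_square complex_eq_iff)
  have "Re z \<noteq> 0"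
  proof
    assume "Re z = 0"
    then show False using re assms(2) zero_le_square[of "Im z"] by simp
  qed
  then show "Im z = 0" "Re z \<noteq> 0" "z = of_real (Re z)" using im by (auto simp: complex_eq_iff)
qed

context
  fixes \<beta> :: real
  assumes b: "0 < \<beta>" "\<beta> < 1"
begin

abbreviation "csaddle \<equiv> complex_of_real (saddle \<beta>)"

lemma radicand_saddle: "radicand \<beta> csaddle = 0"
  using radicand_eq_0_iff[OF b] saddle_in_slit_plane[OF b] by simp

lemma deriv_radicand_saddle: "deriv (radicand \<beta>) csaddle = 0"
  using has_field_derivative_radicand[OF b saddle_in_slit_plane[OF b]] by (simp add: DERIV_imp_deriv)

lemma holomorphic_radicand_quotient: "radicand_quotient \<beta> holomorphic_on slit_plane"
  unfolding radicand_quotient_def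
  by (intro holomorphic_divided_diff holomorphic_radicand open_slit_plane saddle_in_slit_plane b)

lemma radicand_eq_quotient: "radicand \<beta> x = (x - csaddle)\<^sup>2 * radicand_quotient \<beta> x"
proof -
  have "(x - csaddle)\<^sup>2 * radicand_quotient \<beta> x = (x - csaddle) * ((x - csaddle) * radicand_quotient \<beta> x)"
    by (simp add: power2_eq_square)
  also have "\<dots> = (x - csaddle) * divided_diff (radicand \<beta>) csaddle x"
    unfolding radicand_quotient_def divided_diff_mult
    by (simp add: divided_diff_def[of _ csaddle csaddle] deriv_radicand_saddle divided_diff_mult)
  finally show ?thesis by (simp add: divided_diff_mult radicand_saddle)
qed

text \<open>
  Half the second derivative of the radicand, read off from the first derivative: dividing the
  derivative of \<open>(x - s)\<^sup>2 * k x\<close> by \<open>x - s\<close> gives an identity that extends by continuity to \<open>s\<close>.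
\<close>

lemma radicand_quotient_saddle:
  "radicand_quotient \<beta> csaddle = of_real ((1 - \<beta>) / (2 * saddle \<beta> * (1 + saddle \<beta>)))"
proof -
  let ?k = "radicand_quotient \<beta>"
  note hol = holomorphic_radicand_quotient
  have "2 * ?k csaddle + (csaddle - csaddle) * deriv ?k csaddle = of_real (1 - \<beta>) / (csaddle * (1 + csaddle))"
  proof (rule holomorphic_eq_at_point[of "\<lambda>x. 2 * ?k x + (x - csaddle) * deriv ?k x" slit_plane
        "\<lambda>x. of_real (1 - \<beta>) / (x * (1 + x))" csaddle])
    show "(\<lambda>x. 2 * ?k x + (x - csaddle) * deriv ?k x) holomorphic_on slit_plane"
      by (intro holomorphic_intros hol open_slit_plane)
    show "(\<lambda>x. of_real (1 - \<beta>) / (x * (1 + x))) holomorphic_on slit_plane"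
      using slit_plane_nonzero by (auto intro!: holomorphic_intros)
    fix x assume x: "x \<in> slit_plane" "x \<noteq> csaddle"
    have "((\<lambda>x. (x - csaddle)\<^sup>2 * ?k x) has_field_derivative
        (2 * (x - csaddle) * ?k x + (x - csaddle)\<^sup>2 * deriv ?k x)) (at x)"
      using holomorphic_derivI[OF hol open_slit_plane x(1)]
      by (auto intro!: derivative_eq_intros)
    then have "2 * (x - csaddle) * ?k x + (x - csaddle)\<^sup>2 * deriv ?k x
        = of_real (1 - \<beta>) * (x - csaddle) / (x * (1 + x))"
      using has_field_derivative_radicand[OF b x(1)] DERIV_unique
      by (simp flip: radicand_eq_quotient)
    then have "(x - csaddle) * (2 * ?k x + (x - csaddle) * deriv ?k x) = (x - csaddle) * (of_real (1 - \<beta>) / (x * (1 + x)))"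
      by (simp add: algebra_simps power2_eq_square)
    then show "2 * ?k x + (x - csaddle) * deriv ?k x = of_real (1 - \<beta>) / (x * (1 + x))"
      using x(2) by (simp only: mult_cancel_left) auto
  qed (simp_all add: open_slit_plane saddle_pos b)
  from arg_cong[OF this, of "\<lambda>z. z / 2"] show ?thesis by (simp add: mult_ac)
qed

lemma radicand_quotient_real:
  assumes "t > 0"
  obtains p where "p > 0" "radicand_quotient \<beta> (of_real t) = of_real p"
proof (cases "t = saddle \<beta>")
  case True
  then show ?thesis
    using that[of "(1 - \<beta>) / (2 * saddle \<beta> * (1 + saddle \<beta>))"] radicand_quotient_saddle b saddle_pos[OF b]
    by simp
next
  case False
  have "(of_real t - csaddle)\<^sup>2 * radicand_quotient \<beta> (of_real t) = of_real (real_radicand \<beta> t)"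
    using radicand_eq_quotient[of "of_real t"] radicand_of_real[OF assms, of \<beta>] by simp
  then have "radicand_quotient \<beta> (of_real t) = of_real (real_radicand \<beta> t / (t - saddle \<beta>)\<^sup>2)"
    using False by (simp add: field_simps flip: of_real_diff)
  then show ?thesis using that real_radicand_pos[OF b assms False] False
    by (meson divide_pos_pos zero_less_power2 right_minus_eq)
qed

text \<open>
  A continuous function on the positive reals whose square is positive has constant sign; this
  decides the sign of the square root on both sides of the saddle point.
\<close>

lemma sqrt_radicand_quotient_sign:
  assumes hol: "w holomorphic_on slit_plane"
    and sq: "\<And>x. x \<in> slit_plane \<Longrightarrow> (w x)\<^sup>2 = radicand_quotient \<beta> x"
    and "t > 0" "u > 0" "Re (w (of_real t)) > 0"
  shows "Im (w (of_real u)) = 0" "Re (w (of_real u)) > 0"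
proof -
  have real: "Im (w (of_real t)) = 0 \<and> Re (w (of_real t)) \<noteq> 0" if "t > 0" for t
    using sq[of "of_real t"] radicand_quotient_real[OF that] that
    by (metis of_real_in_slit_plane square_eq_pos_real(1,2))
  show "Im (w (of_real u)) = 0" using real assms by blast
  have cont: "continuous_on {0<..} (\<lambda>t. Re (w (of_real t)))"
    by (intro continuous_on_Re continuous_on_compose2[OF holomorphic_on_imp_continuous_on[OF hol]]
        continuous_intros) auto
  show "Re (w (of_real u)) > 0"
  proof (rule ccontr)
    assume "\<not> ?thesis"
    then have "Re (w (of_real u)) < 0" using real[OF assms(4)] by auto
    moreover have "connected ((\<lambda>t. Re (w (of_real t))) ` {0<..})"
      by (intro connected_continuous_image cont) auto
    ultimately have "0 \<in> (\<lambda>t. Re (w (of_real t))) ` {0<..}"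
      using assms(3,4,5) unfolding connected_iff_interval
      by (meson greaterThan_iff image_eqI less_imp_le)
    then show False using real by auto
  qed
qed

lemma rho_exists:
  "\<exists>g. g holomorphic_on slit_plane \<and> (\<forall>x\<in>slit_plane. (g x)\<^sup>2 = radicand \<beta> x) \<and>
       (\<forall>t::real. t > saddle \<beta> \<longrightarrow> Im (g (of_real t)) = 0 \<and> Re (g (of_real t)) > 0)"
proof -
  have nz: "radicand_quotient \<beta> x \<noteq> 0" if "x \<in> slit_plane" for x
  proof (cases "x = csaddle")
    case True
    then show ?thesis using radicand_quotient_real[OF saddle_pos[OF b]] by (metis less_irrefl of_real_eq_0_iff)
  next
    case False
    then show ?thesis using radicand_eq_quotient[of x] radicand_eq_0_iff[OF b that] by auto
  qed
  obtain w0 where w0: "w0 holomorphic_on slit_plane"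
      "\<And>x. x \<in> slit_plane \<Longrightarrow> radicand_quotient \<beta> x = (w0 x)\<^sup>2"
    using simply_connected_imp_holomorphic_sqrt[OF holomorphic_radicand_quotient
        simply_connected_slit_plane open_imp_locally_path_connected[OF open_slit_plane] nz] by blast
  \<comment> \<open>The sign of the root is fixed at one positive point.\<close>
  define w where "w = (if Re (w0 1) > 0 then w0 else (\<lambda>x. - w0 x))"
  have w: "w holomorphic_on slit_plane" "\<And>x. x \<in> slit_plane \<Longrightarrow> (w x)\<^sup>2 = radicand_quotient \<beta> x"
    using w0 by (auto simp: w_def intro: holomorphic_intros)
  have "Re (w0 1) \<noteq> 0"
    using w0(2)[of 1] radicand_quotient_real[of 1]
    by (metis of_real_1 of_real_in_slit_plane square_eq_pos_real(2) zero_less_one)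
  then have "Re (w (of_real 1)) > 0" by (auto simp: w_def)
  from sqrt_radicand_quotient_sign[OF w zero_less_one _ this]
  have sgn: "u > 0 \<Longrightarrow> Im (w (of_real u)) = 0 \<and> Re (w (of_real u)) > 0" for u by blast
  show ?thesis
  proof (intro exI[of _ "\<lambda>x. (x - csaddle) * w x"] conjI ballI allI impI)
    show "(\<lambda>x. (x - csaddle) * w x) holomorphic_on slit_plane"
      by (intro holomorphic_intros w)
    show "((x - csaddle) * w x)\<^sup>2 = radicand \<beta> x" if "x \<in> slit_plane" for x
      using w(2)[OF that] radicand_eq_quotient[of x] by (simp add: power_mult_distrib)
    fix t assume "t > saddle \<beta>"
    then show "Im ((of_real t - csaddle) * w (of_real t)) = 0" "Re ((of_real t - csaddle) * w (of_real t)) > 0"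
      using sgn[of t] saddle_pos[OF b] by auto
  qed
qed

lemma holomorphic_rho: "rho \<beta> holomorphic_on slit_plane"
  and rho_square: "\<And>x. x \<in> slit_plane \<Longrightarrow> (rho \<beta> x)\<^sup>2 = radicand \<beta> x"
  and rho_sign: "\<And>t. t > saddle \<beta> \<Longrightarrow> Im (rho \<beta> (of_real t)) = 0 \<and> Re (rho \<beta> (of_real t)) > 0"
  using someI_ex[OF rho_exists] unfolding rho_def[symmetric] by blast+

lemma rho_eq_0_iff: "x \<in> slit_plane \<Longrightarrow> rho \<beta> x = 0 \<longleftrightarrow> x = csaddle"
  using rho_square radicand_eq_0_iff[OF b] by (metis zero_eq_power2)

text \<open>
  The argument starts from the defining properties of \<^const>\<open>rho\<close> alone, so it does not matter
  which square root the choice operator picks.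
\<close>

lemma rho_quotient:
  defines "w \<equiv> divided_diff (rho \<beta>) csaddle"
  shows rho_eq_quotient: "rho \<beta> x = (x - csaddle) * w x"
    and rho_quotient_pos: "t > 0 \<Longrightarrow> Im (w (of_real t)) = 0 \<and> Re (w (of_real t)) > 0"
    and rho_quotient_square: "x \<in> slit_plane \<Longrightarrow> (w x)\<^sup>2 = radicand_quotient \<beta> x"
proof -
  have S: "csaddle \<in> slit_plane" by (rule saddle_in_slit_plane[OF b])
  have hol: "w holomorphic_on slit_plane"
    unfolding w_def by (intro holomorphic_divided_diff holomorphic_rho open_slit_plane S)
  show eq: "rho \<beta> x = (x - csaddle) * w x" for x
    using rho_eq_0_iff[OF S] by (simp add: w_def divided_diff_mult)
  have sq_ne: "(w x)\<^sup>2 = radicand_quotient \<beta> x" if "x \<in> slit_plane" "x \<noteq> csaddle" for x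
  proof -
    have "(x - csaddle)\<^sup>2 * (w x)\<^sup>2 = (x - csaddle)\<^sup>2 * radicand_quotient \<beta> x"
      using rho_square[OF that(1)] by (simp add: eq radicand_eq_quotient power_mult_distrib)
    then show ?thesis using that by simp
  qed
  moreover have "(w csaddle)\<^sup>2 = radicand_quotient \<beta> csaddle"
    by (rule holomorphic_eq_at_point[of "\<lambda>x. (w x)\<^sup>2" slit_plane])
      (auto intro!: holomorphic_intros hol holomorphic_radicand_quotient sq_ne open_slit_plane saddle_pos b)
  ultimately show sq: "(w x)\<^sup>2 = radicand_quotient \<beta> x" if "x \<in> slit_plane" for x
    using that by (cases "x = csaddle") auto
  have "Re (w (of_real (saddle \<beta> + 1))) > 0"
    using rho_sign[of "saddle \<beta> + 1"] by (simp add: eq)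
  from sqrt_radicand_quotient_sign[OF hol sq _ _ this] saddle_pos[OF b]
  show "t > 0 \<Longrightarrow> Im (w (of_real t)) = 0 \<and> Re (w (of_real t)) > 0" for t
    by auto
qed

lemma rho_of_real:
  assumes "t > 0"
  shows "rho \<beta> (of_real t) = of_real (sgn (t - saddle \<beta>) * sqrt (real_radicand \<beta> t))"
proof -
  define v where "v = Re (divided_diff (rho \<beta>) csaddle (of_real t))"
  have v: "v > 0" "divided_diff (rho \<beta>) csaddle (of_real t) = of_real v"
    using rho_quotient_pos[OF assms] by (auto simp: v_def complex_eq_iff)
  have eq: "rho \<beta> (of_real t) = of_real ((t - saddle \<beta>) * v)"
    using rho_eq_quotient[of "of_real t"] v by simp
  then have "of_real (((t - saddle \<beta>) * v)\<^sup>2) = complex_of_real (real_radicand \<beta> t)"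
    using rho_square[of "of_real t"] radicand_of_real[OF assms] assms by simp
  then have "((t - saddle \<beta>) * v)\<^sup>2 = real_radicand \<beta> t" by (simp only: of_real_eq_iff)
  then have "sqrt (real_radicand \<beta> t) = \<bar>t - saddle \<beta>\<bar> * v"
    using v by (metis abs_mult abs_of_pos real_sqrt_abs)
  then have "sgn (t - saddle \<beta>) * sqrt (real_radicand \<beta> t) = (t - saddle \<beta>) * v"
    by (simp add: sgn_mult_abs flip: mult.assoc)
  then show ?thesis using eq by simp
qed

lemma deriv_rho_saddle:
  "deriv (rho \<beta>) csaddle = of_real ((1 - \<beta>) * sqrt ((1 - \<beta>) / (2 * \<beta>)))"
proof -
  define v where "v = Re (divided_diff (rho \<beta>) csaddle csaddle)"
  have v: "v > 0" "divided_diff (rho \<beta>) csaddle csaddle = of_real v"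
    using rho_quotient_pos[OF saddle_pos[OF b]] by (auto simp: v_def complex_eq_iff)
  have "complex_of_real (v\<^sup>2) = of_real ((1 - \<beta>) / (2 * saddle \<beta> * (1 + saddle \<beta>)))"
    using rho_quotient_square[of csaddle] radicand_quotient_saddle saddle_pos[OF b] v(2) by simp
  then have "v\<^sup>2 = (1 - \<beta>) / (2 * saddle \<beta> * (1 + saddle \<beta>))" by (simp only: of_real_eq_iff)
  also have "\<dots> = (1 - \<beta>)\<^sup>2 * ((1 - \<beta>) / (2 * \<beta>))"
    unfolding saddle_eqs(1)[OF b] using b by (simp add: saddle_def power2_eq_square)
  finally have "v = sqrt ((1 - \<beta>)\<^sup>2 * ((1 - \<beta>) / (2 * \<beta>)))" using v(1) real_sqrt_unique by fastforce
  then have "v = (1 - \<beta>) * sqrt ((1 - \<beta>) / (2 * \<beta>))" using b by (simp only: real_sqrt_mult) simp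
  then show ?thesis using v(2) by (simp add: divided_diff_def)
qed

end

section \<open>Holomorphic families with bounds uniform in the parameter\<close>

text \<open>
  Uniformity in \<open>\<beta>\<close> is obtained from bounds alone: boundedness on compact sets survives
  differentiation (Cauchy) and division by a zero (maximum principle), and
  these two operations generate all coefficients of the expansion.
\<close>

definition uniform_family :: "(real \<Rightarrow> complex \<Rightarrow> complex) \<Rightarrow> bool" where
  "uniform_family f \<longleftrightarrow>
     (\<forall>\<beta>. 0 < \<beta> \<and> \<beta> < 1 \<longrightarrow> f \<beta> holomorphic_on slit_plane) \<and>
     (\<forall>b1 b2 K. 0 < b1 \<and> b2 < 1 \<and> compact K \<and> K \<subseteq> slit_plane \<longrightarrow>
        (\<exists>C. \<forall>\<beta>\<in>{b1..b2}. \<forall>x\<in>K. norm (f \<beta> x) \<le> C))"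

lemma uniform_familyI:
  assumes "\<And>\<beta>. 0 < \<beta> \<Longrightarrow> \<beta> < 1 \<Longrightarrow> f \<beta> holomorphic_on slit_plane"
    and "\<And>b1 b2 K. 0 < b1 \<Longrightarrow> b2 < 1 \<Longrightarrow> compact K \<Longrightarrow> K \<subseteq> slit_plane \<Longrightarrow>
           \<exists>C. \<forall>\<beta>\<in>{b1..b2}. \<forall>x\<in>K. norm (f \<beta> x) \<le> C"
  shows "uniform_family f"
  using assms unfolding uniform_family_def by blast

lemma uniform_family_holomorphic:
  "uniform_family f \<Longrightarrow> 0 < \<beta> \<Longrightarrow> \<beta> < 1 \<Longrightarrow> f \<beta> holomorphic_on slit_plane"
  unfolding uniform_family_def by blast

lemma uniform_family_bounded:
  assumes "uniform_family f" "0 < b1" "b2 < 1" "compact K" "K \<subseteq> slit_plane"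
  obtains C where "C > 0" "\<And>\<beta> x. \<beta> \<in> {b1..b2} \<Longrightarrow> x \<in> K \<Longrightarrow> norm (f \<beta> x) \<le> C"
proof -
  obtain C where C: "\<forall>\<beta>\<in>{b1..b2}. \<forall>x\<in>K. norm (f \<beta> x) \<le> C"
    using assms unfolding uniform_family_def by blast
  show ?thesis
    by (rule that[of "max C 1"]) (use C in \<open>auto intro: max.coboundedI1\<close>)
qed

lemma uniform_family_fixed:
  assumes "g holomorphic_on slit_plane"
  shows "uniform_family (\<lambda>_. g)"
proof (rule uniform_familyI)
  fix K :: "complex set" assume "compact K" "K \<subseteq> slit_plane"
  then have "bounded (g ` K)"
    by (meson assms compact_continuous_image compact_imp_bounded continuous_on_subset
        holomorphic_on_imp_continuous_on)
  then obtain C where "\<forall>x\<in>K. norm (g x) \<le> C" by (auto simp: bounded_iff)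
  then show "\<exists>C. \<forall>\<beta>\<in>{b1..b2}. \<forall>x\<in>K. norm (g x) \<le> C" for b1 b2 :: real by blast
qed (use assms in auto)

lemma uniform_family_mult:
  assumes "uniform_family f" "uniform_family g"
  shows "uniform_family (\<lambda>\<beta> x. f \<beta> x * g \<beta> x)"
proof (rule uniform_familyI)
  fix b1 b2 :: real and K assume H: "0 < b1" "b2 < 1" "compact K" "K \<subseteq> slit_plane"
  obtain C where C: "C > 0" "\<And>\<beta> x. \<beta> \<in> {b1..b2} \<Longrightarrow> x \<in> K \<Longrightarrow> norm (f \<beta> x) \<le> C"
    using uniform_family_bounded[OF assms(1) H] by metis
  obtain D where D: "D > 0" "\<And>\<beta> x. \<beta> \<in> {b1..b2} \<Longrightarrow> x \<in> K \<Longrightarrow> norm (g \<beta> x) \<le> D"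
    using uniform_family_bounded[OF assms(2) H] by metis
  show "\<exists>C. \<forall>\<beta>\<in>{b1..b2}. \<forall>x\<in>K. norm (f \<beta> x * g \<beta> x) \<le> C"
    using C D by (intro exI[of _ "C * D"]) (auto simp: norm_mult intro!: mult_mono)
qed (use assms in \<open>auto intro!: holomorphic_intros uniform_family_holomorphic\<close>)

lemma uniform_family_real_constant:
  assumes "continuous_on {0<..<1} c"
  shows "uniform_family (\<lambda>\<beta> x. of_real (c \<beta>))"
proof (rule uniform_familyI)
  fix b1 b2 :: real and K :: "complex set" assume H: "0 < b1" "b2 < 1"
  have "bounded (c ` {b1..b2})"
    by (intro compact_imp_bounded compact_continuous_image continuous_on_subset[OF assms])
      (use H in auto)
  then obtain C where "\<forall>\<beta>\<in>{b1..b2}. norm (c \<beta>) \<le> C" by (auto simp: bounded_iff)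
  then show "\<exists>C. \<forall>\<beta>\<in>{b1..b2}. \<forall>x\<in>K. norm (complex_of_real (c \<beta>)) \<le> C" by auto
qed auto

text \<open>
  Room for the discs in Cauchy's inequality and in the maximum principle.
\<close>

lemma compact_neighbourhood_in_slit_plane:
  assumes "compact K" "K \<subseteq> slit_plane"
  obtains d L where "d > 0" "compact L" "L \<subseteq> slit_plane" "\<And>x. x \<in> K \<Longrightarrow> cball x d \<subseteq> L"
proof -
  obtain d where "d > 0" "(\<Union>x\<in>K. cball x d) \<subseteq> slit_plane"
    using compact_subset_open_imp_cball_epsilon_subset[OF assms(1) open_slit_plane assms(2)] by blast
  then show ?thesis
    using that[of d "\<Union>x\<in>K. cball x d"] compact_minkowski_sum_cball[OF assms(1)] by blast
qed

lemma uniform_family_deriv: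
  assumes "uniform_family f"
  shows "uniform_family (\<lambda>\<beta>. deriv (f \<beta>))"
proof (rule uniform_familyI)
  fix b1 b2 :: real and K assume H: "0 < b1" "b2 < 1" "compact K" "K \<subseteq> slit_plane"
  obtain d L where d: "d > 0" "compact L" "L \<subseteq> slit_plane" "\<And>x. x \<in> K \<Longrightarrow> cball x d \<subseteq> L"
    using compact_neighbourhood_in_slit_plane[OF H(3,4)] by metis
  obtain C where C: "C > 0" "\<And>\<beta> x. \<beta> \<in> {b1..b2} \<Longrightarrow> x \<in> L \<Longrightarrow> norm (f \<beta> x) \<le> C"
    using uniform_family_bounded[OF assms H(1,2) d(2,3)] by metis
  show "\<exists>C. \<forall>\<beta>\<in>{b1..b2}. \<forall>x\<in>K. norm (deriv (f \<beta>) x) \<le> C"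
  proof (intro exI ballI)
    fix \<beta> x assume x: "\<beta> \<in> {b1..b2}" "x \<in> K"
    then have hol: "f \<beta> holomorphic_on cball x d"
      using uniform_family_holomorphic[OF assms, of \<beta>] H d(3) d(4)[OF x(2)]
      by (auto intro: holomorphic_on_subset[of _ slit_plane])
    have "norm ((deriv ^^ 1) (f \<beta>) x) \<le> fact 1 * C / d ^ 1"
    proof (rule Cauchy_inequality)
      show "f \<beta> holomorphic_on ball x d" using hol by (rule holomorphic_on_subset) auto
      show "continuous_on (cball x d) (f \<beta>)" using hol by (rule holomorphic_on_imp_continuous_on)
      show "norm (f \<beta> y) \<le> C" if "norm (x - y) = d" for y
        using C(2)[OF x(1)] d(4)[OF x(2)] that by (auto simp: subset_iff dist_norm)
    qed fact
    then show "norm (deriv (f \<beta>) x) \<le> C / d" by simp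
  qed
qed (use assms in \<open>auto intro!: holomorphic_deriv uniform_family_holomorphic open_slit_plane\<close>)

text \<open>
  Near the base point the maximum principle transfers the bound for the difference quotient from
  a circle to its interior.
\<close>

lemma uniform_family_divided_diff:
  assumes "uniform_family f"
  shows "uniform_family (\<lambda>\<beta>. divided_diff (f \<beta>) (of_real (saddle \<beta>)))"
proof (rule uniform_familyI)
  show hol: "divided_diff (f \<beta>) (of_real (saddle \<beta>)) holomorphic_on slit_plane"
    if "0 < \<beta>" "\<beta> < 1" for \<beta>
    using that by (intro holomorphic_divided_diff uniform_family_holomorphic[OF assms]
        open_slit_plane saddle_in_slit_plane)
  fix b1 b2 :: real and K assume H: "0 < b1" "b2 < 1" "compact K" "K \<subseteq> slit_plane"
  define S where "S = (\<lambda>\<beta>. complex_of_real (saddle \<beta>)) ` {b1..b2}"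
  have S: "compact S" "S \<subseteq> slit_plane"
  proof -
    show "compact S" unfolding S_def saddle_def
      using H by (intro compact_continuous_image continuous_intros) auto
    show "S \<subseteq> slit_plane" using H by (auto simp: S_def saddle_pos)
  qed
  have "compact (K \<union> S)" "K \<union> S \<subseteq> slit_plane" using H S by auto
  then obtain d L where d: "d > 0" "compact L" "L \<subseteq> slit_plane" "\<And>x. x \<in> K \<union> S \<Longrightarrow> cball x d \<subseteq> L"
    using compact_neighbourhood_in_slit_plane by metis
  obtain C where C: "C > 0" "\<And>\<beta> x. \<beta> \<in> {b1..b2} \<Longrightarrow> x \<in> L \<Longrightarrow> norm (f \<beta> x) \<le> C"
    using uniform_family_bounded[OF assms H(1,2) d(2,3)] by metis
  show "\<exists>C. \<forall>\<beta>\<in>{b1..b2}. \<forall>x\<in>K. norm (divided_diff (f \<beta>) (of_real (saddle \<beta>)) x) \<le> C"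
  proof (intro exI ballI)
    fix \<beta> x assume b: "\<beta> \<in> {b1..b2}" and x: "x \<in> K"
    define s where "s = complex_of_real (saddle \<beta>)"
    have s: "s \<in> S" using b by (auto simp: s_def S_def)
    have L: "x \<in> L" "cball s d \<subseteq> L" using d(1) d(4)[of x] d(4)[of s] x s by auto
    have far: "norm (divided_diff (f \<beta>) s y) \<le> 2 * C / d" if "y \<in> L" "dist s y \<ge> d" for y
    proof -
      have "y \<noteq> s" using that d by auto
      have "norm (f \<beta> y - f \<beta> s) \<le> C + C"
        using L d(1) that by (intro order_trans[OF norm_triangle_ineq4] add_mono C b) auto
      moreover have "norm (y - s) \<ge> d" using that by (simp add: dist_norm norm_minus_commute)
      ultimately have "norm (f \<beta> y - f \<beta> s) / norm (y - s) \<le> (2 * C) / d"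
        using d C(1) by (intro frac_le) auto
      then show ?thesis using \<open>y \<noteq> s\<close> by (simp add: divided_diff_def norm_divide)
    qed
    have "norm (divided_diff (f \<beta>) s x) \<le> 2 * C / d"
    proof (cases "dist s x \<ge> d")
      case True
      then show ?thesis using far L by blast
    next
      case False
      have hol': "divided_diff (f \<beta>) s holomorphic_on cball s d"
        using hol[of \<beta>] b H L(2) d(3) unfolding s_def by (auto intro: holomorphic_on_subset)
      show ?thesis
      proof (rule maximum_modulus_frontier[of "divided_diff (f \<beta>) s" "ball s d"])
        show "divided_diff (f \<beta>) s holomorphic_on interior (ball s d)"
          using hol' by (rule holomorphic_on_subset) auto
        show "continuous_on (closure (ball s d)) (divided_diff (f \<beta>) s)"
          using holomorphic_on_imp_continuous_on[OF hol'] d by simp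
        show "norm (divided_diff (f \<beta>) s z) \<le> 2 * C / d" if "z \<in> frontier (ball s d)" for z
        proof (rule far)
          have "dist s z = d" using that d by simp
          then show "z \<in> L" "dist s z \<ge> d" using L(2) by auto
        qed
      qed (use False in auto)
    qed
    then show "norm (divided_diff (f \<beta>) (of_real (saddle \<beta>)) x) \<le> 2 * C / d" by (simp add: s_def)
  qed
qed

lemma continuous_on_h: "continuous_on {0<..<1} h"
  unfolding h_def[abs_def] by (auto intro!: continuous_intros)

lemma uniform_family_radicand: "uniform_family radicand"
proof (rule uniform_familyI)
  fix b1 b2 :: real and K assume H: "0 < b1" "b2 < 1" "compact K" "K \<subseteq> slit_plane"
  have bd: "uniform_family (\<lambda>_ x. Ln (1 + x))" "uniform_family (\<lambda>_. Ln)"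
    using slit_plane_nonzero by (auto intro!: uniform_family_fixed holomorphic_intros)
  obtain C1 where C1: "\<And>\<beta> x. \<beta> \<in> {b1..b2} \<Longrightarrow> x \<in> K \<Longrightarrow> norm (Ln (1 + x)) \<le> C1"
    using uniform_family_bounded[OF bd(1) H] by metis
  obtain C2 where C2: "\<And>\<beta> x. \<beta> \<in> {b1..b2} \<Longrightarrow> x \<in> K \<Longrightarrow> norm (Ln x) \<le> C2"
    using uniform_family_bounded[OF bd(2) H] by metis
  obtain C3 where C3: "\<And>\<beta> x. \<beta> \<in> {b1..b2} \<Longrightarrow> x \<in> K \<Longrightarrow> norm (complex_of_real (h \<beta>)) \<le> C3"
    using uniform_family_bounded[OF uniform_family_real_constant[OF continuous_on_h] H] by metis
  show "\<exists>C. \<forall>\<beta>\<in>{b1..b2}. \<forall>x\<in>K. norm (radicand \<beta> x) \<le> C"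
  proof (intro exI ballI)
    fix \<beta> x assume b: "\<beta> \<in> {b1..b2}" and x: "x \<in> K"
    have "norm (of_real \<beta> * Ln x) \<le> 1 * C2"
      unfolding norm_mult using b x H by (intro mult_mono C2[OF b x]) auto
    then have "norm (of_real \<beta> * Ln x) \<le> C2" by simp
    then show "norm (radicand \<beta> x) \<le> C1 + C2 + C3"
      unfolding radicand_def
      by (intro order_trans[OF norm_triangle_ineq4] add_mono C1[OF b x] C3[OF b x])
  qed
qed (rule holomorphic_radicand)

lemma uniform_family_rho: "uniform_family rho"
proof (rule uniform_familyI)
  fix b1 b2 :: real and K assume H: "0 < b1" "b2 < 1" "compact K" "K \<subseteq> slit_plane"
  obtain C where C: "\<And>\<beta> x. \<beta> \<in> {b1..b2} \<Longrightarrow> x \<in> K \<Longrightarrow> norm (radicand \<beta> x) \<le> C"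
    using uniform_family_bounded[OF uniform_family_radicand H] by metis
  show "\<exists>C. \<forall>\<beta>\<in>{b1..b2}. \<forall>x\<in>K. norm (rho \<beta> x) \<le> C"
  proof (intro exI ballI)
    fix \<beta> x assume b: "\<beta> \<in> {b1..b2}" and x: "x \<in> K"
    have "(norm (rho \<beta> x))\<^sup>2 \<le> C"
      using C[OF b x] rho_square[of \<beta> x] b x H by (auto simp flip: norm_power)
    then show "norm (rho \<beta> x) \<le> sqrt C" by (rule real_le_rsqrt)
  qed
qed (rule holomorphic_rho)

section \<open>The coefficients of the expansion\<close>

text \<open>
  Inserting \<open>\<Sum>k. a k / m ^ k\<close> into the differential equation of the error and comparing powers of \<open>m\<close>
  gives \<open>Q' * a k = b k - (1 + s) * b k s / (1 + x)\<close> and \<open>b (k + 1) = (a k)'\<close>, where \<open>Q\<close> is the radicand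
  and \<open>b 0\<close> comes from the complementary error function. The subtracted term makes the right-hand
  side vanish at the saddle point \<open>s\<close>, the zero of \<open>Q'\<close>, and the quotient is a divided difference.
  The \<open>b k\<close> are the functions below, and the \<open>a k\<close> the coefficients of the expansion.
\<close>

primrec source :: "nat \<Rightarrow> real \<Rightarrow> complex \<Rightarrow> complex" where
  "source 0 = (\<lambda>\<beta> x. of_real (- sqrt 2) * deriv (rho \<beta>) x)"
| "source (Suc k) = (\<lambda>\<beta>. deriv (\<lambda>x. of_real (1 / (1 - \<beta>)) * x *
      divided_diff (\<lambda>y. (1 + y) * source k \<beta> y) (of_real (saddle \<beta>)) x))"

definition expansion_coeff :: "nat \<Rightarrow> real \<Rightarrow> complex \<Rightarrow> complex" where
  "expansion_coeff k \<beta> x = of_real (1 / (1 - \<beta>)) * x *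
      divided_diff (\<lambda>y. (1 + y) * source k \<beta> y) (of_real (saddle \<beta>)) x"

lemma source_Suc: "source (Suc k) \<beta> = deriv (expansion_coeff k \<beta>)"
  by (simp add: expansion_coeff_def[abs_def])

declare source.simps(2) [simp del]

lemma
  shows uniform_family_source: "uniform_family (source k)"
    and uniform_family_expansion_coeff: "uniform_family (expansion_coeff k)"
proof -
  have coeff: "uniform_family (expansion_coeff k)" if "uniform_family (source k)" for k
    unfolding expansion_coeff_def[abs_def]
    by (intro uniform_family_mult uniform_family_real_constant
        uniform_family_fixed[of "\<lambda>y. y"] uniform_family_fixed[of "\<lambda>y. 1 + y"]
        uniform_family_divided_diff that holomorphic_intros continuous_intros) auto
  show src: "uniform_family (source k)" for k
  proof (induction k)
    case 0
    show ?case unfolding source.simps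
      by (intro uniform_family_mult uniform_family_real_constant uniform_family_deriv
          uniform_family_rho continuous_intros)
  next
    case (Suc k)
    then show ?case unfolding source_Suc by (intro uniform_family_deriv coeff)
  qed
  show "uniform_family (expansion_coeff k)" by (rule coeff[OF src])
qed

lemma expansion_coeff_equation:
  assumes "0 < \<beta>" "\<beta> < 1" "x \<in> slit_plane"
  shows "of_real (1 - \<beta>) * (x - of_real (saddle \<beta>)) / (x * (1 + x)) * expansion_coeff k \<beta> x
       = source k \<beta> x - (1 + of_real (saddle \<beta>)) * source k \<beta> (of_real (saddle \<beta>)) / (1 + x)"
proof -
  let ?s = "complex_of_real (saddle \<beta>)"
  let ?f = "\<lambda>y. (1 + y) * source k \<beta> y"
  have "of_real (1 - \<beta>) * (x - ?s) / (x * (1 + x)) * expansion_coeff k \<beta> x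
      = (of_real (1 - \<beta>) * of_real (1 / (1 - \<beta>))) * (x / x) * ((x - ?s) * divided_diff ?f ?s x) / (1 + x)"
    unfolding expansion_coeff_def by (simp only: times_divide_eq_left times_divide_eq_right divide_divide_eq_left mult_ac)
  also have "of_real (1 - \<beta>) * of_real (1 / (1 - \<beta>)) = (1 :: complex)"
    using assms by (simp flip: of_real_mult)
  also have "x / x = 1" using slit_plane_nonzero[OF assms(3)] by simp
  finally show ?thesis using slit_plane_nonzero[OF assms(3)]
    by (simp add: divided_diff_mult diff_divide_distrib)
qed

text \<open>
  Differentiation of \<open>\<rho>\<^sup>2\<close>.
\<close>

lemma deriv_rho:
  assumes "0 < \<beta>" "\<beta> < 1" "x \<in> slit_plane"
  shows "2 * rho \<beta> x * deriv (rho \<beta>) x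
       = of_real (1 - \<beta>) * (x - of_real (saddle \<beta>)) / (x * (1 + x))"
proof -
  have "((\<lambda>x. (rho \<beta> x)\<^sup>2) has_field_derivative 2 * rho \<beta> x * deriv (rho \<beta>) x) (at x)"
    using holomorphic_derivI[OF holomorphic_rho[OF assms(1,2)] open_slit_plane assms(3)]
    by (auto intro!: derivative_eq_intros)
  moreover have "((\<lambda>x. (rho \<beta> x)\<^sup>2) has_field_derivative
      of_real (1 - \<beta>) * (x - of_real (saddle \<beta>)) / (x * (1 + x))) (at x)"
    using has_field_derivative_radicand[OF assms]
    by (rule has_field_derivative_transform_within_open[OF _ open_slit_plane assms(3)])
      (simp add: rho_square[OF assms(1,2)])
  ultimately show ?thesis by (rule DERIV_unique)
qed

lemma source_0_saddle:
  assumes "0 < \<beta>" "\<beta> < 1"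
  shows "(1 + of_real (saddle \<beta>)) * source 0 \<beta> (of_real (saddle \<beta>))
       = - complex_of_real (sqrt ((1 - \<beta>) / \<beta>))"
proof -
  have "(1 + saddle \<beta>) * (- sqrt 2 * ((1 - \<beta>) * sqrt ((1 - \<beta>) / (2 * \<beta>)))) = - sqrt ((1 - \<beta>) / \<beta>)"
    unfolding saddle_eqs(1)[OF assms] using assms by (simp add: real_sqrt_divide real_sqrt_mult)
  from arg_cong[OF this, of complex_of_real] show ?thesis
    by (simp add: deriv_rho_saddle[OF assms])
qed

text \<open>
  Away from the saddle point this is algebra; at the saddle point both sides are the same limit,
  because the divided difference is continuous.
\<close>

lemma expansion_coeff_0:
  assumes "0 < \<beta>" "\<beta> < 1" "x \<in> slit_plane"
  shows "expansion_coeff 0 \<beta> x = A \<beta> x"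
proof -
  let ?s = "complex_of_real (saddle \<beta>)"
  have off: "expansion_coeff 0 \<beta> y = A_formula \<beta> y" if y: "y \<in> slit_plane" "y \<noteq> ?s" for y
  proof -
    note nz = slit_plane_nonzero[OF y(1)]
    define D where "D = of_real (1 - \<beta>) * (y - ?s) / (y * (1 + y))"
    have D: "D \<noteq> 0" using y nz assms by (auto simp: D_def)
    have r: "rho \<beta> y \<noteq> 0" using rho_eq_0_iff[OF assms(1,2) y(1)] y by simp
    have "source 0 \<beta> y = - (of_real (sqrt 2) * deriv (rho \<beta>) y)" by simp
    also have "deriv (rho \<beta>) y = D / (2 * rho \<beta> y)"
      using deriv_rho[OF assms(1,2) y(1)] r unfolding D_def[symmetric] by (simp add: field_simps)
    also have "of_real (sqrt 2) * (D / (2 * rho \<beta> y)) = D * (1 / (of_real (sqrt 2) * rho \<beta> y))"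
    proof -
      have "complex_of_real (sqrt 2) * of_real (sqrt 2) = 2"
        by (simp flip: of_real_mult)
      then show ?thesis using r by (simp add: field_simps)
    qed
    finally have src: "source 0 \<beta> y = - D * (1 / (of_real (sqrt 2) * rho \<beta> y))" by simp
    define Q where "Q = of_real (sqrt (\<beta> * (1 - \<beta>))) * (1 - of_real \<beta> / (y * of_real (1 - \<beta>)))"
    have Q: "D / Q = of_real (sqrt ((1 - \<beta>) / \<beta>)) / (1 + y)"
    proof -
      have "1 - of_real \<beta> / (y * of_real (1 - \<beta>)) = (y - ?s) / y"
        using nz assms by (simp add: saddle_def field_simps)
      then have "D / Q = (of_real (1 - \<beta>) / of_real (sqrt (\<beta> * (1 - \<beta>)))) / (1 + y)"
      proof -
        have "a * u / (y * w) / (q * (u / y)) = a / q / w" if "u \<noteq> 0" for a u w q :: complex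
          using that nz by (cases "q = 0"; cases "w = 0") (simp_all add: field_simps)
        with \<open>1 - of_real \<beta> / (y * of_real (1 - \<beta>)) = (y - ?s) / y\<close> show ?thesis
          unfolding D_def Q_def using y by simp
      qed
      also have "complex_of_real (1 - \<beta>) / of_real (sqrt (\<beta> * (1 - \<beta>))) = of_real ((1 - \<beta>) / sqrt (\<beta> * (1 - \<beta>)))"
        by simp
      also have "(1 - \<beta>) / sqrt (\<beta> * (1 - \<beta>)) = sqrt ((1 - \<beta>) / \<beta>)"
      proof -
        have "(1 - \<beta>) / sqrt (\<beta> * (1 - \<beta>)) = ((1 - \<beta>) / sqrt (1 - \<beta>)) / sqrt \<beta>"
          by (simp add: real_sqrt_mult)
        then show ?thesis using assms real_div_sqrt[of "1 - \<beta>"] by (simp add: real_sqrt_divide)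
      qed
      finally show ?thesis .
    qed
    have "D * expansion_coeff 0 \<beta> y
        = - D * (1 / (of_real (sqrt 2) * rho \<beta> y)) + of_real (sqrt ((1 - \<beta>) / \<beta>)) / (1 + y)"
      using expansion_coeff_equation[OF assms(1,2) y(1), of 0]
      unfolding source_0_saddle[OF assms(1,2)] D_def[symmetric] src by simp
    also have "\<dots> = D * A_formula \<beta> y"
      unfolding A_formula_def Q_def[symmetric] Q[symmetric] by (simp add: algebra_simps)
    finally show ?thesis using D by simp
  qed
  show ?thesis
  proof (cases "x = ?s")
    case True
    have "continuous_on slit_plane (expansion_coeff 0 \<beta>)"
      by (intro holomorphic_on_imp_continuous_on uniform_family_holomorphic
          uniform_family_expansion_coeff assms)
    then have "(expansion_coeff 0 \<beta> \<longlongrightarrow> expansion_coeff 0 \<beta> ?s) (at ?s)"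
      using saddle_in_slit_plane[OF assms(1,2)]
      by (auto simp: continuous_on_eq_continuous_at[OF open_slit_plane] isCont_def)
    moreover have "eventually (\<lambda>y. y \<in> slit_plane \<and> y \<noteq> ?s) (at ?s)"
      using open_slit_plane saddle_in_slit_plane[OF assms(1,2)]
      by (simp only: eventually_at_topological) blast
    then have "eventually (\<lambda>y. expansion_coeff 0 \<beta> y = A_formula \<beta> y) (at ?s)"
      by eventually_elim (use off in auto)
    ultimately have "(A_formula \<beta> \<longlongrightarrow> expansion_coeff 0 \<beta> ?s) (at ?s)"
      using tendsto_cong by fastforce
    then show ?thesis unfolding A_def using True by (simp add: tendsto_Lim)
  qed (use off assms in \<open>simp add: A_def\<close>)
qed

section \<open>The incomplete binomial sum\<close>

text \<open>
  The sum solves a first-order linear equation with a single monomial as inhomogeneity, because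
  the contributions of neighbouring binomial coefficients telescope.
\<close>

lemma has_field_derivative_F:
  "(F m r has_field_derivative
      (of_nat m * F m r x - (of_nat m - of_nat r) * of_nat (m choose r) * x ^ r) / (1 + x)) (at x)"
  if "1 + x \<noteq> 0"
proof -
  have "\<exists>D. (F m r has_field_derivative D) (at x) \<and>
     (1 + x) * D = of_nat m * F m r x - (of_nat m - of_nat r) * of_nat (m choose r) * x ^ r"
  proof (induction r)
    case 0
    show ?case by (intro exI[of _ 0]) (simp add: F_def[abs_def])
  next
    case (Suc r)
    then obtain D where D: "(F m r has_field_derivative D) (at x)"
      "(1 + x) * D = of_nat m * F m r x - (of_nat m - of_nat r) * of_nat (m choose r) * x ^ r" by blast
    let ?c = "of_nat (m choose Suc r) :: complex"
    have eq: "F m (Suc r) = (\<lambda>x. F m r x + ?c * x ^ Suc r)"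
      by (simp add: F_def fun_eq_iff)
    have step: "of_nat (Suc r) * ?c = (of_nat m - of_nat r) * of_nat (m choose r)"
    proof (cases "r \<le> m")
      case True
      have "Suc r * (m choose Suc r) = (m - r) * (m choose r)"
        by (simp only: binomial_absorption binomial_absorb_comp)
      then have "complex_of_nat (Suc r * (m choose Suc r)) = of_nat ((m - r) * (m choose r))" by simp
      then show ?thesis using True by (simp only: of_nat_mult of_nat_diff)
    qed (simp add: binomial_eq_0)
    have "(F m (Suc r) has_field_derivative D + ?c * (of_nat (Suc r) * x ^ r)) (at x)"
      unfolding eq
      using DERIV_add[OF D(1) DERIV_cmult[OF DERIV_power_Suc[OF DERIV_ident, of r x UNIV], of ?c]]
      by simp
    moreover have "(1 + x) * (D + ?c * (of_nat (Suc r) * x ^ r))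
       = of_nat m * F m r x + (of_nat (Suc r) * ?c - (of_nat m - of_nat r) * of_nat (m choose r)) * x ^ r
         + of_nat (Suc r) * ?c * x ^ Suc r"
      by (simp only: distrib_left D(2)) (simp add: algebra_simps)
    then have "(1 + x) * (D + ?c * (of_nat (Suc r) * x ^ r))
       = of_nat m * F m (Suc r) x - (of_nat m - of_nat (Suc r)) * ?c * x ^ Suc r"
      unfolding eq step[symmetric] by (simp add: algebra_simps)
    ultimately show ?case by blast
  qed
  then obtain D where D: "(F m r has_field_derivative D) (at x)"
     "(1 + x) * D = of_nat m * F m r x - (of_nat m - of_nat r) * of_nat (m choose r) * x ^ r" by blast
  have "D = (of_nat m * F m r x - (of_nat m - of_nat r) * of_nat (m choose r) * x ^ r) / (1 + x)"
    using that by (simp add: D(2)[symmetric])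
  with D(1) show ?thesis by simp
qed

lemma binomial_theorem_one: "(1 + t) ^ m = (\<Sum>l\<le>m. of_nat (m choose l) * t ^ l)"
  for t :: "'a :: comm_ring_1"
  using binomial_ring[of t 1 m] by (simp add: add.commute)

text \<open>
  Chernoff's inequality: replacing the point \<open>t\<close> by \<open>s\<close> costs the factor
  \<open>(t / s) ^ r\<close>, because \<open>(t / s) ^ l\<close> is monotone in \<open>l\<close>.
\<close>

lemma chernoff:
  fixes s t :: real
  assumes "s > 0" "r \<le> m"
  shows chernoff_lower: "t \<ge> s \<Longrightarrow> (\<Sum>l=0..r. real (m choose l) * t ^ l) \<le> (t / s) ^ r * (1 + s) ^ m"
    and chernoff_upper: "0 < t \<Longrightarrow> t \<le> s \<Longrightarrow>
      (1 + t) ^ m - (\<Sum>l=0..r. real (m choose l) * t ^ l) \<le> (t / s) ^ r * (1 + s) ^ m"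
proof -
  have tl: "real (m choose l) * t ^ l = (t / s) ^ l * (real (m choose l) * s ^ l)" for l
    using assms by (simp add: power_divide)
  have sum_le: "(\<Sum>l\<in>X. real (m choose l) * s ^ l) \<le> (1 + s) ^ m" if "X \<subseteq> {..m}" for X
    unfolding binomial_theorem_one using that assms by (intro sum_mono2) auto
  have bound: "(\<Sum>l\<in>X. real (m choose l) * t ^ l) \<le> (t / s) ^ r * (1 + s) ^ m"
    if X: "X \<subseteq> {..m}" and le: "\<And>l. l \<in> X \<Longrightarrow> (t / s) ^ l \<le> (t / s) ^ r" and t: "t > 0" for X
  proof -
    have "(\<Sum>l\<in>X. real (m choose l) * t ^ l) \<le> (\<Sum>l\<in>X. (t / s) ^ r * (real (m choose l) * s ^ l))"
      unfolding tl using assms le by (intro sum_mono mult_right_mono) auto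
    also have "\<dots> = (t / s) ^ r * (\<Sum>l\<in>X. real (m choose l) * s ^ l)"
      by (simp add: sum_distrib_left)
    also have "\<dots> \<le> (t / s) ^ r * (1 + s) ^ m"
      using sum_le[OF X] t assms by (intro mult_left_mono) auto
    finally show ?thesis .
  qed
  show "(\<Sum>l=0..r. real (m choose l) * t ^ l) \<le> (t / s) ^ r * (1 + s) ^ m" if "t \<ge> s"
    using that assms by (intro bound power_increasing) auto
  show "(1 + t) ^ m - (\<Sum>l=0..r. real (m choose l) * t ^ l) \<le> (t / s) ^ r * (1 + s) ^ m"
    if "0 < t" "t \<le> s"
  proof -
    have "{..m} = {0..r} \<union> {r<..m}" using assms by auto
    then have "(1 + t) ^ m = (\<Sum>l=0..r. real (m choose l) * t ^ l) + (\<Sum>l\<in>{r<..m}. real (m choose l) * t ^ l)"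
      unfolding binomial_theorem_one by (subst sum.union_disjoint[symmetric]) auto
    moreover have "(\<Sum>l\<in>{r<..m}. real (m choose l) * t ^ l) \<le> (t / s) ^ r * (1 + s) ^ m"
      using that assms by (intro bound power_decreasing) auto
    ultimately show ?thesis by simp
  qed
qed

section \<open>The error of the truncated expansion\<close>

text \<open>
  The size of the correction term; it is also the ratio of the last monomial of the sum to
  \<open>(1 + x) ^ m\<close>, up to a factor that depends on \<open>m\<close> and \<open>r\<close> only.
\<close>

definition weight :: "nat \<Rightarrow> real \<Rightarrow> complex \<Rightarrow> complex" where
  "weight m \<beta> x = exp (- of_nat m * radicand \<beta> x)"

lemma weight_eq:
  assumes "m > 0" "x \<in> slit_plane"
  shows "weight m (real r / real m) x = x ^ r * of_real (exp (real m * h (real r / real m))) / (1 + x) ^ m"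
proof -
  define \<beta> where "\<beta> = real r / real m"
  have r: "complex_of_nat m * of_real \<beta> = of_nat r"
    using assms(1) by (simp add: \<beta>_def)
  note nz = slit_plane_nonzero[OF assms(2)]
  have "weight m \<beta> x = exp ((of_nat m * of_real \<beta>) * Ln x + of_nat m * of_real (h \<beta>) - of_nat m * Ln (1 + x))"
    unfolding weight_def radicand_def by (simp add: algebra_simps)
  also have "\<dots> = exp (of_nat r * Ln x) * exp (of_nat m * of_real (h \<beta>)) / exp (of_nat m * Ln (1 + x))"
    unfolding r by (simp add: exp_add exp_diff)
  also have "exp (of_nat r * Ln x) = x ^ r" using nz by (simp add: exp_of_nat_mult)
  also have "exp (of_nat m * Ln (1 + x)) = (1 + x) ^ m" using nz by (simp add: exp_of_nat_mult)
  also have "exp (of_nat m * of_real (h \<beta>)) = complex_of_real (exp (real m * h \<beta>))"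
    by (simp flip: exp_of_real)
  finally show ?thesis by (simp add: \<beta>_def)
qed

lemma norm_weight: "norm (weight m \<beta> x) = exp (- real m * Re (radicand \<beta> x))"
  by (simp add: weight_def)

lemma weight_nonzero [simp]: "weight m \<beta> x \<noteq> 0"
  by (simp add: weight_def)

lemma approx_eq:
  assumes "0 < \<beta>" "\<beta> < 1" "x \<in> slit_plane"
  shows "approx m \<beta> x c = (1 + x) ^ m *
    (erfc (of_real (sqrt (real m)) * rho \<beta> x) / 2 + c * weight m \<beta> x / of_real (sqrt (2 * real m * pi)))"
  unfolding approx_def rho_square[OF assms] weight_def by simp

definition cdf_error :: "nat \<Rightarrow> nat \<Rightarrow> complex \<Rightarrow> complex" where
  "cdf_error m r x = F m r x / (1 + x) ^ m
     - erfc (of_real (sqrt (real m)) * rho (real r / real m) x) / 2"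

text \<open>
  The factor by which the Chernoff bound reduces the total mass is exactly the weight, since the
  radicand vanishes at the saddle point.
\<close>

lemma weight_of_real:
  assumes "m > 0" "r < m" "0 < r" "t > 0"
  defines "\<beta> \<equiv> real r / real m"
  shows "exp (- real m * real_radicand \<beta> t)
       = (t / saddle \<beta>) ^ r * (1 + saddle \<beta>) ^ m / (1 + t) ^ m"
proof -
  have b: "0 < \<beta>" "\<beta> < 1" using assms by (auto simp: \<beta>_def)
  have W: "exp (- real m * real_radicand \<beta> u) = u ^ r * exp (real m * h \<beta>) / (1 + u) ^ m" if "u > 0" for u
  proof -
    have "complex_of_real (exp (- real m * real_radicand \<beta> u)) = weight m \<beta> (of_real u)"
      using that by (simp add: weight_def radicand_of_real flip: exp_of_real)
    also have "\<dots> = of_real (u ^ r * exp (real m * h \<beta>) / (1 + u) ^ m)"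
      unfolding \<beta>_def using that assms(1) by (subst weight_eq) auto
    finally show ?thesis by (simp only: of_real_eq_iff)
  qed
  have "saddle \<beta> ^ r * exp (real m * h \<beta>) = (1 + saddle \<beta>) ^ m"
    using W[OF saddle_pos[OF b]] saddle_pos[OF b] by (simp add: real_radicand_saddle[OF b] divide_simps)
  then have "(t / saddle \<beta>) ^ r * (1 + saddle \<beta>) ^ m
      = (t / saddle \<beta>) ^ r * saddle \<beta> ^ r * exp (real m * h \<beta>)" by simp
  also have "(t / saddle \<beta>) ^ r * saddle \<beta> ^ r = t ^ r"
    using saddle_pos[OF b] by (simp add: power_divide)
  finally have "(t / saddle \<beta>) ^ r * (1 + saddle \<beta>) ^ m = t ^ r * exp (real m * h \<beta>)" .
  then show ?thesis using W[OF assms(4)] by simp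
qed

text \<open>
  Right of the saddle point the normalised sum and \<open>erfc / 2\<close> are both exponentially small, left of
  it both are exponentially close to \<open>1\<close>; the Chernoff bound contributes one weight and the
  error function half a weight.
\<close>

lemma cdf_error_of_real:
  assumes "m > 0" "r < m" "0 < r" "t > 0" "t \<noteq> saddle (real r / real m)"
  shows "norm (cdf_error m r (of_real t)) \<le> 3 / 2 * exp (- real m * real_radicand (real r / real m) t)"
proof -
  define \<beta> where "\<beta> = real r / real m"
  have b: "0 < \<beta>" "\<beta> < 1" using assms by (auto simp: \<beta>_def)
  define Q where "Q = real_radicand \<beta> t"
  define P where "P = (\<Sum>l=0..r. real (m choose l) * t ^ l)"
  have Q: "Q > 0" using real_radicand_pos[OF b assms(4)] assms by (simp add: Q_def \<beta>_def)
  have sq: "(sqrt (real m) * sqrt Q)\<^sup>2 = real m * Q" using Q by (simp add: power_mult_distrib)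
  have e: "0 \<le> erfc_real (sqrt (real m) * sqrt Q)" "erfc_real (sqrt (real m) * sqrt Q) \<le> exp (- real m * Q)"
    using erfc_real_nonneg erfc_real_le_exp[of "sqrt (real m) * sqrt Q"] Q unfolding sq by auto
  have FP: "F m r (of_real t) = of_real P" by (simp add: F_def P_def)
  have rho: "rho \<beta> (of_real t) = of_real (sgn (t - saddle \<beta>) * sqrt Q)"
    unfolding Q_def by (rule rho_of_real[OF b assms(4)])
  have w: "exp (- real m * Q) = (t / saddle \<beta>) ^ r * (1 + saddle \<beta>) ^ m / (1 + t) ^ m"
    unfolding Q_def \<beta>_def by (rule weight_of_real) fact+
  note chern = chernoff_lower[of "saddle \<beta>" r m t] chernoff_upper[of "saddle \<beta>" r m t]
  have "norm (cdf_error m r (of_real t)) \<le> exp (- real m * Q) + exp (- real m * Q) / 2"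
  proof (cases "t > saddle \<beta>")
    case True
    have "P / (1 + t) ^ m \<le> exp (- real m * Q)"
      unfolding w P_def using True assms chern(1) saddle_pos[OF b] by (intro divide_right_mono) auto
    moreover have "P \<ge> 0" unfolding P_def using assms by (intro sum_nonneg) auto
    moreover have eq: "cdf_error m r (of_real t) = of_real (P / (1 + t) ^ m - erfc_real (sqrt (real m) * sqrt Q) / 2)"
      unfolding cdf_error_def \<beta>_def[symmetric] rho FP using True
      by (simp add: erfc_of_real flip: of_real_mult)
    moreover have "P / (1 + t) ^ m \<ge> 0" using \<open>P \<ge> 0\<close> assms by simp
    ultimately show ?thesis using e unfolding eq norm_of_real by linarith
  next
    case False
    then have lt: "t < saddle \<beta>" using assms by (simp add: \<beta>_def)
    have "((1 + t) ^ m - P) / (1 + t) ^ m \<le> exp (- real m * Q)"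
      unfolding w P_def using lt assms chern(2) saddle_pos[OF b] by (intro divide_right_mono) auto
    then have "1 - P / (1 + t) ^ m \<le> exp (- real m * Q)" using assms by (simp add: diff_divide_distrib)
    moreover have "P \<le> (1 + t) ^ m" unfolding P_def binomial_theorem_one using assms by (intro sum_mono2) auto
    then have "1 - P / (1 + t) ^ m \<ge> 0" using assms by (simp add: field_simps)
    moreover have eq: "cdf_error m r (of_real t)
        = of_real (erfc_real (sqrt (real m) * sqrt Q) / 2 - (1 - P / (1 + t) ^ m))"
    proof -
      have "of_real (sqrt (real m)) * of_real (sgn (t - saddle \<beta>) * sqrt Q)
          = - complex_of_real (sqrt (real m) * sqrt Q)" using lt by simp
      then show ?thesis
        unfolding cdf_error_def \<beta>_def[symmetric] rho FP
        by (simp only: erfc_minus erfc_of_real) (simp add: diff_divide_distrib)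
    qed
    ultimately show ?thesis using e unfolding eq norm_of_real by linarith
  qed
  then show ?thesis by (simp add: Q_def \<beta>_def)
qed

text \<open>
  The binomial coefficient of the last term, scaled to be of order one.
\<close>

definition binom_factor :: "nat \<Rightarrow> nat \<Rightarrow> real" where
  "binom_factor m r = sqrt (2 * real m * pi) * (1 - real r / real m) * real (m choose r)
     * exp (- real m * h (real r / real m))"

definition truncation :: "nat \<Rightarrow> nat \<Rightarrow> nat \<Rightarrow> complex \<Rightarrow> complex" where
  "truncation m r N x = (\<Sum>k<N. expansion_coeff k (real r / real m) x / of_nat m ^ k)"

definition truncation_error :: "nat \<Rightarrow> nat \<Rightarrow> nat \<Rightarrow> complex \<Rightarrow> complex" where
  "truncation_error m r N x = cdf_error m r x
     - weight m (real r / real m) x * truncation m r N x / of_real (sqrt (2 * real m * pi))"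

text \<open>
  The scaled binomial coefficient has the asymptotic series with terms
  \<open>- (1 + s) * source k s / m ^ k\<close>, and this is the error of its truncation. The series is equivalent
  to that of Stirling, but it is found in the form in which the recursion for the coefficients
  needs it.
\<close>

definition stirling_error :: "nat \<Rightarrow> nat \<Rightarrow> nat \<Rightarrow> complex" where
  "stirling_error m r N = of_real (binom_factor m r)
     + (\<Sum>k<N. (1 + of_real (saddle (real r / real m)))
          * source k (real r / real m) (of_real (saddle (real r / real m))) / of_nat m ^ k)"

lemma has_field_derivative_weight:
  assumes "0 < \<beta>" "\<beta> < 1" "x \<in> slit_plane"
  shows "(weight m \<beta> has_field_derivative - weight m \<beta> x *
    (of_nat m * (of_real (1 - \<beta>) * (x - of_real (saddle \<beta>)) / (x * (1 + x))))) (at x)"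
  unfolding weight_def[abs_def]
  using has_field_derivative_radicand[OF assms]
  by (auto intro!: derivative_eq_intros)

text \<open>
  The derivative of \<open>F / (1 + x) ^ m\<close> collapses to the last monomial, that is, to the weight.
\<close>

lemma has_field_derivative_binomial_cdf:
  assumes "0 < r" "r < m" "x \<in> slit_plane"
  shows "((\<lambda>x. F m r x / (1 + x) ^ m) has_field_derivative
    weight m (real r / real m) x / of_real (sqrt (2 * real m * pi))
      * (- of_nat m * of_real (binom_factor m r) / (1 + x))) (at x)"
proof -
  note nz = slit_plane_nonzero[OF assms(3)]
  define \<beta> where "\<beta> = real r / real m"
  define c where "c = complex_of_nat (m choose r)"
  let ?F' = "(of_nat m * F m r x - (of_nat m - of_nat r) * c * x ^ r) / (1 + x)"
  obtain k where k: "m = Suc k" using assms by (cases m) auto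
  have "((\<lambda>x. F m r x / (1 + x) ^ m) has_field_derivative
      (?F' * (1 + x) ^ m - F m r x * (of_nat m * (1 + x) ^ (m - 1))) / ((1 + x) ^ m * (1 + x) ^ m)) (at x)"
    using has_field_derivative_F[OF nz(2), of m r] nz unfolding c_def
    by (auto intro!: derivative_eq_intros)
  also have "(?F' * (1 + x) ^ m - F m r x * (of_nat m * (1 + x) ^ (m - 1))) / ((1 + x) ^ m * (1 + x) ^ m)
      = - ((of_nat m - of_nat r) * c * x ^ r) / ((1 + x) ^ m * (1 + x))"
  proof -
    have "(1 + x) ^ m = (1 + x) * (1 + x) ^ k" by (simp add: k)
    then have "?F' * (1 + x) ^ m - F m r x * (of_nat m * (1 + x) ^ (m - 1))
        = - ((of_nat m - of_nat r) * c * x ^ r) * (1 + x) ^ k"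
    proof -
      have "(u * f - g) / y * (y * p) - f * (u * p) = - g * p" if "y \<noteq> 0" for u f g y p :: complex
        using that by (simp add: field_simps)
      from this[OF nz(2), of "of_nat m" "F m r x" _ "(1 + x) ^ k"] show ?thesis by (simp add: k)
    qed
    then have "(?F' * (1 + x) ^ m - F m r x * (of_nat m * (1 + x) ^ (m - 1))) / ((1 + x) ^ m * (1 + x) ^ m)
        = - ((of_nat m - of_nat r) * c * x ^ r) * (1 + x) ^ k / ((1 + x) ^ m * ((1 + x) * (1 + x) ^ k))"
      by (simp add: k)
    also have "\<dots> = - ((of_nat m - of_nat r) * c * x ^ r) / ((1 + x) ^ m * (1 + x))"
      using nz by simp
    finally show ?thesis .
  qed
  also have "\<dots> = weight m \<beta> x / of_real (sqrt (2 * real m * pi))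
      * (- of_nat m * of_real (binom_factor m r) / (1 + x))"
  proof -
    have e: "complex_of_real (exp (real m * h \<beta>)) * of_real (exp (- real m * h \<beta>)) = 1"
      by (simp flip: of_real_mult exp_add)
    have q: "complex_of_real (sqrt (2 * real m * pi)) \<noteq> 0" using assms by simp
    have mr: "of_nat m * complex_of_real (1 - \<beta>) = of_nat m - of_nat r"
      using assms by (simp add: \<beta>_def right_diff_distrib)
    have "weight m \<beta> x / of_real (sqrt (2 * real m * pi)) * (- of_nat m * of_real (binom_factor m r) / (1 + x))
      = - ((of_real (exp (real m * h \<beta>)) * of_real (exp (- real m * h \<beta>)))
          * (of_real (sqrt (2 * real m * pi)) / of_real (sqrt (2 * real m * pi)))
          * (of_nat m * of_real (1 - \<beta>)) * c * x ^ r) / ((1 + x) ^ m * (1 + x))"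
      unfolding weight_eq[OF order.strict_trans[OF assms(1,2)] assms(3), of r, folded \<beta>_def]
        binom_factor_def \<beta>_def[symmetric] c_def of_real_mult of_real_of_nat_eq
      by (simp only: times_divide_eq_left times_divide_eq_right divide_divide_eq_left
          mult_minus_left mult_minus_right mult_ac minus_divide_left)
    then show ?thesis using q unfolding e mr by simp
  qed
  finally show ?thesis by (simp add: \<beta>_def)
qed

lemma has_field_derivative_cdf_error:
  assumes "0 < r" "r < m" "x \<in> slit_plane"
  shows "(cdf_error m r has_field_derivative
    weight m (real r / real m) x / of_real (sqrt (2 * real m * pi))
      * (- of_nat m * source 0 (real r / real m) x - of_nat m * of_real (binom_factor m r) / (1 + x))) (at x)"
proof -
  define \<beta> where "\<beta> = real r / real m"
  have b: "0 < \<beta>" "\<beta> < 1" using assms by (auto simp: \<beta>_def)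
  have rho: "(rho \<beta> has_field_derivative deriv (rho \<beta>) x) (at x)"
    by (rule holomorphic_derivI[OF holomorphic_rho[OF b] open_slit_plane assms(3)])
  define \<mu> where "\<mu> = complex_of_real (sqrt (real m))"
  have \<mu>2: "\<mu> * \<mu> = of_nat m" unfolding \<mu>_def by (simp flip: of_real_mult)
  have \<mu>0: "\<mu> \<noteq> 0" using assms by (simp add: \<mu>_def)
  have w: "exp (- (\<mu> * rho \<beta> x)\<^sup>2) = weight m \<beta> x"
    unfolding weight_def power_mult_distrib rho_square[OF b assms(3)] power2_eq_square[of \<mu>] \<mu>2 by simp
  have "((\<lambda>x. erfc (\<mu> * rho \<beta> x)) has_field_derivative
      (- 2 / of_real (sqrt pi) * exp (- (\<mu> * rho \<beta> x)\<^sup>2)) * (\<mu> * deriv (rho \<beta>) x)) (at x)"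
    by (rule has_field_derivative_erfc', rule DERIV_cmult, rule rho)
  then have "((\<lambda>x. erfc (\<mu> * rho \<beta> x) / 2) has_field_derivative
      (- 2 / of_real (sqrt pi) * weight m \<beta> x) * (\<mu> * deriv (rho \<beta>) x) / 2) (at x)"
    unfolding w by (rule DERIV_cdivide)
  then have "(cdf_error m r has_field_derivative
      weight m \<beta> x / of_real (sqrt (2 * real m * pi)) * (- of_nat m * of_real (binom_factor m r) / (1 + x))
      - (- 2 / of_real (sqrt pi) * weight m \<beta> x) * (\<mu> * deriv (rho \<beta>) x) / 2) (at x)"
    unfolding cdf_error_def[abs_def] \<beta>_def[symmetric] \<mu>_def
    by (rule DERIV_diff[OF has_field_derivative_binomial_cdf[OF assms, folded \<beta>_def]])
  also have "(- 2 / of_real (sqrt pi) * weight m \<beta> x) * (\<mu> * deriv (rho \<beta>) x) / 2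
      = weight m \<beta> x / of_real (sqrt (2 * real m * pi)) * (of_nat m * source 0 \<beta> x)"
  proof -
    have "complex_of_real (sqrt (2 * real m * pi)) = of_real (sqrt 2) * \<mu> * of_real (sqrt pi)"
      by (simp add: real_sqrt_mult \<mu>_def)
    then show ?thesis using \<mu>0 by (simp add: field_simps flip: \<mu>2)
  qed
  finally show ?thesis by (simp add: \<beta>_def algebra_simps)
qed

text \<open>
  The recursion for the coefficients is made so that all terms of the derivative cancel except
  the next source term and the error of the asymptotic series for the binomial coefficient.
\<close>

lemma has_field_derivative_truncation_error:
  assumes "0 < r" "r < m" "x \<in> slit_plane"
  shows "(truncation_error m r N has_field_derivative
    weight m (real r / real m) x / of_real (sqrt (2 * real m * pi)) *
      (- of_nat m * source N (real r / real m) x / of_nat m ^ N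
       - of_nat m * stirling_error m r N / (1 + x))) (at x)"
proof (induction N)
  case 0
  have "truncation_error m r 0 = cdf_error m r"
    by (simp add: truncation_error_def truncation_def fun_eq_iff)
  then show ?case using has_field_derivative_cdf_error[OF assms]
    by (simp add: stirling_error_def)
next
  case (Suc N)
  define \<beta> where "\<beta> = real r / real m"
  have b: "0 < \<beta>" "\<beta> < 1" using assms by (auto simp: \<beta>_def)
  define s where "s = complex_of_real (saddle \<beta>)"
  define q where "q = complex_of_real (sqrt (2 * real m * pi))"
  define \<mu> where "\<mu> = complex_of_nat m"
  define D where "D = of_real (1 - \<beta>) * (x - s) / (x * (1 + x))"
  define \<psi> where "\<psi> = weight m \<beta> x"
  define a where "a = expansion_coeff N \<beta> x"
  have nz: "1 + x \<noteq> 0" "\<mu> \<noteq> 0" using slit_plane_nonzero[OF assms(3)] assms by (auto simp: \<mu>_def)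
  have eq: "truncation_error m r (Suc N)
      = (\<lambda>x. truncation_error m r N x - weight m \<beta> x * expansion_coeff N \<beta> x / (\<mu> ^ N * q))"
    by (simp add: truncation_error_def truncation_def fun_eq_iff \<beta>_def \<mu>_def q_def ring_distribs add_divide_distrib)
  have "(expansion_coeff N \<beta> has_field_derivative source (Suc N) \<beta> x) (at x)"
    unfolding source_Suc
    by (intro holomorphic_derivI[OF uniform_family_holomorphic[OF uniform_family_expansion_coeff b]
          open_slit_plane assms(3)])
  then have "((\<lambda>x. weight m \<beta> x * expansion_coeff N \<beta> x) has_field_derivative
      - \<psi> * (\<mu> * D) * a + source (Suc N) \<beta> x * \<psi>) (at x)"
    using DERIV_mult[OF has_field_derivative_weight[OF b assms(3)]]
    unfolding D_def \<psi>_def a_def \<mu>_def s_def by blast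
  then have "(truncation_error m r (Suc N) has_field_derivative
     \<psi> / q * (- \<mu> * source N \<beta> x / \<mu> ^ N - \<mu> * stirling_error m r N / (1 + x))
     - (- \<psi> * (\<mu> * D) * a + source (Suc N) \<beta> x * \<psi>) / (\<mu> ^ N * q)) (at x)"
    unfolding eq \<psi>_def q_def \<beta>_def \<mu>_def
    by (intro DERIV_diff DERIV_cdivide Suc.IH)
  also have "\<psi> / q * (- \<mu> * source N \<beta> x / \<mu> ^ N - \<mu> * stirling_error m r N / (1 + x))
     - (- \<psi> * (\<mu> * D) * a + source (Suc N) \<beta> x * \<psi>) / (\<mu> ^ N * q)
     = \<psi> / q * (- \<mu> * source N \<beta> x / \<mu> ^ N - \<mu> * stirling_error m r N / (1 + x)
         + \<mu> * (D * a) / \<mu> ^ N - source (Suc N) \<beta> x / \<mu> ^ N)"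
    using nz by (simp add: algebra_simps add_divide_distrib diff_divide_distrib)
  also have "D * a = source N \<beta> x - (1 + s) * source N \<beta> s / (1 + x)"
    unfolding D_def a_def s_def by (rule expansion_coeff_equation[OF b assms(3)])
  also have "- \<mu> * source N \<beta> x / \<mu> ^ N - \<mu> * stirling_error m r N / (1 + x)
         + \<mu> * (source N \<beta> x - (1 + s) * source N \<beta> s / (1 + x)) / \<mu> ^ N - source (Suc N) \<beta> x / \<mu> ^ N
      = - \<mu> * source (Suc N) \<beta> x / \<mu> ^ Suc N - \<mu> * stirling_error m r (Suc N) / (1 + x)"
  proof -
    have "stirling_error m r (Suc N) = stirling_error m r N + (1 + s) * source N \<beta> s / \<mu> ^ N"
      by (simp add: stirling_error_def \<mu>_def s_def \<beta>_def)
    moreover have "- u * b / p - u * t / y + u * (b - g / y) / p - e / p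
        = - u * e / (u * p) - u * (t + g / p) / y"
      if "u \<noteq> 0" "p \<noteq> 0" "y \<noteq> 0" for u b p t y g e :: complex
      using that by (simp add: field_simps)
    ultimately show ?thesis using nz by simp
  qed
  finally show ?case by (simp add: \<psi>_def q_def \<mu>_def \<beta>_def)
qed

text \<open>
  Each summand of the entropy is bounded through \<open>ln u \<le> u - 1\<close>.
\<close>

lemma h_le_1:
  assumes "0 < \<beta>" "\<beta> < 1"
  shows "h \<beta> \<le> 1"
proof -
  have "- ln u \<le> 1 / u - 1" if "u > 0" for u :: real
    using ln_le_minus_one[of "1 / u"] that by (simp add: ln_div)
  then have "\<beta> * (- ln \<beta>) \<le> \<beta> * (1 / \<beta> - 1)" "(1 - \<beta>) * (- ln (1 - \<beta>)) \<le> (1 - \<beta>) * (1 / (1 - \<beta>) - 1)"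
    using assms by (intro mult_left_mono; force)+
  moreover have "\<beta> * (1 / \<beta> - 1) = 1 - \<beta>" "(1 - \<beta>) * (1 / (1 - \<beta>) - 1) = \<beta>"
    using assms by (simp_all add: field_simps)
  ultimately show ?thesis unfolding h_def by simp
qed

text \<open>
  The radicand tends to infinity at both ends of the positive axis, uniformly in \<open>\<beta>\<close>: at \<open>L\<close> it is at
  least \<open>(1 - \<beta>) * ln L - 1\<close>, and at \<open>1 / L\<close> at least \<open>\<beta> * ln L - 1\<close>.
\<close>

lemma radicand_large_at_ends:
  assumes "0 < b1" "b2 < 1" "B > 0"
  obtains \<eta> L where "0 < \<eta>" "\<eta> \<le> 1 / B" "B \<le> L" "\<eta> < L"
    "\<And>\<beta>. \<beta> \<in> {b1..b2} \<Longrightarrow> \<eta> < saddle \<beta> \<and> saddle \<beta> + 1 < L \<and>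
        \<kappa> \<le> real_radicand \<beta> \<eta> \<and> \<kappa> \<le> real_radicand \<beta> L"
proof -
  define c where "c = min b1 (1 - b2)"
  have c: "c > 0" "c \<le> b1" "c \<le> 1 - b2" using assms by (auto simp: c_def)
  \<comment> \<open>The last three members give \<open>B \<le> L\<close>, \<open>saddle \<beta> + 1 < L\<close> and \<open>1 / L < saddle \<beta>\<close>.\<close>
  define L where "L = Max {exp ((\<bar>\<kappa>\<bar> + 1) / c), \<bar>B\<bar> + 2, 1 / (1 - b2) + 2, 1 / b1 + 1}"
  have L: "exp ((\<bar>\<kappa>\<bar> + 1) / c) \<le> L" "\<bar>B\<bar> + 2 \<le> L" "1 / (1 - b2) + 2 \<le> L" "1 / b1 + 1 \<le> L"
    by (auto simp: L_def)
  have L1: "L > 1" using L(2) by simp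
  have lnL: "c * ln L \<ge> \<bar>\<kappa>\<bar> + 1"
  proof -
    have "ln L \<ge> ln (exp ((\<bar>\<kappa>\<bar> + 1) / c))" using L(1) L1 by (subst ln_le_cancel_iff) auto
    then show ?thesis using c by (simp add: field_simps)
  qed
  show ?thesis
  proof (rule that[of "1 / L" L])
    show "1 / L \<le> 1 / B"
      using L assms by (intro divide_left_mono) auto
    fix \<beta> assume b: "\<beta> \<in> {b1..b2}"
    then have b': "0 < \<beta>" "\<beta> < 1" using assms by auto
    have "1 / L < b1"
    proof -
      have "1 < b1 * L" using L(4) assms by (simp add: field_simps)
      then show ?thesis using L1 by (simp add: field_simps)
    qed
    also have "b1 \<le> saddle \<beta>"
    proof -
      have "\<beta> * 1 \<le> \<beta> * (1 / (1 - \<beta>))" using b' by (intro mult_left_mono) auto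
      then show ?thesis using b by (simp add: saddle_def)
    qed
    finally have 1: "1 / L < saddle \<beta>" .
    have "saddle \<beta> \<le> 1 / (1 - b2)" unfolding saddle_def using b b' assms by (intro frac_le) auto
    then have 2: "saddle \<beta> + 1 < L" using L(3) by simp
    have "c * ln L \<le> \<beta> * ln L" "c * ln L \<le> (1 - \<beta>) * ln L"
      using b c L1 by (auto intro!: mult_right_mono)
    then have "\<beta> * ln L \<ge> \<kappa> + 1" "ln L - \<beta> * ln L \<ge> \<kappa> + 1"
      using lnL by (auto simp: left_diff_distrib)
    moreover have "ln (1 + L) \<ge> ln L" "ln (1 + 1 / L) \<ge> 0" using L1 by auto
    moreover have "ln (1 / L) = - ln L" using L1 by (simp add: ln_div)
    ultimately have "\<kappa> \<le> real_radicand \<beta> (1 / L)" "\<kappa> \<le> real_radicand \<beta> L"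
      unfolding real_radicand_def using h_le_1[OF b'] by simp_all
    with 1 2 show "1 / L < saddle \<beta> \<and> saddle \<beta> + 1 < L \<and>
        \<kappa> \<le> real_radicand \<beta> (1 / L) \<and> \<kappa> \<le> real_radicand \<beta> L" by blast
  next
    show "1 / L < L" using L1 by (smt (verit) divide_less_eq_1_pos less_1_mult less_divide_eq_1_pos)
  qed (use L L1 in auto)
qed

lemma has_real_derivative_Re:
  assumes "(g has_field_derivative D) (at (of_real t))"
  shows "((\<lambda>t. Re (g (of_real t))) has_real_derivative Re D) (at t)"
  using bounded_linear.has_vector_derivative[OF bounded_linear_Re
      has_vector_derivative_real_field[OF assms, of UNIV]]
  by (simp add: has_real_derivative_iff_has_vector_derivative)

text \<open>
  At distance \<open>1 / m\<close> from the saddle point the weight is therefore still bounded below.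
\<close>

lemma real_radicand_le_near_saddle:
  assumes "0 < \<beta>" "\<beta> < 1" "saddle \<beta> \<le> t"
  shows "real_radicand \<beta> t \<le> (t - saddle \<beta>)\<^sup>2 / saddle \<beta>"
proof (cases "t = saddle \<beta>")
  case False
  note s = saddle_pos[OF assms(1,2)]
  have "\<exists>\<xi>. saddle \<beta> < \<xi> \<and> \<xi> < t \<and> real_radicand \<beta> t - real_radicand \<beta> (saddle \<beta>)
      = (t - saddle \<beta>) * ((1 - \<beta>) * (\<xi> - saddle \<beta>) / (\<xi> * (1 + \<xi>)))"
    using False assms s by (intro MVT2 has_real_derivative_real_radicand) auto
  then obtain \<xi> where \<xi>: "saddle \<beta> < \<xi>" "\<xi> < t" "real_radicand \<beta> t
      = (t - saddle \<beta>) * ((1 - \<beta>) * (\<xi> - saddle \<beta>) / (\<xi> * (1 + \<xi>)))"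
    by (auto simp: real_radicand_saddle[OF assms(1,2)])
  have "(1 - \<beta>) * (\<xi> - saddle \<beta>) / (\<xi> * (1 + \<xi>)) \<le> 1 * (t - saddle \<beta>) / (saddle \<beta> * 1)"
    using \<xi> s assms by (intro frac_le mult_mono) auto
  then have "real_radicand \<beta> t \<le> (t - saddle \<beta>) * ((t - saddle \<beta>) / saddle \<beta>)"
    unfolding \<xi>(3) using \<xi> by (intro mult_left_mono) auto
  then show ?thesis by (simp add: power2_eq_square)
qed (simp add: real_radicand_saddle assms)

text \<open>
  The error is small at both ends of the positive axis, hence so is its increment between them. If
  \<^term>\<open>stirling_error m r N\<close> exceeds the first summand of the bound, then it dominates the
  derivative, the error is monotone in the direction of its phase, and the
  increment over the interval from the saddle point \<open>s\<close> to \<open>s + 1 / m\<close> alone yields the second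
  summand.
\<close>

lemma stirling_error_bound:
  assumes mr: "0 < r" "r < m" and \<beta>: "\<beta> = real r / real m"
    and \<eta>: "0 < \<eta>" "\<eta> < saddle \<beta>" and L: "saddle \<beta> + 1 < L" "1 \<le> L"
    and src: "\<And>t. \<eta> \<le> t \<Longrightarrow> t \<le> L \<Longrightarrow> norm (source N \<beta> (of_real t)) \<le> Cb"
    and ends: "norm (truncation_error m r N (of_real \<eta>)) \<le> CE"
      "norm (truncation_error m r N (of_real L)) \<le> CE"
  shows "norm (stirling_error m r N)
    \<le> 2 * (1 + L) * Cb / real m ^ N + 4 * (1 + L) * exp (1 / saddle \<beta>) * sqrt (2 * real m * pi) * CE"
proof (cases "norm (stirling_error m r N) \<le> 2 * (1 + L) * Cb / real m ^ N")
  case True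
  have "CE \<ge> 0" using ends(1) norm_ge_zero order_trans by blast
  then have "0 \<le> 4 * (1 + L) * exp (1 / saddle \<beta>) * sqrt (2 * real m * pi) * CE" using L by simp
  with True show ?thesis by linarith
next
  case False
  have b: "0 < \<beta>" "\<beta> < 1" using mr by (auto simp: \<beta>)
  note s = saddle_pos[OF b]
  have m1: "real m \<ge> 1" using mr by simp
  define \<tau> where "\<tau> = stirling_error m r N"
  define q where "q = sqrt (2 * real m * pi)"
  define k where "k = norm \<tau> / (2 * (1 + L))"
  define w where "w t = exp (- real m * real_radicand \<beta> t)" for t
  have q: "q > 0" using mr by (simp add: q_def)
  have k: "Cb / real m ^ N < k"
  proof -
    have "2 * (1 + L) * (Cb / real m ^ N) < norm \<tau>" using False by (simp add: \<tau>_def)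
    then show ?thesis unfolding k_def using L by (simp add: pos_less_divide_eq mult.commute)
  qed
  have "norm (source N \<beta> (of_real \<eta>)) \<le> Cb" using \<eta> L by (intro src) auto
  then have "Cb \<ge> 0" using norm_ge_zero order_trans by blast
  then have "0 \<le> Cb / real m ^ N" by simp
  with k have k0: "k > 0" by linarith
  then have \<tau>0: "norm \<tau> > 0" unfolding k_def by force
  \<comment> \<open>Rotating by the phase of \<open>\<tau>\<close> makes the dominant term of the derivative real and negative.\<close>
  define u where "u = cnj \<tau> / of_real (norm \<tau>)"
  have u: "norm u = 1" "u * \<tau> = of_real (norm \<tau>)"
  proof -
    show "norm u = 1" using \<tau>0 by (simp add: u_def norm_divide)
    have "u * \<tau> = of_real ((norm \<tau>)\<^sup>2) / of_real (norm \<tau>)"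
      unfolding u_def complex_norm_square by (simp add: mult.commute)
    then show "u * \<tau> = of_real (norm \<tau>)" using \<tau>0 by (simp add: power2_eq_square)
  qed
  define f where "f t = Re (u * truncation_error m r N (of_real t))" for t
  have f': "\<exists>D. (f has_real_derivative D) (at t) \<and> D \<le> - (w t / q) * (real m * k)"
    if t: "\<eta> \<le> t" "t \<le> L" for t
  proof -
    have t0: "t > 0" using \<eta> t by simp
    define D where "D = weight m \<beta> (of_real t) / of_real q *
      (- of_nat m * source N \<beta> (of_real t) / of_nat m ^ N - of_nat m * \<tau> / (1 + of_real t))"
    have "(truncation_error m r N has_field_derivative D) (at (of_real t))"
      unfolding D_def \<beta> q_def \<tau>_def using mr t0 by (intro has_field_derivative_truncation_error) auto
    then have der: "(f has_real_derivative Re (u * D)) (at t)"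
      unfolding f_def by (intro has_real_derivative_Re DERIV_cmult)
    have wt: "weight m \<beta> (of_real t) = of_real (w t)"
      by (simp add: weight_def radicand_of_real[OF t0] w_def flip: exp_of_real)
    have "u * D = of_real (w t / q * real m) *
        (- (u * source N \<beta> (of_real t)) / of_nat m ^ N - (u * \<tau>) / (1 + of_real t))"
      unfolding D_def wt by (simp add: algebra_simps diff_divide_distrib add_divide_distrib)
    also have "\<dots> = of_real (w t / q * real m) *
        (- (u * source N \<beta> (of_real t)) / of_real (real m ^ N) - of_real (norm \<tau> / (1 + t)))"
      unfolding u by simp
    moreover have Re_scaled: "Re (of_real A * (- z / of_real B - of_real C)) = A * (- (Re z / B) - C)"
      for A B C :: real and z by simp
    ultimately have "Re (u * D) = w t / q * real m *
        (- (Re (u * source N \<beta> (of_real t)) / real m ^ N) - norm \<tau> / (1 + t))"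
      by (simp only: Re_scaled)
    also have "\<dots> \<le> w t / q * real m * (- k)"
    proof (rule mult_left_mono)
      have "- Re (u * source N \<beta> (of_real t)) \<le> norm (u * source N \<beta> (of_real t))"
        using abs_Re_le_cmod[of "u * source N \<beta> (of_real t)"] by linarith
      also have "\<dots> \<le> Cb" using src[OF t] u by (simp add: norm_mult)
      finally have "- Re (u * source N \<beta> (of_real t)) / real m ^ N \<le> Cb / real m ^ N"
        using mr by (intro divide_right_mono) auto
      then have "- (Re (u * source N \<beta> (of_real t)) / real m ^ N) \<le> Cb / real m ^ N"
        by (simp only: minus_divide_left)
      moreover have "norm \<tau> / (1 + t) \<ge> norm \<tau> / (1 + L)"
        using t t0 by (intro divide_left_mono) auto
      moreover have "norm \<tau> / (1 + L) = 2 * k" using L by (simp add: k_def field_simps)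
      ultimately show "- (Re (u * source N \<beta> (of_real t)) / real m ^ N) - norm \<tau> / (1 + t) \<le> - k"
        using k by linarith
    qed (use q mr in \<open>simp add: w_def\<close>)
    finally show ?thesis using der by (intro exI[of _ "Re (u * D)"]) (simp add: mult.assoc)
  qed
  have mono: "f t' \<le> f t" if "\<eta> \<le> t" "t \<le> t'" "t' \<le> L" for t t'
  proof (rule DERIV_nonpos_imp_nonincreasing[OF that(2)])
    fix y assume "t \<le> y" "y \<le> t'"
    then have "\<eta> \<le> y" "y \<le> L" using that by linarith+
    then obtain D where "(f has_real_derivative D) (at y)" "D \<le> - (w y / q) * (real m * k)"
      using f' by blast
    moreover have "- (w y / q) * (real m * k) \<le> 0" using q k0 by (simp add: w_def)
    ultimately show "\<exists>D. (f has_real_derivative D) (at y) \<and> D \<le> 0" by force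
  qed
  \<comment> \<open>The weight stays above a constant up to this point.\<close>
  define t1 where "t1 = saddle \<beta> + 1 / real m"
  have t1: "saddle \<beta> < t1" "t1 \<le> saddle \<beta> + 1" using mr m1 by (auto simp: t1_def)
  obtain f1 where f1: "\<And>t. \<eta> \<le> t \<Longrightarrow> t \<le> L \<Longrightarrow>
      (f has_real_derivative f1 t) (at t) \<and> f1 t \<le> - (w t / q) * (real m * k)"
    using f' by metis
  have "\<exists>\<xi>. saddle \<beta> < \<xi> \<and> \<xi> < t1 \<and> f t1 - f (saddle \<beta>) = (t1 - saddle \<beta>) * f1 \<xi>"
    by (rule MVT2[OF t1(1)]) (use f1 \<eta> L t1 in auto)
  then obtain \<xi> where \<xi>: "saddle \<beta> < \<xi>" "\<xi> < t1" "f t1 - f (saddle \<beta>) = (t1 - saddle \<beta>) * f1 \<xi>"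
    by blast
  define e where "e = exp (- (1 / saddle \<beta>))"
  have "w \<xi> \<ge> e"
  proof -
    have "real_radicand \<beta> \<xi> \<le> (\<xi> - saddle \<beta>)\<^sup>2 / saddle \<beta>"
      using real_radicand_le_near_saddle[OF b, of \<xi>] \<xi> by simp
    also have "\<dots> \<le> (1 / real m)\<^sup>2 / saddle \<beta>"
      using \<xi> s by (intro divide_right_mono power_mono) (auto simp: t1_def)
    also have "\<dots> \<le> (1 / real m) / saddle \<beta>"
      using m1 s by (intro divide_right_mono) (auto simp: power2_eq_square field_simps)
    finally have "real m * real_radicand \<beta> \<xi> \<le> real m * ((1 / real m) / saddle \<beta>)"
      using mr by (intro mult_left_mono) auto
    then show ?thesis using mr by (simp add: w_def e_def)
  qed
  then have "w \<xi> / q * (real m * k) \<ge> e / q * (real m * k)"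
    using q k0 by (intro mult_right_mono divide_right_mono) auto
  then have "f1 \<xi> \<le> - (e / q * (real m * k))"
    using f1[of \<xi>] \<xi> \<eta> L t1 by auto
  then have "(1 / real m) * f1 \<xi> \<le> (1 / real m) * (- (e / q * (real m * k)))"
    by (rule mult_left_mono) simp
  then have "f t1 - f (saddle \<beta>) \<le> (1 / real m) * (- (e / q * (real m * k)))"
    using \<xi>(3) by (simp only: t1_def add_diff_cancel_left')
  then have "f t1 - f (saddle \<beta>) \<le> - (e * k / q)" using mr by simp
  moreover have "f L \<le> f t1" "f (saddle \<beta>) \<le> f \<eta>" using \<eta> L t1 by (auto intro!: mono)
  ultimately have "e * k / q \<le> f \<eta> - f L" by linarith
  also have "\<dots> \<le> 2 * CE"
  proof -
    have "\<bar>f t\<bar> \<le> norm (truncation_error m r N (of_real t))" for t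
      unfolding f_def using abs_Re_le_cmod[of "u * truncation_error m r N (of_real t)"] u
      by (simp add: norm_mult)
    from this[of \<eta>] this[of L] ends show ?thesis by linarith
  qed
  finally have "k \<le> 2 * CE * q / e" using q by (simp add: e_def field_simps)
  also have "2 * CE * q / e = 2 * CE * q * exp (1 / saddle \<beta>)"
    by (simp add: e_def exp_minus divide_inverse)
  finally have "norm \<tau> \<le> 4 * (1 + L) * exp (1 / saddle \<beta>) * q * CE"
    using L by (simp add: k_def field_simps)
  moreover have "0 \<le> 2 * (1 + L) * Cb / real m ^ N" using L \<open>Cb \<ge> 0\<close> by simp
  ultimately show ?thesis by (simp add: \<tau>_def q_def)
qed

text \<open>
  With \<open>R = norm x\<close> and \<open>t\<close> the argument of \<open>x\<close>, the square of \<open>norm (1 + x)\<close> is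
  \<open>1 + 2 * R * cos t + R\<^sup>2\<close>, which decreases in \<open>\<bar>t\<bar>\<close>; the other terms of the real part depend on
  \<open>R\<close> only.
\<close>

lemma Re_radicand_arc:
  assumes x: "x \<in> slit_plane" and w: "Re w = ln (norm x)" "\<bar>Im w\<bar> \<le> \<bar>Im (Ln x)\<bar>"
  shows "exp w \<in> slit_plane" "Ln (exp w) = w" "norm (exp w) = norm x"
    "Re (radicand \<beta> x) \<le> Re (radicand \<beta> (exp w))"
proof -
  note nz = slit_plane_nonzero[OF x]
  have lt: "\<bar>Im (Ln x)\<bar> < pi" by (rule abs_Im_Ln_less_pi[OF x])
  then have im: "\<bar>Im w\<bar> < pi" using w by linarith
  then show Ln: "Ln (exp w) = w" by (intro Ln_exp) auto
  show norm: "norm (exp w) = norm x" using w nz by simp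
  show mem: "exp w \<in> slit_plane" by (rule exp_in_slit_plane[OF im])
  have polar: "(norm (1 + exp v))\<^sup>2 = 1 + 2 * exp (Re v) * cos \<bar>Im v\<bar> + (exp (Re v))\<^sup>2" for v
  proof -
    have "(norm (1 + exp v))\<^sup>2 = (1 + exp (Re v) * cos (Im v))\<^sup>2 + (exp (Re v) * sin (Im v))\<^sup>2"
      by (simp add: cmod_power2 Re_exp Im_exp)
    also have "\<dots> = 1 + 2 * exp (Re v) * cos (Im v) + (exp (Re v))\<^sup>2 * ((sin (Im v))\<^sup>2 + (cos (Im v))\<^sup>2)"
      by (simp only: power2_sum power_mult_distrib distrib_left) simp
    finally show ?thesis by simp
  qed
  have "cos \<bar>Im (Ln x)\<bar> \<le> cos \<bar>Im w\<bar>"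
    using w lt by (intro cos_monotone_0_pi_le) auto
  then have "(norm (1 + exp (Ln x)))\<^sup>2 \<le> (norm (1 + exp w))\<^sup>2"
    unfolding polar using w nz by (simp add: mult_left_mono)
  then have "norm (1 + x) \<le> norm (1 + exp w)" using nz by (simp add: power2_le_iff_abs_le)
  then have "ln (norm (1 + x)) \<le> ln (norm (1 + exp w))"
    using nz by (subst ln_le_cancel_iff) (auto simp: slit_plane_nonzero[OF mem])
  then show "Re (radicand \<beta> x) \<le> Re (radicand \<beta> (exp w))"
    unfolding Re_radicand[OF x] Re_radicand[OF mem] norm by simp
qed

text \<open>
  From \<open>x\<close> follow the circle around the origin to the positive axis, and then the axis away from the
  saddle point. The real part of the radicand increases along the whole path, so the weight never
  exceeds its value at \<open>x\<close>, and the mean value inequality bounds the error at \<open>x\<close> by this weight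
  plus the error at the end of the path.
\<close>

lemma truncation_error_path_bound:
  assumes mr: "0 < r" "r < m" and \<beta>: "\<beta> = real r / real m" and x: "x \<in> slit_plane"
    and \<eta>: "0 < \<eta>" "\<eta> < saddle \<beta>" "\<eta> \<le> norm x" and L: "saddle \<beta> < L" "norm x \<le> L"
    and bounds: "\<And>y. y \<in> slit_plane \<Longrightarrow> \<eta> \<le> norm y \<Longrightarrow> norm y \<le> L \<Longrightarrow> \<bar>Im (Ln y)\<bar> \<le> \<bar>Im (Ln x)\<bar> \<Longrightarrow>
        norm (source N \<beta> y) \<le> Cb \<and> norm (1 / (1 + y)) \<le> C1"
    and \<tau>: "norm (stirling_error m r N) \<le> T"
    and ends: "norm (truncation_error m r N (of_real \<eta>)) \<le> CE"
      "norm (truncation_error m r N (of_real L)) \<le> CE"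
  shows "norm (truncation_error m r N x)
    \<le> norm (weight m \<beta> x) / sqrt (2 * real m * pi) * (5 * L * real m * (Cb / real m ^ N + T * C1)) + CE"
proof -
  have b: "0 < \<beta>" "\<beta> < 1" using mr by (auto simp: \<beta>)
  note nz = slit_plane_nonzero[OF x]
  define R where "R = norm x"
  have R: "R > 0" "\<eta> \<le> R" "R \<le> L" using nz \<eta> L by (auto simp: R_def)
  define q where "q = sqrt (2 * real m * pi)"
  have q: "q > 0" using mr by (simp add: q_def)
  define M where "M = real m * (Cb / real m ^ N + T * C1)"
  define E where "E = truncation_error m r N"
  have T0: "T \<ge> 0" using \<tau> norm_ge_zero order_trans by blast
  have C1: "C1 \<ge> 0" "Cb \<ge> 0" using bounds[OF x] \<eta> L by (meson norm_ge_zero order_trans order_refl)+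
  have M0: "M \<ge> 0" unfolding M_def using T0 C1 by simp
  have E': "\<exists>D. (E has_field_derivative D) (at y) \<and> norm D \<le> norm (weight m \<beta> x) / q * M"
    if y: "y \<in> slit_plane" "\<eta> \<le> norm y" "norm y \<le> L" "\<bar>Im (Ln y)\<bar> \<le> \<bar>Im (Ln x)\<bar>"
      "Re (radicand \<beta> x) \<le> Re (radicand \<beta> y)" for y
  proof -
    define D where "D = weight m \<beta> y / of_real q *
      (- of_nat m * source N \<beta> y / of_nat m ^ N - of_nat m * stirling_error m r N / (1 + y))"
    have "(E has_field_derivative D) (at y)"
      unfolding D_def \<beta> q_def E_def using mr y by (intro has_field_derivative_truncation_error)
    moreover have "norm D \<le> norm (weight m \<beta> x) / q * M"
    proof -
      have "norm (- of_nat m * source N \<beta> y / of_nat m ^ N - of_nat m * stirling_error m r N / (1 + y))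
          \<le> norm (- of_nat m * source N \<beta> y / of_nat m ^ N) + norm (of_nat m * stirling_error m r N / (1 + y))"
        by (rule norm_triangle_ineq4)
      also have "\<dots> = real m * (norm (source N \<beta> y) / real m ^ N + norm (stirling_error m r N) * norm (1 / (1 + y)))"
        by (simp add: norm_mult norm_divide norm_power algebra_simps)
      also have "\<dots> \<le> M" unfolding M_def using bounds[OF y(1-4)] \<tau> T0 mr
        by (intro mult_left_mono add_mono mult_mono divide_right_mono) auto
      finally have 1: "norm (- of_nat m * source N \<beta> y / of_nat m ^ N - of_nat m * stirling_error m r N / (1 + y)) \<le> M" .
      have 2: "norm (weight m \<beta> y) \<le> norm (weight m \<beta> x)"
        unfolding norm_weight using y(5) by (simp add: mult_left_mono)
      have "norm D = norm (weight m \<beta> y) / q * norm (- of_nat m * source N \<beta> y / of_nat m ^ N - of_nat m * stirling_error m r N / (1 + y))"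
        unfolding D_def using q by (simp add: norm_mult norm_divide)
      also have "\<dots> \<le> norm (weight m \<beta> x) / q * M"
        using 1 2 q by (intro mult_mono divide_right_mono) auto
      finally show ?thesis .
    qed
    ultimately show ?thesis by blast
  qed
  define W where "W = norm (weight m \<beta> x) / q * M"
  have W: "W \<ge> 0" using q M0 by (simp add: W_def)
  have arc: "norm (E x - E (of_real R)) \<le> W * L * 4"
  proof -
    let ?S = "closed_segment (of_real (ln R)) (Ln x)"
    have on_arc: "Re w = ln (norm x) \<and> \<bar>Im w\<bar> \<le> \<bar>Im (Ln x)\<bar>" if "w \<in> ?S" for w
    proof -
      obtain u where u: "0 \<le> u" "u \<le> 1" "w = (1 - u) *\<^sub>R of_real (ln R) + u *\<^sub>R Ln x"
        using \<open>w \<in> ?S\<close> by (auto simp: closed_segment_def)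
      have "Re w = ln (norm x)" using nz by (simp add: u R_def algebra_simps)
      moreover have "\<bar>Im w\<bar> \<le> 1 * \<bar>Im (Ln x)\<bar>"
        using u by (simp add: abs_mult mult_left_le_one_le)
      ultimately show ?thesis by simp
    qed
    have "\<forall>w\<in>?S. \<exists>D. ((\<lambda>w. E (exp w)) has_field_derivative D) (at w within ?S) \<and> norm D \<le> W * L"
    proof
      fix w assume w: "w \<in> ?S"
      note arc = Re_radicand_arc[OF x conjunct1[OF on_arc[OF w]] conjunct2[OF on_arc[OF w]]]
      obtain D where D: "(E has_field_derivative D) (at (exp w))" "norm D \<le> W"
        using E'[of "exp w"] arc(4)[of \<beta>] on_arc[OF w] \<eta> L unfolding W_def
        by (simp only: arc(1,2,3)) blast
      have "((\<lambda>w. E (exp w)) has_field_derivative D * exp w) (at w within ?S)"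
        using DERIV_chain2[OF D(1) DERIV_exp] by (rule has_field_derivative_at_within)
      moreover have "norm (D * exp w) \<le> W * L"
        unfolding norm_mult arc(3) using D L W by (intro mult_mono) auto
      ultimately show "\<exists>D. ((\<lambda>w. E (exp w)) has_field_derivative D) (at w within ?S) \<and> norm D \<le> W * L"
        by blast
    qed
    then obtain D where D: "\<And>w. w \<in> ?S \<Longrightarrow> ((\<lambda>w. E (exp w)) has_field_derivative D w) (at w within ?S)"
      "\<And>w. w \<in> ?S \<Longrightarrow> norm (D w) \<le> W * L" by metis
    have "norm (E (exp (Ln x)) - E (exp (of_real (ln R)))) \<le> W * L * norm (Ln x - of_real (ln R))"
      by (rule field_differentiable_bound[OF convex_closed_segment D]) auto
    also have "norm (Ln x - of_real (ln R)) \<le> 4"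
    proof -
      have "Ln x - of_real (ln R) = \<i> * of_real (Im (Ln x))"
        using nz by (simp add: complex_eq_iff R_def)
      then have "norm (Ln x - of_real (ln R)) = \<bar>Im (Ln x)\<bar>" by (simp add: norm_mult)
      also have "\<dots> \<le> pi" using mpi_less_Im_Ln[of x] Im_Ln_le_pi[of x] nz by (simp add: abs_le_iff)
      also have "\<dots> \<le> 4" using pi_less_4 by simp
      finally show ?thesis .
    qed
    finally show ?thesis using nz R W L by (simp add: exp_of_real mult_left_mono)
  qed
  have Rx: "Re (radicand \<beta> x) \<le> real_radicand \<beta> R"
    using Re_radicand_arc(4)[OF x, of "of_real (ln R)" \<beta>] R radicand_of_real[OF R(1)]
    by (simp add: R_def exp_of_real)
  have radial: "norm (E (of_real t) - E (of_real R)) \<le> W * L"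
    if t: "\<eta> \<le> t" "t \<le> L" "\<And>y. y \<in> closed_segment R t \<Longrightarrow> real_radicand \<beta> R \<le> real_radicand \<beta> y" for t
  proof -
    let ?S = "closed_segment (complex_of_real R) (of_real t)"
    have "\<forall>y\<in>?S. \<exists>D. (E has_field_derivative D) (at y within ?S) \<and> norm D \<le> W"
    proof
      fix y assume "y \<in> ?S"
      then obtain v where v: "y = of_real v" "v \<in> closed_segment R t"
        by (auto simp: closed_segment_of_real)
      have v0: "v > 0" "\<eta> \<le> v" "v \<le> L"
        using v R t \<eta> by (auto simp: closed_segment_eq_real_ivl split: if_splits)
      have "\<exists>D. (E has_field_derivative D) (at y) \<and> norm D \<le> W"
        unfolding W_def using v0 Rx t(3)[OF v(2)]
        by (intro E') (auto simp: v radicand_of_real)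
      then show "\<exists>D. (E has_field_derivative D) (at y within ?S) \<and> norm D \<le> W"
        using has_field_derivative_at_within by blast
    qed
    then obtain D where D: "\<And>y. y \<in> ?S \<Longrightarrow> (E has_field_derivative D y) (at y within ?S)"
      "\<And>y. y \<in> ?S \<Longrightarrow> norm (D y) \<le> W" by metis
    have "norm (E (of_real t) - E (of_real R)) \<le> W * norm (complex_of_real t - of_real R)"
      by (rule field_differentiable_bound[OF convex_closed_segment D]) auto
    also have "norm (complex_of_real t - of_real R) = \<bar>t - R\<bar>" by (simp flip: of_real_diff)
    also have "W * \<bar>t - R\<bar> \<le> W * L" using R t \<eta> W by (intro mult_left_mono) auto
    finally show ?thesis .
  qed
  have "norm (E (of_real R)) \<le> CE + W * L"
  proof (cases "R \<ge> saddle \<beta>")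
    case True
    have "norm (E (of_real L) - E (of_real R)) \<le> W * L"
    proof (rule radial)
      fix y assume "y \<in> closed_segment R L"
      then have "R \<le> y" using R by (auto simp: closed_segment_eq_real_ivl)
      then show "real_radicand \<beta> R \<le> real_radicand \<beta> y"
        using real_radicand_strict_mono[OF b True, of y] by (cases "R = y") auto
    qed (use R in auto)
    with ends(2) show ?thesis unfolding E_def[symmetric]
      using norm_triangle_ineq2[of "E (of_real R)" "E (of_real L)"] by (simp add: norm_minus_commute)
  next
    case False
    have "norm (E (of_real \<eta>) - E (of_real R)) \<le> W * L"
    proof (rule radial)
      fix y assume "y \<in> closed_segment R \<eta>"
      then have "y \<le> R" "\<eta> \<le> y" using R by (auto simp: closed_segment_eq_real_ivl split: if_splits)
      then show "real_radicand \<beta> R \<le> real_radicand \<beta> y"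
        using real_radicand_strict_antimono[OF b, of R y] False \<eta> by (cases "R = y") auto
    qed (use R in auto)
    with ends(1) show ?thesis unfolding E_def[symmetric]
      using norm_triangle_ineq2[of "E (of_real R)" "E (of_real \<eta>)"] by (simp add: norm_minus_commute)
  qed
  then have "norm (E x) \<le> W * (5 * L) + CE"
    using arc norm_triangle_ineq2[of "E x" "E (of_real R)"] by (simp add: algebra_simps)
  also have "W * (5 * L) = norm (weight m \<beta> x) / q * (5 * L * real m * (Cb / real m ^ N + T * C1))"
    by (simp add: W_def M_def)
  finally show ?thesis by (simp add: E_def q_def)
qed

section \<open>The uniform expansion\<close>

text \<open>
  The constants describe a compact set that also contains the integration paths of its points.
\<close>

lemma compact_in_log_rectangle:
  assumes K: "compact K" "K \<subseteq> slit_plane"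
  obtains B \<alpha> where "B > 0" "0 \<le> \<alpha>" "\<alpha> < pi"
    "\<And>x. x \<in> K \<Longrightarrow> 1 / B \<le> norm x \<and> norm x \<le> B \<and> \<bar>Im (Ln x)\<bar> \<le> \<alpha>"
proof -
  define K1 where "K1 = insert 1 K"
  have K1: "compact K1" "K1 \<subseteq> slit_plane" "K1 \<noteq> {}"
    using K by (auto simp: K1_def slit_plane_iff)
  have nz: "x \<noteq> 0" "x \<notin> \<real>\<^sub>\<le>\<^sub>0" if "x \<in> K1" for x
    using slit_plane_nonzero[OF subsetD[OF K1(2) that]] by auto
  have "continuous_on K1 (\<lambda>x. \<bar>Im (Ln x)\<bar>)" "continuous_on K1 (\<lambda>x. norm x)"
    "continuous_on K1 (\<lambda>x. 1 / norm x)"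
    using nz by (auto intro!: continuous_intros)
  note attain = continuous_attains_sup[OF K1(1,3) this(1)] continuous_attains_sup[OF K1(1,3) this(2)]
    continuous_attains_sup[OF K1(1,3) this(3)]
  obtain a where a: "a \<in> K1" "\<forall>x\<in>K1. \<bar>Im (Ln x)\<bar> \<le> \<bar>Im (Ln a)\<bar>" using attain(1) by blast
  obtain b where b: "b \<in> K1" "\<forall>x\<in>K1. norm x \<le> norm b" using attain(2) by blast
  obtain c where c: "c \<in> K1" "\<forall>x\<in>K1. 1 / norm x \<le> 1 / norm c" using attain(3) by blast
  define B where "B = max (norm b) (1 / norm c)"
  have B: "B > 0" using nz[OF b(1)] by (simp add: B_def less_max_iff_disj)
  show ?thesis
  proof (rule that[of B "\<bar>Im (Ln a)\<bar>"])
    show "\<bar>Im (Ln a)\<bar> < pi" using a K1 by (intro abs_Im_Ln_less_pi) auto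
    fix x assume "x \<in> K"
    then have x: "x \<in> K1" by (simp add: K1_def)
    then have "1 / norm x \<le> B" using c by (auto simp: B_def)
    then have "1 / B \<le> norm x" using B nz[OF x] by (simp add: field_simps)
    moreover have "norm x \<le> B" using b x by (auto simp: B_def)
    ultimately show "1 / B \<le> norm x \<and> norm x \<le> B \<and> \<bar>Im (Ln x)\<bar> \<le> \<bar>Im (Ln a)\<bar>"
      using a x by blast
  qed (use B in auto)
qed

lemma compact_annular_sector:
  assumes "0 < \<eta>" "0 \<le> \<alpha>" "\<alpha> < pi"
  obtains S where "compact S" "S \<subseteq> slit_plane"
    "\<And>y. y \<in> slit_plane \<Longrightarrow> \<eta> \<le> norm y \<Longrightarrow> norm y \<le> L \<Longrightarrow> \<bar>Im (Ln y)\<bar> \<le> \<alpha> \<Longrightarrow> y \<in> S"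
proof
  let ?S = "exp ` cbox (Complex (ln \<eta>) (- \<alpha>)) (Complex (ln L) \<alpha>)"
  show "compact ?S" by (intro compact_continuous_image continuous_intros compact_cbox)
  show "?S \<subseteq> slit_plane"
  proof
    fix y assume "y \<in> ?S"
    then obtain w where w: "w \<in> cbox (Complex (ln \<eta>) (- \<alpha>)) (Complex (ln L) \<alpha>)" "y = exp w" by blast
    then have "\<bar>Im w\<bar> \<le> \<alpha>" by (simp add: in_cbox_complex_iff abs_le_iff)
    then show "y \<in> slit_plane" unfolding w(2) using assms(3) by (intro exp_in_slit_plane) linarith
  qed
  fix y assume y: "y \<in> slit_plane" "\<eta> \<le> norm y" "norm y \<le> L" "\<bar>Im (Ln y)\<bar> \<le> \<alpha>"
  note nz = slit_plane_nonzero[OF y(1)]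
  have "Ln y \<in> cbox (Complex (ln \<eta>) (- \<alpha>)) (Complex (ln L) \<alpha>)"
    using y nz assms(1) by (simp add: in_cbox_complex_iff abs_le_iff)
  then show "y \<in> ?S" using nz by (intro image_eqI[of _ exp "Ln y"]) auto
qed

lemma power_times_exp_minus_le:
  assumes "m > 0"
  shows "real m ^ k * exp (- real m) \<le> fact k"
proof -
  have "real m ^ k / fact k \<le> exp (real m)"
    using sum_le_suminf[OF summable_exp_generic[of "real m"], of "{k}"]
    by (simp add: exp_def divide_inverse mult.commute)
  then show ?thesis by (simp add: exp_minus divide_simps mult.commute)
qed

lemma sqrt_2_m_pi_bounds:
  assumes "m > 0"
  shows "1 \<le> sqrt (2 * real m * pi)" "sqrt (2 * real m * pi) \<le> 3 * real m"
proof -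
  have m: "real m \<ge> 1" using assms by simp
  have "1 * 1 \<le> real m * pi" using m pi_ge_two by (intro mult_mono) auto
  then show "1 \<le> sqrt (2 * real m * pi)" by simp
  have "2 * real m * pi \<le> 2 * real m * 4" using pi_less_4 m by (intro mult_left_mono) auto
  also have "\<dots> \<le> 9 * (real m * real m)" using m mult_left_mono[OF m, of "real m"] by simp
  finally show "sqrt (2 * real m * pi) \<le> 3 * real m"
    using m by (intro real_le_lsqrt) (auto simp: power2_eq_square)
qed

lemma ratio_in_interval:
  assumes "0 < b1" "b2 < 1" "m > 0" "\<beta> = real r / real m" "\<beta> \<in> {b1..b2}"
  shows "0 < r \<and> r < m"
proof -
  have "0 < \<beta>" "\<beta> < 1" using assms(1,2,5) by auto
  then show ?thesis using assms(3) unfolding assms(4) by (simp add: zero_less_divide_iff)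
qed

text \<open>
  The ends of the axis are chosen so far out that the weight there is smaller by the factor
  \<open>exp (- m)\<close> than the weight anywhere on \<open>K\<close>. The estimate loses one power of \<open>m\<close>.
\<close>

lemma truncation_error_crude:
  assumes b12: "0 < b1" "b2 < 1" and K: "compact K" "K \<subseteq> slit_plane"
  obtains C T where "C \<ge> 0" "T \<ge> 0"
    "\<And>m r \<beta>. m > 0 \<Longrightarrow> \<beta> = real r / real m \<Longrightarrow> \<beta> \<in> {b1..b2} \<Longrightarrow>
       norm (stirling_error m r N) \<le> T / real m ^ N"
    "\<And>m r \<beta> x. m > 0 \<Longrightarrow> \<beta> = real r / real m \<Longrightarrow> \<beta> \<in> {b1..b2} \<Longrightarrow> x \<in> K \<Longrightarrow>
       norm (truncation_error m r N x) * sqrt (2 * real m * pi)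
         \<le> norm (weight m \<beta> x) * (C * real m / real m ^ N)"
proof -
  obtain B \<alpha> where B: "B > 0" and \<alpha>: "0 \<le> \<alpha>" "\<alpha> < pi"
    and KB: "\<And>x. x \<in> K \<Longrightarrow> 1 / B \<le> norm x \<and> norm x \<le> B \<and> \<bar>Im (Ln x)\<bar> \<le> \<alpha>"
    using compact_in_log_rectangle[OF K] by metis
  obtain Cr where Cr: "Cr > 0" "\<And>\<beta> x. \<beta> \<in> {b1..b2} \<Longrightarrow> x \<in> K \<Longrightarrow> norm (radicand \<beta> x) \<le> Cr"
    using uniform_family_bounded[OF uniform_family_radicand b12 K] by metis
  \<comment> \<open>The excess \<open>1\<close> over the radicand on \<open>K\<close> yields the factor \<open>exp (- m)\<close>.\<close>
  define \<kappa> where "\<kappa> = Cr + 1"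
  obtain \<eta> L where \<eta>: "0 < \<eta>" "\<eta> \<le> 1 / B" and L: "B \<le> L" "\<eta> < L" and ends:
    "\<And>\<beta>. \<beta> \<in> {b1..b2} \<Longrightarrow> \<eta> < saddle \<beta> \<and> saddle \<beta> + 1 < L \<and>
        \<kappa> \<le> real_radicand \<beta> \<eta> \<and> \<kappa> \<le> real_radicand \<beta> L"
    using radicand_large_at_ends[OF b12 B, of \<kappa>] by metis
  obtain S where S: "compact S" "S \<subseteq> slit_plane" and S_mem:
    "\<And>y. y \<in> slit_plane \<Longrightarrow> \<eta> \<le> norm y \<Longrightarrow> norm y \<le> L \<Longrightarrow> \<bar>Im (Ln y)\<bar> \<le> \<alpha> \<Longrightarrow> y \<in> S"
    using compact_annular_sector[OF \<eta>(1) \<alpha>, where L = L] by metis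
  have S_real: "complex_of_real t \<in> S" if "\<eta> \<le> t" "t \<le> L" for t
    using that \<eta> \<alpha> by (intro S_mem) auto
  obtain Cb where Cb: "Cb > 0" "\<And>\<beta> x. \<beta> \<in> {b1..b2} \<Longrightarrow> x \<in> S \<Longrightarrow> norm (source N \<beta> x) \<le> Cb"
    using uniform_family_bounded[OF uniform_family_source b12 S] by metis
  have "uniform_family (\<lambda>_ x. 1 / (1 + x))"
    using slit_plane_nonzero by (intro uniform_family_fixed holomorphic_intros) auto
  from uniform_family_bounded[OF this b12 S]
  obtain C1 where C1: "C1 > 0" "\<And>\<beta> x. \<beta> \<in> {b1..b2} \<Longrightarrow> x \<in> S \<Longrightarrow> norm (1 / (1 + x)) \<le> C1"
    by metis
  have "\<exists>c. \<forall>\<beta>\<in>{b1..b2}. \<forall>x\<in>S. norm (expansion_coeff k \<beta> x) \<le> c" for k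
    using uniform_family_expansion_coeff[of k] b12 S unfolding uniform_family_def by blast
  then obtain ca where ca: "\<And>k \<beta> x. \<beta> \<in> {b1..b2} \<Longrightarrow> x \<in> S \<Longrightarrow> norm (expansion_coeff k \<beta> x) \<le> ca k"
    by metis
  define G where "G = 2 + (\<Sum>k<N. \<bar>ca k\<bar>)"
  have G: "G \<ge> 2" unfolding G_def by (simp add: sum_nonneg)
  define H where "H = 4 * (1 + L) * exp (1 / b1)"
  have L0: "L > 0" using L \<eta> by linarith
  have H: "H \<ge> 0" using L0 by (simp add: H_def)
  \<comment> \<open>A bound for \<open>m ^ (N + 1) * exp (- m)\<close>.\<close>
  define D :: real where "D = fact (Suc N)"
  have D: "D > 0" by (simp add: D_def)
  define T where "T = 2 * (1 + L) * Cb + 3 * H * G * D"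
  have T: "T \<ge> 0" using L0 Cb H G D by (simp add: T_def)
  define C where "C = 5 * L * (Cb + T * C1) + 3 * G * D"
  have C: "C \<ge> 0" using L0 Cb T C1 G D by (simp add: C_def)

  have small: "sqrt (2 * real m * pi) * exp (- real m) \<le> 3 * D / real m ^ N" if "m > 0" for m
  proof -
    have le: "sqrt (2 * real m * pi) * exp (- real m) \<le> 3 * real m * exp (- real m)"
      using sqrt_2_m_pi_bounds[OF that] by (intro mult_right_mono) auto
    have "real m * exp (- real m) \<le> D / real m ^ N"
      using power_times_exp_minus_le[OF that, of "Suc N"] that
      by (simp add: D_def field_simps del: fact_Suc)
    then have "3 * (real m * exp (- real m)) \<le> 3 * (D / real m ^ N)" by simp
    with le show ?thesis by (simp only: mult.assoc times_divide_eq_right order_trans)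
  qed
  have end_bound: "norm (truncation_error m r N (of_real t)) \<le> G * exp (- real m * \<kappa>)"
    if mr: "m > 0" "0 < r" "r < m" and \<beta>: "\<beta> = real r / real m" "\<beta> \<in> {b1..b2}"
      and t: "t \<in> {\<eta>, L}" for m r \<beta> t
  proof -
    have t': "t > 0" "t \<noteq> saddle \<beta>" "\<kappa> \<le> real_radicand \<beta> t" "\<eta> \<le> t" "t \<le> L"
      using t ends[OF \<beta>(2)] \<eta> L by auto
    define q where "q = sqrt (2 * real m * pi)"
    have q: "q \<ge> 1" using sqrt_2_m_pi_bounds[OF mr(1)] by (simp add: q_def)
    define e where "e = exp (- real m * \<kappa>)"
    have e: "exp (- real m * real_radicand \<beta> t) \<le> e" using t' by (simp add: e_def mult_left_mono)
    have "norm (cdf_error m r (of_real t)) \<le> 3 / 2 * exp (- real m * real_radicand \<beta> t)"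
      unfolding \<beta>(1) using mr t' by (intro cdf_error_of_real) (auto simp: \<beta>(1))
    also have "\<dots> \<le> 2 * e"
    proof -
      have "e \<ge> 0" by (simp add: e_def)
      with e show ?thesis by linarith
    qed
    finally have 1: "norm (cdf_error m r (of_real t)) \<le> 2 * e" .
    have "norm (truncation m r N (of_real t)) \<le> (\<Sum>k<N. \<bar>ca k\<bar>)"
      unfolding truncation_def \<beta>(1)[symmetric]
    proof (rule sum_norm_le)
      fix k
      have "norm (expansion_coeff k \<beta> (of_real t)) / real m ^ k \<le> \<bar>ca k\<bar> / 1"
        using ca[OF \<beta>(2) S_real[OF t'(4,5)], of k] mr by (intro frac_le) auto
      then show "norm (expansion_coeff k \<beta> (of_real t) / of_nat m ^ k) \<le> \<bar>ca k\<bar>"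
        by (simp add: norm_divide norm_power)
    qed
    moreover have "norm (weight m \<beta> (of_real t)) \<le> e"
      unfolding norm_weight using e t' by (simp add: radicand_of_real)
    ultimately have "norm (weight m \<beta> (of_real t)) * norm (truncation m r N (of_real t)) / q
        \<le> e * (\<Sum>k<N. \<bar>ca k\<bar>) / 1"
      using q by (intro frac_le mult_mono) (auto simp: e_def sum_nonneg)
    then have 2: "norm (weight m \<beta> (of_real t) * truncation m r N (of_real t) / of_real q) \<le> e * (\<Sum>k<N. \<bar>ca k\<bar>)"
      using q by (simp add: norm_mult norm_divide)
    have "norm (truncation_error m r N (of_real t)) \<le> 2 * e + e * (\<Sum>k<N. \<bar>ca k\<bar>)"
      unfolding truncation_error_def \<beta>(1)[symmetric] q_def[symmetric]
      by (intro order_trans[OF norm_triangle_ineq4] add_mono 1 2)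
    then show ?thesis by (simp add: G_def e_def algebra_simps)
  qed
  have \<tau>: "norm (stirling_error m r N) \<le> T / real m ^ N"
    if mr: "m > 0" and \<beta>: "\<beta> = real r / real m" "\<beta> \<in> {b1..b2}" for m r \<beta>
  proof -
    have r: "0 < r" "r < m" using ratio_in_interval[OF b12 mr \<beta>] by auto
    have b: "0 < \<beta>" "\<beta> < 1" using \<beta>(2) b12 by auto
    have "norm (stirling_error m r N) \<le> 2 * (1 + L) * Cb / real m ^ N
       + 4 * (1 + L) * exp (1 / saddle \<beta>) * sqrt (2 * real m * pi) * (G * exp (- real m * \<kappa>))"
    proof (rule stirling_error_bound[OF r \<beta>(1) \<eta>(1)])
      show "\<eta> < saddle \<beta>" "saddle \<beta> + 1 < L" "1 \<le> L"
        using ends[OF \<beta>(2)] saddle_pos[OF b] by auto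
      show "norm (source N \<beta> (of_real t)) \<le> Cb" if "\<eta> \<le> t" "t \<le> L" for t
        using Cb(2)[OF \<beta>(2) S_real[OF that]] .
    qed (use end_bound[OF mr r \<beta>] in auto)
    also have "4 * (1 + L) * exp (1 / saddle \<beta>) * sqrt (2 * real m * pi) * (G * exp (- real m * \<kappa>))
        \<le> H * sqrt (2 * real m * pi) * (G * exp (- real m))"
    proof -
      have "b1 \<le> saddle \<beta>"
      proof -
        have "\<beta> * 1 \<le> \<beta> * (1 / (1 - \<beta>))" using b by (intro mult_left_mono) auto
        then show ?thesis using \<beta>(2) by (simp add: saddle_def)
      qed
      then have "exp (1 / saddle \<beta>) \<le> exp (1 / b1)" using b12 by (simp add: frac_le)
      moreover have "exp (- real m * \<kappa>) \<le> exp (- real m)"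
        using Cr(1) by (simp add: \<kappa>_def distrib_left)
      ultimately show ?thesis unfolding H_def using L0 G by (intro mult_mono) auto
    qed
    also have "H * sqrt (2 * real m * pi) * (G * exp (- real m)) = H * G * (sqrt (2 * real m * pi) * exp (- real m))"
      by simp
    also have "\<dots> \<le> H * G * (3 * D / real m ^ N)"
      using small[OF mr] H G by (intro mult_left_mono) auto
    also have "2 * (1 + L) * Cb / real m ^ N + H * G * (3 * D / real m ^ N) = T / real m ^ N"
      by (simp add: T_def add_divide_distrib)
    finally show ?thesis by simp
  qed
  have main: "norm (truncation_error m r N x) * sqrt (2 * real m * pi)
         \<le> norm (weight m \<beta> x) * (C * real m / real m ^ N)"
    if mr: "m > 0" and \<beta>: "\<beta> = real r / real m" "\<beta> \<in> {b1..b2}" and x: "x \<in> K" for m r \<beta> x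
  proof -
    have r: "0 < r" "r < m" using ratio_in_interval[OF b12 mr \<beta>] by auto
    have b: "0 < \<beta>" "\<beta> < 1" using \<beta>(2) b12 by auto
    have xs: "x \<in> slit_plane" using x K by auto
    define q where "q = sqrt (2 * real m * pi)"
    have q: "q \<ge> 1" using sqrt_2_m_pi_bounds[OF mr(1)] by (simp add: q_def)
    have "norm (truncation_error m r N x)
      \<le> norm (weight m \<beta> x) / q * (5 * L * real m * (Cb / real m ^ N + T / real m ^ N * C1))
        + G * exp (- real m * \<kappa>)"
      unfolding q_def
    proof (rule truncation_error_path_bound[OF r \<beta>(1) xs \<eta>(1)])
      show "\<eta> < saddle \<beta>" "\<eta> \<le> norm x" "saddle \<beta> < L" "norm x \<le> L"
        using ends[OF \<beta>(2)] KB[OF x] \<eta> L by auto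
      fix y assume y: "y \<in> slit_plane" "\<eta> \<le> norm y" "norm y \<le> L" "\<bar>Im (Ln y)\<bar> \<le> \<bar>Im (Ln x)\<bar>"
      then have "y \<in> S" using KB[OF x] by (intro S_mem) auto
      then show "norm (source N \<beta> y) \<le> Cb \<and> norm (1 / (1 + y)) \<le> C1"
        using Cb(2)[OF \<beta>(2)] C1(2)[OF \<beta>(2)] by auto
    qed (use end_bound[OF mr r \<beta>] \<tau>[OF mr \<beta>] in auto)
    then have "norm (truncation_error m r N x) * q
      \<le> (norm (weight m \<beta> x) / q * (5 * L * real m * (Cb / real m ^ N + T / real m ^ N * C1))
        + G * exp (- real m * \<kappa>)) * q"
      using q by (intro mult_right_mono) auto
    also have "\<dots> = norm (weight m \<beta> x) * (5 * L * (Cb + T * C1) * real m / real m ^ N)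
        + G * (q * exp (- real m * \<kappa>))"
      using q mr by (simp add: field_simps)
    also have "q * exp (- real m * \<kappa>) \<le> norm (weight m \<beta> x) * (3 * D * real m / real m ^ N)"
    proof -
      have "Re (radicand \<beta> x) \<le> Cr"
        using Cr(2)[OF \<beta>(2) x] complex_Re_le_cmod[of "radicand \<beta> x"] by linarith
      then have "exp (- real m * Cr) \<le> norm (weight m \<beta> x)"
        unfolding norm_weight by (simp add: mult_left_mono)
      moreover have "q * exp (- real m) \<le> 3 * D * real m / real m ^ N"
      proof -
        have "3 * D / real m ^ N \<le> 3 * D * real m / real m ^ N"
          using mr D by (intro divide_right_mono) auto
        then show ?thesis using small[OF mr] unfolding q_def by linarith
      qed
      ultimately have "exp (- real m * Cr) * (q * exp (- real m))
          \<le> norm (weight m \<beta> x) * (3 * D * real m / real m ^ N)"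
        using q by (intro mult_mono) auto
      moreover have "exp (- real m * \<kappa>) = exp (- real m * Cr) * exp (- real m)"
        by (simp add: \<kappa>_def distrib_left flip: exp_add)
      ultimately show ?thesis by (simp add: mult_ac)
    qed
    finally have "norm (truncation_error m r N x) * q
       \<le> norm (weight m \<beta> x) * (5 * L * (Cb + T * C1) * real m / real m ^ N)
        + G * (norm (weight m \<beta> x) * (3 * D * real m / real m ^ N))"
      using G by (simp add: mult_left_mono)
    also have "\<dots> = norm (weight m \<beta> x) * (C * real m / real m ^ N)"
      unfolding C_def by (simp add: algebra_simps add_divide_distrib)
    finally show ?thesis by (simp add: q_def)
  qed
  show ?thesis using that[OF C T] \<tau> main by blast
qed

text \<open>
  The estimate for one further term, with the additional term moved to the error, recovers the
  power of \<open>m\<close> that was lost.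
\<close>

lemma truncation_error_sharp:
  assumes b12: "0 < b1" "b2 < 1" and K: "compact K" "K \<subseteq> slit_plane"
  obtains C where "C \<ge> 0"
    "\<And>m r \<beta> x. m > 0 \<Longrightarrow> \<beta> = real r / real m \<Longrightarrow> \<beta> \<in> {b1..b2} \<Longrightarrow> x \<in> K \<Longrightarrow>
       norm (truncation_error m r N x) * sqrt (2 * real m * pi)
         \<le> norm (weight m \<beta> x) * (C / real m ^ N)"
proof -
  obtain C T where C: "C \<ge> 0"
    "\<And>m r \<beta> x. m > 0 \<Longrightarrow> \<beta> = real r / real m \<Longrightarrow> \<beta> \<in> {b1..b2} \<Longrightarrow> x \<in> K \<Longrightarrow>
       norm (truncation_error m r (Suc N) x) * sqrt (2 * real m * pi)
         \<le> norm (weight m \<beta> x) * (C * real m / real m ^ Suc N)"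
    using truncation_error_crude[OF assms, of "Suc N"] by metis
  obtain a where a: "a > 0" "\<And>\<beta> x. \<beta> \<in> {b1..b2} \<Longrightarrow> x \<in> K \<Longrightarrow> norm (expansion_coeff N \<beta> x) \<le> a"
    using uniform_family_bounded[OF uniform_family_expansion_coeff assms] by metis
  show ?thesis
  proof (rule that[of "C + a"])
    fix m r \<beta> x assume H: "m > 0" "\<beta> = real r / real m" "\<beta> \<in> {b1..b2}" "x \<in> K"
    define q where "q = sqrt (2 * real m * pi)"
    have q: "q \<ge> 1" using sqrt_2_m_pi_bounds[OF H(1)] by (simp add: q_def)
    have "truncation_error m r N x = truncation_error m r (Suc N) x
        + weight m \<beta> x * (expansion_coeff N \<beta> x / of_nat m ^ N) / of_real q"
      unfolding truncation_error_def truncation_def H(2)[symmetric] q_def[symmetric]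
      by (simp add: ring_distribs add_divide_distrib)
    then have "norm (truncation_error m r N x) * q \<le> (norm (truncation_error m r (Suc N) x)
        + norm (weight m \<beta> x * (expansion_coeff N \<beta> x / of_nat m ^ N) / of_real q)) * q"
      using q by (intro mult_right_mono) (auto intro: norm_triangle_ineq)
    also have "\<dots> = norm (truncation_error m r (Suc N) x) * q
        + norm (weight m \<beta> x) * (norm (expansion_coeff N \<beta> x) / real m ^ N)"
      using q by (simp add: norm_mult norm_divide norm_power distrib_right)
    also have "\<dots> \<le> norm (weight m \<beta> x) * (C * real m / real m ^ Suc N) + norm (weight m \<beta> x) * (a / real m ^ N)"
      using C(2)[OF H] a(2)[OF H(3,4)] unfolding q_def
      by (intro add_mono mult_left_mono divide_right_mono) auto
    also have "\<dots> = norm (weight m \<beta> x) * ((C + a) / real m ^ N)"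
      using H(1) by (simp add: field_simps)
    finally show "norm (truncation_error m r N x) * sqrt (2 * real m * pi)
         \<le> norm (weight m \<beta> x) * ((C + a) / real m ^ N)" by (simp add: q_def)
  qed (use C a in auto)
qed

lemma F_eq_approx:
  assumes mr: "0 < r" "r < m" and \<beta>: "\<beta> = real r / real m" and x: "x \<in> slit_plane"
  shows "F m r x = approx m \<beta> x (truncation m r N x
    + truncation_error m r N x * of_real (sqrt (2 * real m * pi)) / weight m \<beta> x)"
proof -
  have b: "0 < \<beta>" "\<beta> < 1" using mr by (auto simp: \<beta>)
  note nz = slit_plane_nonzero[OF x]
  have q: "complex_of_real (sqrt (2 * real m * pi)) \<noteq> 0" using mr by simp
  have "F m r x = (1 + x) ^ m * (erfc (of_real (sqrt (real m)) * rho \<beta> x) / 2 + cdf_error m r x)"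
    using nz by (simp add: cdf_error_def \<beta>)
  also have "cdf_error m r x = (truncation m r N x
    + truncation_error m r N x * of_real (sqrt (2 * real m * pi)) / weight m \<beta> x)
      * weight m \<beta> x / of_real (sqrt (2 * real m * pi))"
    unfolding truncation_error_def \<beta>[symmetric] using q by (simp add: field_simps)
  finally show ?thesis unfolding approx_eq[OF b x] .
qed

lemma uniform_expansion:
  assumes b12: "0 < b1" "b2 < 1" and K: "compact K" "K \<subseteq> slit_plane"
  obtains C where "C \<ge> 0"
    "\<And>m r \<beta> x. m > 0 \<Longrightarrow> \<beta> = real r / real m \<Longrightarrow> \<beta> \<in> {b1..b2} \<Longrightarrow> x \<in> K \<Longrightarrow>
       \<exists>R. norm R \<le> C / real m ^ N \<and>
         F m r x = approx m \<beta> x ((\<Sum>k<N. expansion_coeff k \<beta> x / of_nat m ^ k) + R)"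
proof -
  obtain C where C: "C \<ge> 0"
    "\<And>m r \<beta> x. m > 0 \<Longrightarrow> \<beta> = real r / real m \<Longrightarrow> \<beta> \<in> {b1..b2} \<Longrightarrow> x \<in> K \<Longrightarrow>
       norm (truncation_error m r N x) * sqrt (2 * real m * pi)
         \<le> norm (weight m \<beta> x) * (C / real m ^ N)"
    using truncation_error_sharp[OF assms, of N] by metis
  show ?thesis
  proof (rule that[OF C(1)])
    fix m r \<beta> x assume H: "m > 0" "\<beta> = real r / real m" "\<beta> \<in> {b1..b2}" "x \<in> K"
    have r: "0 < r" "r < m" using ratio_in_interval[OF b12 H(1-3)] by auto
    have xs: "x \<in> slit_plane" using H K by auto
    let ?R = "truncation_error m r N x * of_real (sqrt (2 * real m * pi)) / weight m \<beta> x"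
    have "norm ?R = norm (truncation_error m r N x) * sqrt (2 * real m * pi) / norm (weight m \<beta> x)"
      by (simp add: norm_mult norm_divide)
    also have "\<dots> \<le> norm (weight m \<beta> x) * (C / real m ^ N) / norm (weight m \<beta> x)"
      by (intro divide_right_mono C(2)[OF H]) auto
    finally have "norm ?R \<le> C / real m ^ N" by simp
    moreover have "F m r x = approx m \<beta> x ((\<Sum>k<N. expansion_coeff k \<beta> x / of_nat m ^ k) + ?R)"
      using F_eq_approx[OF r H(2) xs, of N] by (simp add: truncation_def H(2))
    ultimately show "\<exists>R. norm R \<le> C / real m ^ N \<and>
         F m r x = approx m \<beta> x ((\<Sum>k<N. expansion_coeff k \<beta> x / of_nat m ^ k) + R)" by blast
  qed
qed

section \<open>The relative error at a fixed point\<close>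

text \<open>
  Dividing the bracket of the approximation by the coefficient of \<open>c\<close> turns it into \<open>scaled_erfc + c\<close>,
  so an absolute lower bound for this sum turns the additive remainder into a relative one.
\<close>

definition scaled_erfc :: "nat \<Rightarrow> real \<Rightarrow> complex \<Rightarrow> complex" where
  "scaled_erfc m \<beta> x = of_real (sqrt (2 * real m * pi))
     * (erfc (of_real (sqrt (real m)) * rho \<beta> x) / 2) / weight m \<beta> x"

lemma approx_eq_scaled:
  assumes "0 < \<beta>" "\<beta> < 1" "x \<in> slit_plane" "m > 0"
  shows "approx m \<beta> x c = (1 + x) ^ m * weight m \<beta> x / of_real (sqrt (2 * real m * pi))
    * (scaled_erfc m \<beta> x + c)"
proof -
  have "complex_of_real (sqrt (2 * real m * pi)) \<noteq> 0" using assms by simp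
  then show ?thesis
    unfolding approx_eq[OF assms(1-3)] scaled_erfc_def by (simp add: field_simps)
qed

lemma relative_error:
  assumes "0 < \<beta>" "\<beta> < 1" "x \<in> slit_plane" "m > 0"
    and F: "F m r x = approx m \<beta> x (c + R)"
    and c: "scaled_erfc m \<beta> x + c \<noteq> 0" and R: "norm R \<le> \<epsilon> * norm (scaled_erfc m \<beta> x + c)"
  shows "\<exists>\<eta>. norm \<eta> \<le> \<epsilon> \<and> F m r x = approx m \<beta> x c * (1 + \<eta>)"
proof (intro exI conjI)
  let ?\<eta> = "R / (scaled_erfc m \<beta> x + c)"
  show "norm ?\<eta> \<le> \<epsilon>" using c R by (simp add: norm_divide divide_le_eq)
  show "F m r x = approx m \<beta> x c * (1 + ?\<eta>)"
  proof -
    have "(scaled_erfc m \<beta> x + c) * (1 + ?\<eta>) = scaled_erfc m \<beta> x + (c + R)"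
      using c by (simp add: distrib_left)
    then show ?thesis unfolding F approx_eq_scaled[OF assms(1-4)] by (simp only: mult.assoc)
  qed
qed

text \<open>
  On the vertical segment from the real axis to \<open>z + t\<close> the derivative has modulus at most
  \<open>2 * exp (y\<^sup>2 - (x + t)\<^sup>2)\<close>.
\<close>

lemma erfc_tendsto_0: "((\<lambda>t. erfc (z + of_real t)) \<longlongrightarrow> 0) at_top"
proof -
  define x y where "x = Re z" and "y = Im z"
  have bound: "norm (erfc (z + of_real t)) \<le> exp (- (x + t)\<^sup>2) + 2 * exp (y\<^sup>2) * \<bar>y\<bar> * exp (- (x + t)\<^sup>2)"
    if "x + t \<ge> 0" for t
  proof -
    define u where "u = x + t"
    have zt: "z + of_real t = of_real u + \<i> * of_real y" by (simp add: complex_eq_iff x_def y_def u_def)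
    let ?S = "closed_segment (complex_of_real u) (of_real u + \<i> * of_real y)"
    have "norm (erfc (of_real u + \<i> * of_real y) - erfc (of_real u))
        \<le> 2 * exp (y\<^sup>2) * exp (- u\<^sup>2) * norm (of_real u + \<i> * of_real y - of_real u)"
    proof (rule field_differentiable_bound[OF convex_closed_segment[of "of_real u" "of_real u + \<i> * of_real y"]])
      fix w assume "w \<in> ?S"
      then obtain c where c: "0 \<le> c" "c \<le> 1" "w = (1 - c) *\<^sub>R of_real u + c *\<^sub>R (of_real u + \<i> * of_real y)"
        by (auto simp: closed_segment_def)
      show "(erfc has_field_derivative - 2 / of_real (sqrt pi) * exp (- w\<^sup>2)) (at w within ?S)"
        by (rule has_field_derivative_at_within[OF has_field_derivative_erfc])
      have "Re (- w\<^sup>2) = (c * y)\<^sup>2 - u\<^sup>2" by (simp add: c power2_eq_square algebra_simps)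
      also have "\<dots> \<le> y\<^sup>2 - u\<^sup>2"
        using c by (simp add: power_mult_distrib mult_left_le_one_le power_le_one)
      finally have "exp (Re (- w\<^sup>2)) \<le> exp (y\<^sup>2) * exp (- u\<^sup>2)" by (simp flip: exp_add)
      moreover have "2 / sqrt pi \<le> 2" using pi_ge_two by (simp add: divide_le_eq)
      ultimately have "2 / sqrt pi * exp (Re (- w\<^sup>2)) \<le> 2 * (exp (y\<^sup>2) * exp (- u\<^sup>2))"
        by (intro mult_mono) auto
      then show "norm (- 2 / of_real (sqrt pi) * exp (- w\<^sup>2)) \<le> 2 * exp (y\<^sup>2) * exp (- u\<^sup>2)"
        by (simp add: norm_mult norm_divide)
    qed auto
    moreover have "norm (erfc (of_real u)) \<le> exp (- u\<^sup>2)"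
      using erfc_real_nonneg[of u] erfc_real_le_exp[of u] that[folded u_def] by (simp add: erfc_of_real)
    ultimately have "norm (erfc (of_real u + \<i> * of_real y)) \<le> exp (- u\<^sup>2) + 2 * exp (y\<^sup>2) * \<bar>y\<bar> * exp (- u\<^sup>2)"
      using norm_triangle_ineq2[of "erfc (of_real u + \<i> * of_real y)" "erfc (of_real u)"]
      by (simp add: norm_mult mult_ac)
    then show ?thesis unfolding zt[symmetric] u_def[symmetric] .
  qed
  show ?thesis
  proof (rule Lim_null_comparison)
    show "eventually (\<lambda>t. norm (erfc (z + of_real t))
        \<le> exp (- (x + t)\<^sup>2) + 2 * exp (y\<^sup>2) * \<bar>y\<bar> * exp (- (x + t)\<^sup>2)) at_top"
      using eventually_ge_at_top[of "- x"] by eventually_elim (rule bound, simp)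
    show "((\<lambda>t. exp (- (x + t)\<^sup>2) + 2 * exp (y\<^sup>2) * \<bar>y\<bar> * exp (- (x + t)\<^sup>2)) \<longlongrightarrow> 0) at_top"
      by real_asymp
  qed
qed

text \<open>
  On a horizontal ray to the right the modulus of the exponential decreases like a Gaussian, so
  the remainder can be estimated by integrating its derivative from infinity.
\<close>

lemma erfc_asymptotics:
  assumes z: "Re z \<ge> 0" "z \<noteq> 0"
  shows "norm (erfc z - exp (- z\<^sup>2) / (of_real (sqrt pi) * z)) \<le> 2 * norm (exp (- z\<^sup>2)) / (norm z)\<^sup>2"
proof -
  define p where "p = complex_of_real (sqrt pi)"
  have p: "p \<noteq> 0" by (simp add: p_def)
  define V where "V w = erfc w - exp (- w\<^sup>2) / (p * w)" for w
  have V': "(V has_field_derivative exp (- w\<^sup>2) / (p * w\<^sup>2)) (at w)" if "w \<noteq> 0" for w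
  proof -
    have "(V has_field_derivative - 2 / p * exp (- w\<^sup>2) -
        ((exp (- w\<^sup>2) * (- (2 * w))) * (p * w) - exp (- w\<^sup>2) * p) / ((p * w) * (p * w))) (at w)"
      unfolding V_def using that p
      by (auto intro!: derivative_eq_intros has_field_derivative_erfc simp: p_def)
    also have "- 2 / p * exp (- w\<^sup>2) -
        ((exp (- w\<^sup>2) * (- (2 * w))) * (p * w) - exp (- w\<^sup>2) * p) / ((p * w) * (p * w)) = exp (- w\<^sup>2) / (p * w\<^sup>2)"
      using that p by (simp add: divide_simps power2_eq_square)
    finally show ?thesis .
  qed
  define c where "c = norm (exp (- z\<^sup>2)) / (norm z)\<^sup>2"
  have shift: "norm z \<le> norm (z + of_real t)" if "t \<ge> 0" for t
  proof -
    have "(norm z)\<^sup>2 \<le> (norm (z + of_real t))\<^sup>2"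
      unfolding cmod_power2 using z that by (auto intro!: power_mono)
    then show ?thesis by (rule power2_le_imp_le) simp
  qed
  have incr: "norm (V (z + of_real T) - V (z + of_real 0)) \<le> c * arctan T - c * arctan 0" if "T > 0" for T
  proof (rule differentiable_bound_general[OF that])
    show "continuous_on {0..T} (\<lambda>t. c * arctan t)" by (intro continuous_intros)
    have ne: "z + of_real t \<noteq> 0" if "t \<ge> 0" for t using shift[OF that] z by auto
    have der: "((\<lambda>t. V (z + of_real t)) has_vector_derivative
        exp (- (z + of_real t)\<^sup>2) / (p * (z + of_real t)\<^sup>2)) (at t)" if "t \<ge> 0" for t
    proof -
      have "((\<lambda>w. V (z + w)) has_field_derivative exp (- (z + of_real t)\<^sup>2) / (p * (z + of_real t)\<^sup>2)) (at (of_real t))"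
        using DERIV_shift[of V _ "of_real t" z] V'[OF ne[OF that]] by (simp add: add.commute)
      then show ?thesis by (rule has_vector_derivative_real_field)
    qed
    show "continuous_on {0..T} (\<lambda>t. V (z + of_real t))"
      by (intro continuous_at_imp_continuous_on ballI has_vector_derivative_continuous[OF der]) auto
    show "((\<lambda>t. V (z + of_real t)) has_vector_derivative
        exp (- (z + of_real t)\<^sup>2) / (p * (z + of_real t)\<^sup>2)) (at t)" if "0 < t" "t < T" for t
      using der that by simp
    show "((\<lambda>t. c * arctan t) has_vector_derivative c * inverse (1 + t\<^sup>2)) (at t)" for t
      by (auto simp: has_real_derivative_iff_has_vector_derivative[symmetric] intro!: derivative_eq_intros)
    show "norm (exp (- (z + of_real t)\<^sup>2) / (p * (z + of_real t)\<^sup>2)) \<le> c * inverse (1 + t\<^sup>2)"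
      if "0 < t" "t < T" for t
    proof -
      have "Re (- (z + of_real t)\<^sup>2) = Re (- z\<^sup>2) - 2 * t * Re z - t\<^sup>2"
        by (simp add: power2_eq_square algebra_simps)
      also have "\<dots> \<le> Re (- z\<^sup>2) - t\<^sup>2" using that z by simp
      finally have "norm (exp (- (z + of_real t)\<^sup>2)) \<le> norm (exp (- z\<^sup>2)) * exp (- t\<^sup>2)"
        by (simp flip: exp_add)
      also have "exp (- t\<^sup>2) \<le> inverse (1 + t\<^sup>2)"
      proof -
        have "1 + t\<^sup>2 \<le> exp (t\<^sup>2)" by (rule exp_ge_add_one_self)
        then show ?thesis by (simp add: exp_minus add_pos_nonneg le_imp_inverse_le)
      qed
      finally have num: "norm (exp (- (z + of_real t)\<^sup>2)) \<le> norm (exp (- z\<^sup>2)) * inverse (1 + t\<^sup>2)"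
        by (simp add: mult_left_mono)
      have "1 * (norm z)\<^sup>2 \<le> norm p * (norm (z + of_real t))\<^sup>2"
        using shift[of t] that pi_ge_two by (intro mult_mono power_mono) (auto simp: p_def)
      then have "norm (exp (- (z + of_real t)\<^sup>2)) / (norm p * (norm (z + of_real t))\<^sup>2)
          \<le> (norm (exp (- z\<^sup>2)) * inverse (1 + t\<^sup>2)) / (norm z)\<^sup>2"
        using num z by (intro frac_le) auto
      then show ?thesis by (simp add: norm_divide norm_mult norm_power c_def)
    qed
  qed
  have c0: "c \<ge> 0" by (simp add: c_def)
  have bound: "norm (V (z + of_real T) - V z) \<le> 2 * c" if "T > 0" for T
  proof -
    have "c * arctan T \<le> c * 2" using c0 arctan_ubound[of T] pi_less_4 by (intro mult_left_mono) auto
    then show ?thesis using incr[OF that] by simp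
  qed
  have lim: "((\<lambda>T. V (z + of_real T)) \<longlongrightarrow> 0) at_top"
  proof -
    have "((\<lambda>T. exp (- (z + of_real T)\<^sup>2) / (p * (z + of_real T))) \<longlongrightarrow> 0) at_top"
    proof (rule Lim_null_comparison)
      show "eventually (\<lambda>T. norm (exp (- (z + of_real T)\<^sup>2) / (p * (z + of_real T)))
          \<le> norm (exp (- z\<^sup>2)) * exp (- T\<^sup>2) / (norm p * norm z)) at_top"
        using eventually_ge_at_top[of 0]
      proof eventually_elim
        fix T :: real assume T: "T \<ge> 0"
        have "Re (- (z + of_real T)\<^sup>2) = Re (- z\<^sup>2) - 2 * T * Re z - T\<^sup>2"
          by (simp add: power2_eq_square algebra_simps)
        also have "\<dots> \<le> Re (- z\<^sup>2) - T\<^sup>2" using T z by simp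
        finally have "norm (exp (- (z + of_real T)\<^sup>2)) \<le> norm (exp (- z\<^sup>2)) * exp (- T\<^sup>2)"
          by (simp flip: exp_add)
        moreover have "norm p * norm z \<le> norm p * norm (z + of_real T)"
          using shift[OF T] by (intro mult_left_mono) auto
        ultimately show "norm (exp (- (z + of_real T)\<^sup>2) / (p * (z + of_real T)))
          \<le> norm (exp (- z\<^sup>2)) * exp (- T\<^sup>2) / (norm p * norm z)"
          unfolding norm_divide norm_mult using z p by (intro frac_le) auto
      qed
      show "((\<lambda>T. norm (exp (- z\<^sup>2)) * exp (- T\<^sup>2) / (norm p * norm z)) \<longlongrightarrow> 0) at_top"
        by (intro tendsto_divide_zero tendsto_mult_right_zero) real_asymp
    qed
    then show ?thesis unfolding V_def using tendsto_diff[OF erfc_tendsto_0[of z]] by fastforce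
  qed
  have "norm (0 - V z) \<le> 2 * c"
    by (rule tendsto_upperbound[OF tendsto_norm[OF tendsto_diff[OF lim tendsto_const]]])
      (use bound in \<open>auto intro: eventually_mono[OF eventually_gt_at_top[of 0]]\<close>)
  then have "norm (V z) \<le> 2 * c" by simp
  then show ?thesis by (simp add: V_def p_def c_def)
qed

text \<open>
  The second case is the first one for \<open>- \<rho>\<close>, by the reflection formula \<open>erfc (- z) = 2 - erfc z\<close>;
  the constant \<open>2\<close> becomes the additional term.
\<close>

lemma scaled_erfc_asymptotics:
  assumes b: "0 < \<beta>" "\<beta> < 1" and x: "x \<in> slit_plane" and m: "m > 0" and rho: "rho \<beta> x \<noteq> 0"
  defines "q \<equiv> sqrt (2 * real m * pi)"
  shows "Re (rho \<beta> x) \<ge> 0 \<Longrightarrow>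
      norm (scaled_erfc m \<beta> x - 1 / (of_real (sqrt 2) * rho \<beta> x)) \<le> q / (real m * (norm (rho \<beta> x))\<^sup>2)"
    and "Re (rho \<beta> x) < 0 \<Longrightarrow>
      norm (scaled_erfc m \<beta> x - of_real q / weight m \<beta> x - 1 / (of_real (sqrt 2) * rho \<beta> x))
        \<le> q / (real m * (norm (rho \<beta> x))\<^sup>2)"
proof -
  define \<mu> where "\<mu> = complex_of_real (sqrt (real m))"
  define \<psi> where "\<psi> = weight m \<beta> x"
  define \<zeta> where "\<zeta> = \<mu> * rho \<beta> x"
  have \<mu>: "\<mu> \<noteq> 0" "\<mu> * \<mu> = of_nat m" using m by (auto simp: \<mu>_def simp flip: of_real_mult)
  have q: "q > 0" using m by (simp add: q_def)
  have w: "exp (- \<zeta>\<^sup>2) = \<psi>"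
    unfolding weight_def \<psi>_def \<zeta>_def power_mult_distrib rho_square[OF b x] power2_eq_square[of \<mu>] \<mu>(2) by simp
  have lead: "of_real q / 2 * (\<psi> / (of_real (sqrt pi) * \<zeta>)) / \<psi> = 1 / (of_real (sqrt 2) * rho \<beta> x)"
  proof -
    have "complex_of_real q = of_real (sqrt 2) * \<mu> * of_real (sqrt pi)"
      by (simp add: q_def \<mu>_def real_sqrt_mult)
    moreover have "complex_of_real (sqrt 2) * of_real (sqrt 2) = 2" by (simp flip: of_real_mult)
    ultimately show ?thesis using rho \<mu> by (simp add: \<psi>_def \<zeta>_def field_simps)
  qed
  have n\<zeta>: "(norm \<zeta>)\<^sup>2 = real m * (norm (rho \<beta> x))\<^sup>2"
    by (simp add: \<zeta>_def norm_mult power_mult_distrib \<mu>_def)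
  have asym: "norm (of_real q / 2 * erfc z / \<psi> - of_real q / 2 * (\<psi> / (of_real (sqrt pi) * z)) / \<psi>)
      \<le> q / (real m * (norm (rho \<beta> x))\<^sup>2)"
    if "Re z \<ge> 0" "z = \<zeta> \<or> z = - \<zeta>" for z
  proof -
    have z: "z \<noteq> 0" "z\<^sup>2 = \<zeta>\<^sup>2" "norm z = norm \<zeta>" using that rho \<mu> by (auto simp: \<zeta>_def)
    have "of_real q / 2 * erfc z / \<psi> - of_real q / 2 * (\<psi> / (of_real (sqrt pi) * z)) / \<psi>
        = of_real (q / 2) / \<psi> * (erfc z - \<psi> / (of_real (sqrt pi) * z))"
      by (simp add: algebra_simps diff_divide_distrib)
    then have "norm (of_real q / 2 * erfc z / \<psi> - of_real q / 2 * (\<psi> / (of_real (sqrt pi) * z)) / \<psi>)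
        = q / 2 / norm \<psi> * norm (erfc z - exp (- z\<^sup>2) / (of_real (sqrt pi) * z))"
      using q by (simp add: norm_mult norm_divide z w)
    also have "\<dots> \<le> q / 2 / norm \<psi> * (2 * norm (exp (- z\<^sup>2)) / (norm z)\<^sup>2)"
      using q z that by (intro mult_left_mono erfc_asymptotics) auto
    also have "\<dots> = q / (real m * (norm (rho \<beta> x))\<^sup>2)"
      unfolding z w n\<zeta> by (simp add: \<psi>_def)
    finally show ?thesis .
  qed
  have s: "scaled_erfc m \<beta> x = of_real q / 2 * erfc \<zeta> / \<psi>"
    by (simp add: scaled_erfc_def q_def \<psi>_def \<zeta>_def \<mu>_def)
  show "norm (scaled_erfc m \<beta> x - 1 / (of_real (sqrt 2) * rho \<beta> x)) \<le> q / (real m * (norm (rho \<beta> x))\<^sup>2)"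
    if "Re (rho \<beta> x) \<ge> 0"
    using asym[of \<zeta>] that unfolding lead s by (simp add: \<zeta>_def \<mu>_def)
  show "norm (scaled_erfc m \<beta> x - of_real q / weight m \<beta> x - 1 / (of_real (sqrt 2) * rho \<beta> x))
        \<le> q / (real m * (norm (rho \<beta> x))\<^sup>2)" if "Re (rho \<beta> x) < 0"
  proof -
    have "Re (- \<zeta>) \<ge> 0" using that by (simp add: \<zeta>_def \<mu>_def mult_nonneg_nonpos)
    note a = asym[OF this]
    have "scaled_erfc m \<beta> x - of_real q / \<psi> - 1 / (of_real (sqrt 2) * rho \<beta> x)
        = - (of_real q / 2 * erfc (- \<zeta>) / \<psi> - of_real q / 2 * (\<psi> / (of_real (sqrt pi) * - \<zeta>)) / \<psi>)"
      unfolding s lead[symmetric] erfc_minus by (simp add: algebra_simps diff_divide_distrib)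
    then show ?thesis using a unfolding \<psi>_def[symmetric] by (simp only: norm_minus_cancel simp_thms)
  qed
qed

text \<open>
  Off the saddle point the terms \<open>1 / (sqrt 2 * \<rho>)\<close> cancel, and what remains is a nonzero number,
  plus, for \<open>Re \<rho> < 0\<close>, a term of modulus \<open>sqrt (2 * pi * m) * exp (m * Re (radicand \<beta> x))\<close>. For fixed
  \<open>x\<close> the latter tends to \<open>0\<close> or to infinity, so the two never cancel for large \<open>m\<close>. At the saddle
  point the error function contributes \<open>sqrt (2 * pi * m) / 2\<close>.
\<close>

lemma scaled_approx_lower_bound:
  assumes b: "0 < \<beta>" "\<beta> < 1" and x: "x \<in> slit_plane"
  obtains l where "l > 0" "eventually (\<lambda>m. l \<le> norm (scaled_erfc m \<beta> x + A \<beta> x)) sequentially"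
proof (cases "x = of_real (saddle \<beta>)")
  case True
  have rho: "rho \<beta> x = 0" using rho_eq_0_iff[OF b x] True by simp
  have "erfc 0 = 1" using erfc_of_real[of 0] erfc_real_0 by simp
  then have s: "scaled_erfc m \<beta> x = of_real (sqrt (2 * real m * pi) / 2)" for m
    using rho_square[OF b x] by (simp add: scaled_erfc_def weight_def rho)
  have "eventually (\<lambda>m. 1 + norm (A \<beta> x) \<le> sqrt (2 * real m * pi) / 2) sequentially"
    by real_asymp
  then have "eventually (\<lambda>m. 1 \<le> norm (scaled_erfc m \<beta> x + A \<beta> x)) sequentially"
  proof eventually_elim
    case (elim m)
    have "norm (scaled_erfc m \<beta> x) = sqrt (2 * real m * pi) / 2" unfolding s by simp
    then show ?case using elim norm_diff_ineq[of "scaled_erfc m \<beta> x" "A \<beta> x"] by linarith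
  qed
  then show ?thesis using that[of 1] by simp
next
  case False
  note nz = slit_plane_nonzero[OF x]
  define \<rho> where "\<rho> = rho \<beta> x"
  have rho: "\<rho> \<noteq> 0" using rho_eq_0_iff[OF b x] False by (simp add: \<rho>_def)
  define B where "B = 1 / (of_real (sqrt (\<beta> * (1 - \<beta>))) * (1 - of_real \<beta> / (x * of_real (1 - \<beta>))))"
  have "1 - of_real \<beta> / (x * of_real (1 - \<beta>)) \<noteq> 0"
  proof
    assume "1 - of_real \<beta> / (x * of_real (1 - \<beta>)) = 0"
    then have "x * of_real (1 - \<beta>) = of_real \<beta>" using nz b by (simp add: field_simps)
    then have "x = of_real \<beta> / of_real (1 - \<beta>)" using b by (simp add: field_simps)
    then show False using False by (simp add: saddle_def)
  qed
  then have B: "B \<noteq> 0" using b by (simp add: B_def)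
  have A: "A \<beta> x = B - 1 / (of_real (sqrt 2) * \<rho>)"
    using False by (simp add: A_def A_formula_def B_def \<rho>_def)
  define e where "e m = sqrt (2 * real m * pi) / (real m * (norm \<rho>)\<^sup>2)" for m
  have e: "e \<longlonglongrightarrow> 0" unfolding e_def using rho by real_asymp
  have small: "eventually (\<lambda>m. e m < norm B / 4) sequentially"
    using order_tendstoD(2)[OF e, of "norm B / 4"] B by simp
  note asym = scaled_erfc_asymptotics[OF b x _ rho[unfolded \<rho>_def], folded \<rho>_def]
  have "eventually (\<lambda>m. min 1 (norm B / 2) \<le> norm (scaled_erfc m \<beta> x + A \<beta> x)) sequentially"
  proof (cases "Re \<rho> \<ge> 0")
    case True
    show ?thesis using small eventually_gt_at_top[of 0]
    proof eventually_elim
      case (elim m)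
      have "norm ((scaled_erfc m \<beta> x + A \<beta> x) - B) \<le> e m"
        using asym(1)[OF elim(2) True] by (simp add: A e_def)
      then have "norm (B - (scaled_erfc m \<beta> x + A \<beta> x)) \<le> e m" by (simp only: norm_minus_commute)
      then show ?case using elim(1) norm_triangle_ineq2[of B "scaled_erfc m \<beta> x + A \<beta> x"]
        norm_ge_zero[of B] by linarith
    qed
  next
    case neg: False
    have close: "norm ((scaled_erfc m \<beta> x + A \<beta> x) - B - of_real (sqrt (2 * real m * pi)) / weight m \<beta> x) \<le> e m"
      if "m > 0" for m
      using asym(2)[OF that] neg by (simp add: A e_def algebra_simps)
    have size: "norm (of_real (sqrt (2 * real m * pi)) / weight m \<beta> x)
        = sqrt (2 * real m * pi) * exp (real m * Re (radicand \<beta> x))" for m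
      by (simp add: norm_divide norm_weight exp_minus field_simps)
    show ?thesis
    proof (cases "Re (radicand \<beta> x) < 0")
      case True
      define k where "k = - Re (radicand \<beta> x)"
      have k: "k > 0" using True by (simp add: k_def)
      have "(\<lambda>m. sqrt (2 * real m * pi) * exp (- (real m * k))) \<longlonglongrightarrow> 0" using k by real_asymp
      then have "eventually (\<lambda>m. sqrt (2 * real m * pi) * exp (- (real m * k)) < norm B / 4) sequentially"
        using B by (intro order_tendstoD(2)) auto
      then show ?thesis using small eventually_gt_at_top[of 0]
      proof eventually_elim
        case (elim m)
        let ?Z = "scaled_erfc m \<beta> x + A \<beta> x" and ?w = "of_real (sqrt (2 * real m * pi)) / weight m \<beta> x"
        have "norm ?w < norm B / 4" using elim(1) unfolding size by (simp add: k_def)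
        moreover have "norm B \<le> norm ?Z + norm ?w + norm (?Z - B - ?w)"
        proof -
          have "norm B \<le> norm (?Z - ?w) + norm (?Z - B - ?w)"
            using norm_triangle_ineq4[of "?Z - ?w" "?Z - B - ?w"] by simp
          then show ?thesis using norm_triangle_ineq4[of ?Z ?w] by linarith
        qed
        ultimately show ?case using close[OF elim(3)] elim(2) by linarith
      qed
    next
      case nonneg: False
      have "eventually (\<lambda>m. 1 + 2 * norm B \<le> sqrt (2 * real m * pi)) sequentially" by real_asymp
      then show ?thesis using small eventually_gt_at_top[of 0]
      proof eventually_elim
        case (elim m)
        let ?Z = "scaled_erfc m \<beta> x + A \<beta> x" and ?w = "of_real (sqrt (2 * real m * pi)) / weight m \<beta> x"
        have "sqrt (2 * real m * pi) * 1 \<le> norm ?w"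
          unfolding size using nonneg by (intro mult_left_mono) auto
        moreover have "norm ?w \<le> norm ?Z + norm B + norm (?Z - B - ?w)"
        proof -
          have "norm ?w \<le> norm (?Z - B) + norm (?Z - B - ?w)"
            using norm_triangle_ineq4[of "?Z - B" "?Z - B - ?w"] by simp
          then show ?thesis using norm_triangle_ineq4[of ?Z B] by linarith
        qed
        ultimately show ?case using close[OF elim(3)] elim(1,2) norm_ge_zero[of B] by linarith
      qed
    qed
  qed
  then show ?thesis using that[of "min 1 (norm B / 2)"] B by simp
qed

lemma pointwise_asymptotics:
  assumes b: "0 < \<beta>" "\<beta> < 1" and x: "x \<in> slit_plane" and \<epsilon>: "0 < \<epsilon>"
  shows "\<exists>M. \<forall>m\<ge>M. \<forall>r. m > 0 \<and> \<beta> = real r / real m \<longrightarrow>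
           (\<exists>\<eta>. norm \<eta> \<le> \<epsilon> \<and> F m r x = approx m \<beta> x (A \<beta> x) * (1 + \<eta>))"
proof -
  have "compact {x}" "{x} \<subseteq> slit_plane" using x by auto
  then obtain C where C: "C \<ge> 0"
    "\<And>m r \<beta>' y. m > 0 \<Longrightarrow> \<beta>' = real r / real m \<Longrightarrow> \<beta>' \<in> {\<beta>..\<beta>} \<Longrightarrow> y \<in> {x} \<Longrightarrow>
       \<exists>R. norm R \<le> C / real m ^ 1 \<and>
         F m r y = approx m \<beta>' y ((\<Sum>k<1. expansion_coeff k \<beta>' y / of_nat m ^ k) + R)"
    by (rule uniform_expansion[OF b, of "{x}" 1]) blast
  obtain l where l: "l > 0" "eventually (\<lambda>m. l \<le> norm (scaled_erfc m \<beta> x + A \<beta> x)) sequentially"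
    using scaled_approx_lower_bound[OF b x] by metis
  have "(\<lambda>m. C / real m) \<longlonglongrightarrow> 0" by real_asymp
  then have "eventually (\<lambda>m. C / real m < \<epsilon> * l) sequentially"
    using \<epsilon> l by (intro order_tendstoD(2)) auto
  from eventually_conj[OF l(2) this] obtain M where M:
    "\<And>m. m \<ge> M \<Longrightarrow> l \<le> norm (scaled_erfc m \<beta> x + A \<beta> x) \<and> C / real m < \<epsilon> * l"
    unfolding eventually_sequentially by blast
  show ?thesis
  proof (rule exI[of _ M], intro allI impI)
    fix m r assume m: "M \<le> m" and r: "m > 0 \<and> \<beta> = real r / real m"
    then obtain R where R: "norm R \<le> C / real m" "F m r x = approx m \<beta> x (A \<beta> x + R)"
      using C(2)[of m \<beta> r x] expansion_coeff_0[OF b x] by auto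
    have "\<epsilon> * l \<le> \<epsilon> * norm (scaled_erfc m \<beta> x + A \<beta> x)"
      using M[OF m] \<epsilon> by (intro mult_left_mono) auto
    then show "\<exists>\<eta>. norm \<eta> \<le> \<epsilon> \<and> F m r x = approx m \<beta> x (A \<beta> x) * (1 + \<eta>)"
      using M[OF m] R l r by (intro relative_error[OF b x _ R(2)]) auto
  qed
qed

section \<open>The relative error away from the zeros\<close>

text \<open>
  If \<open>G\<close> is small at the centre, then the equation \<open>G' = p * G - g\<close> makes \<open>G\<close> close to the linear
  function with slope \<open>- g x\<close>, whose modulus on the circle exceeds the modulus at the centre; the
  minimum modulus principle forbids this for a function without zeros.
\<close>

lemma nonvanishing_solution_lower_bound:
  fixes G p g :: "complex \<Rightarrow> complex"
  assumes d: "d > 0"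
    and der: "\<And>y. y \<in> cball x d \<Longrightarrow> (G has_field_derivative (p y * G y - g y)) (at y)"
    and nz: "\<And>y. y \<in> cball x d \<Longrightarrow> G y \<noteq> 0"
    and P: "\<And>y. y \<in> cball x d \<Longrightarrow> norm (p y) \<le> P"
    and Q: "\<And>y. y \<in> cball x d \<Longrightarrow> norm (g y) \<le> Q"
    and e: "\<And>y. y \<in> cball x d \<Longrightarrow> norm (g y - g x) \<le> e"
    and dP: "2 * d * P \<le> 1"
  shows "d * (norm (g x) - 2 * d * P * Q - e) \<le> 3 * norm (G x)"
proof -
  define \<mu> where "\<mu> = norm (G x)"
  have x: "x \<in> cball x d" using d by simp
  have P0: "P \<ge> 0" "Q \<ge> 0" using P[OF x] Q[OF x] norm_ge_zero order_trans by blast+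
  have cont: "continuous_on (cball x d) G"
    by (intro continuous_at_imp_continuous_on ballI DERIV_isCont[OF der])
  have "\<exists>y0\<in>cball x d. \<forall>y\<in>cball x d. norm (G y) \<le> norm (G y0)"
    using d by (intro continuous_attains_sup compact_cball continuous_on_norm cont) auto
  then obtain y0 where y0: "y0 \<in> cball x d" "\<And>y. y \<in> cball x d \<Longrightarrow> norm (G y) \<le> norm (G y0)"
    by blast
  define M where "M = norm (G y0)"
  have pG: "norm (p y * G y) \<le> P * M" if "y \<in> cball x d" for y
    unfolding norm_mult M_def using P[OF that] y0(2)[OF that] P0 by (intro mult_mono) auto
  have M: "M \<le> 2 * (\<mu> + d * Q)"
  proof -
    have "norm (G y0 - G x) \<le> (P * M + Q) * norm (y0 - x)"
    proof (rule field_differentiable_bound[OF convex_cball[of x d]])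
      show "norm (p y * G y - g y) \<le> P * M + Q" if "y \<in> cball x d" for y
        by (intro order_trans[OF norm_triangle_ineq4] add_mono pG Q that)
      show "(G has_field_derivative (p y * G y - g y)) (at y within cball x d)" if "y \<in> cball x d" for y
        by (rule has_field_derivative_at_within[OF der[OF that]])
    qed (use x y0 in auto)
    also have "\<dots> \<le> (P * M + Q) * d"
      using y0(1) P0 by (intro mult_left_mono) (auto simp: dist_norm norm_minus_commute M_def)
    finally have "M \<le> \<mu> + (P * M + Q) * d"
      using norm_triangle_ineq2[of "G y0" "G x"] by (simp add: M_def \<mu>_def)
    moreover have "2 * d * P * M \<le> 1 * M" using dP by (intro mult_right_mono) (auto simp: M_def)
    ultimately show ?thesis by (simp add: algebra_simps)
  qed
  have lin: "norm (G y - G x + g x * (y - x)) \<le> (P * M + e) * d" if "y \<in> cball x d" for y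
  proof -
    define H where "H y = G y + g x * (y - x)" for y
    have "norm (H y - H x) \<le> (P * M + e) * norm (y - x)"
    proof (rule field_differentiable_bound[OF convex_cball[of x d]])
      fix w assume w: "w \<in> cball x d"
      have "(H has_field_derivative (p w * G w - g w + g x)) (at w)"
        unfolding H_def by (auto intro!: derivative_eq_intros der[OF w])
      then show "(H has_field_derivative (p w * G w - g w + g x)) (at w within cball x d)"
        by (rule has_field_derivative_at_within)
      have "norm (p w * G w - (g w - g x)) \<le> P * M + e"
        by (intro order_trans[OF norm_triangle_ineq4] add_mono pG e w)
      then show "norm (p w * G w - g w + g x) \<le> P * M + e" by (simp add: algebra_simps)
    qed (use that x in auto)
    also have "\<dots> \<le> (P * M + e) * d"
      using that P0 e[OF x] by (intro mult_left_mono) (auto simp: dist_norm norm_minus_commute M_def)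
    finally show ?thesis by (simp add: H_def algebra_simps)
  qed
  \<comment> \<open>A lower bound for \<open>G\<close> on the circle: the linear part minus twice the value at the centre.\<close>
  define l where "l = d * (norm (g x) - 2 * d * P * Q - e) - 2 * \<mu>"
  have circle: "norm (G y) \<ge> l" if y: "dist x y = d" for y
  proof -
    have "d * norm (g x) = norm (g x * (y - x))"
      using y by (simp add: norm_mult dist_norm norm_minus_commute)
    also have "\<dots> \<le> norm (G y - G x + g x * (y - x)) + norm (G y - G x)"
      using norm_triangle_ineq4[of "G y - G x + g x * (y - x)" "G y - G x"] by simp
    also have "\<dots> \<le> (P * M + e) * d + (norm (G y) + \<mu>)"
      unfolding \<mu>_def using lin[of y] y by (intro add_mono norm_triangle_ineq4) auto
    finally have 1: "d * norm (g x) \<le> (P * M + e) * d + norm (G y) + \<mu>" by simp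
    have "d * P * M \<le> d * P * (2 * (\<mu> + d * Q))" using M P0 d by (intro mult_left_mono) auto
    moreover have "2 * d * P * \<mu> \<le> 1 * \<mu>" using dP by (intro mult_right_mono) (auto simp: \<mu>_def)
    ultimately show ?thesis using 1 by (simp add: l_def algebra_simps)
  qed
  have "l \<le> \<mu>"
  proof (rule ccontr)
    assume "\<not> l \<le> \<mu>"
    then have l: "\<mu> < l" "l > 0" using norm_ge_zero[of "G x"] unfolding \<mu>_def by linarith+
    have hol: "(\<lambda>y. inverse (G y)) holomorphic_on cball x d"
    proof -
      have "G holomorphic_on cball x d"
        using der has_field_derivative_at_within
        unfolding holomorphic_on_def field_differentiable_def by blast
      then show ?thesis using nz by (intro holomorphic_intros) auto
    qed
    have "norm (inverse (G x)) \<le> inverse l"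
    proof (rule maximum_modulus_frontier[of "\<lambda>y. inverse (G y)" "ball x d"])
      show "(\<lambda>y. inverse (G y)) holomorphic_on interior (ball x d)"
        using hol by (rule holomorphic_on_subset) auto
      show "continuous_on (closure (ball x d)) (\<lambda>y. inverse (G y))"
        using holomorphic_on_imp_continuous_on[OF hol] d by simp
      show "norm (inverse (G z)) \<le> inverse l" if "z \<in> frontier (ball x d)" for z
        using circle[of z] that d l unfolding norm_inverse by (intro le_imp_inverse_le) auto
    qed (use d in auto)
    then have "l \<le> \<mu>" using l nz[OF x] unfolding norm_inverse \<mu>_def by (simp add: inverse_le_iff_le)
    with l show False by simp
  qed
  then show ?thesis by (simp add: l_def \<mu>_def)
qed

text \<open>
  The sum in the scaling of \<open>scaled_erfc + c\<close>, with the same zeros as \<open>F\<close> in the slit plane.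
\<close>

definition scaled_F :: "nat \<Rightarrow> nat \<Rightarrow> complex \<Rightarrow> complex" where
  "scaled_F m r x = of_real (sqrt (2 * real m * pi)) * (F m r x / (1 + x) ^ m)
     / weight m (real r / real m) x"

lemma has_field_derivative_scaled_F:
  assumes "0 < r" "r < m" "x \<in> slit_plane"
  shows "(scaled_F m r has_field_derivative
    of_nat m * deriv (radicand (real r / real m)) x * scaled_F m r x
      - of_nat m * of_real (binom_factor m r) / (1 + x)) (at x)"
proof -
  define \<beta> where "\<beta> = real r / real m"
  have b: "0 < \<beta>" "\<beta> < 1" using assms by (auto simp: \<beta>_def)
  define q where "q = complex_of_real (sqrt (2 * real m * pi))"
  have q: "q \<noteq> 0" using assms by (simp add: q_def)
  define D where "D = deriv (radicand \<beta>) x"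
  define \<psi> where "\<psi> = weight m \<beta> x"
  define g where "g = complex_of_nat m * of_real (binom_factor m r) / (1 + x)"
  have \<psi>: "(weight m \<beta> has_field_derivative - \<psi> * (of_nat m * D)) (at x)"
    unfolding D_def DERIV_imp_deriv[OF has_field_derivative_radicand[OF b assms(3)]] \<psi>_def
    by (rule has_field_derivative_weight[OF b assms(3)])
  have "((\<lambda>x. q * (F m r x / (1 + x) ^ m) / weight m \<beta> x) has_field_derivative
     ((q * (\<psi> / q * - g)) * \<psi> - (q * (F m r x / (1 + x) ^ m)) * (- \<psi> * (of_nat m * D))) / (\<psi> * \<psi>)) (at x)"
    using DERIV_divide[OF DERIV_cmult[OF has_field_derivative_binomial_cdf[OF assms], of q] \<psi>[unfolded \<beta>_def]]
    by (simp add: \<psi>_def \<beta>_def q_def g_def)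
  also have "((q * (\<psi> / q * - g)) * \<psi> - (q * (F m r x / (1 + x) ^ m)) * (- \<psi> * (of_nat m * D))) / (\<psi> * \<psi>)
      = of_nat m * D * (q * (F m r x / (1 + x) ^ m) / \<psi>) - g"
  proof -
    have "\<psi> \<noteq> 0" by (simp add: \<psi>_def)
    have "((q * (\<psi> / q * - g)) * \<psi> - v * (- \<psi> * u)) / (\<psi> * \<psi>) = u * (v / \<psi>) - g" for u v
      using q \<open>\<psi> \<noteq> 0\<close> by (simp add: field_simps)
    then show ?thesis .
  qed
  finally show ?thesis unfolding scaled_F_def[abs_def] q_def D_def \<psi>_def g_def \<beta>_def .
qed

lemma stirling_error_1:
  assumes "0 < r" "r < m"
  shows "stirling_error m r 1 = of_real (binom_factor m r - sqrt ((1 - real r / real m) / (real r / real m)))"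
  using source_0_saddle[of "real r / real m"] assms by (simp add: stirling_error_def)

lemma stirling_error_uniform:
  assumes "0 < b1" "b2 < 1"
  obtains T where "T \<ge> 0"
    "\<And>m r \<beta>. m > 0 \<Longrightarrow> \<beta> = real r / real m \<Longrightarrow> \<beta> \<in> {b1..b2} \<Longrightarrow>
       norm (stirling_error m r N) \<le> T / real m ^ N"
  by (rule truncation_error_crude[OF assms compact_empty empty_subsetI, of N]; rule that; assumption)

text \<open>
  At distance of order \<open>1 / m\<close> the differential equation of \<^const>\<open>scaled_F\<close> has coefficients and an
  inhomogeneity of order \<open>m\<close>, and the inhomogeneity is also bounded below by a multiple of \<open>m\<close>. On
  discs of radius \<open>\<sigma> / m\<close> the lemma \<open>nonvanishing_solution_lower_bound\<close> therefore gives a bound that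
  does not depend on \<open>m\<close>.
\<close>

lemma scaled_F_lower_bound:
  assumes b12: "0 < b1" "b1 \<le> b2" "b2 < 1" and K: "compact K" "K \<subseteq> slit_plane" and \<delta>: "\<delta> > 0"
  obtains l M where "l > 0"
    "\<And>m r \<beta> x. m \<ge> M \<Longrightarrow> m > 0 \<Longrightarrow> \<beta> = real r / real m \<Longrightarrow> \<beta> \<in> {b1..b2} \<Longrightarrow> x \<in> K \<Longrightarrow>
       (\<And>z. F m r z = 0 \<Longrightarrow> \<delta> / real m \<le> dist x z) \<Longrightarrow> l \<le> norm (scaled_F m r x)"
proof -
  obtain d0 S where d0: "d0 > 0" and S: "compact S" "S \<subseteq> slit_plane" "\<And>x. x \<in> K \<Longrightarrow> cball x d0 \<subseteq> S"
    using compact_neighbourhood_in_slit_plane[OF K] by metis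
  obtain c1 where c1: "c1 > 0"
    "\<And>\<beta> x. \<beta> \<in> {b1..b2} \<Longrightarrow> x \<in> S \<Longrightarrow> norm (deriv (radicand \<beta>) x) \<le> c1"
    using uniform_family_bounded[OF uniform_family_deriv[OF uniform_family_radicand] b12(1,3) S(1,2)] by metis
  have "uniform_family (\<lambda>_ x. 1 / (1 + x))"
    using slit_plane_nonzero by (intro uniform_family_fixed holomorphic_intros) auto
  from uniform_family_bounded[OF this b12(1,3) S(1,2)]
  obtain C1 where "C1 > 0" "\<And>\<beta> x. \<beta> \<in> {b1..b2} \<Longrightarrow> x \<in> S \<Longrightarrow> norm (1 / (1 + x)) \<le> C1"
    by metis
  then have C1: "C1 > 0" "\<And>x. x \<in> S \<Longrightarrow> norm (1 / (1 + x)) \<le> C1" using b12(2) by auto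
  have "uniform_family (\<lambda>_ x. 1 + x)" by (intro uniform_family_fixed holomorphic_intros)
  from uniform_family_bounded[OF this b12(1,3) K]
  obtain B where "B > 0" "\<And>\<beta> x. \<beta> \<in> {b1..b2} \<Longrightarrow> x \<in> K \<Longrightarrow> norm (1 + x) \<le> B"
    by metis
  then have B: "B > 0" "\<And>x. x \<in> K \<Longrightarrow> norm (1 + x) \<le> B" using b12(2) by auto
  obtain T where T: "T \<ge> 0" "\<And>m r \<beta>. m > 0 \<Longrightarrow> \<beta> = real r / real m \<Longrightarrow> \<beta> \<in> {b1..b2} \<Longrightarrow>
       norm (stirling_error m r 1) \<le> T / real m ^ 1"
    using stirling_error_uniform[OF b12(1,3), of 1] by metis
  define gmin where "gmin = sqrt ((1 - b2) / b2) / 2"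
  define gmax where "gmax = sqrt ((1 - b1) / b1) + T"
  have gmin: "gmin > 0" using b12 by (simp add: gmin_def)
  have gmax: "gmax > 0" using b12 T by (simp add: gmax_def add_pos_nonneg)
  define e0 where "e0 = gmin / B"
  have e0: "e0 > 0" using gmin B by (simp add: e0_def)
  define k where "k = 2 * c1 * (gmax * C1) + gmax * C1\<^sup>2"
  have k: "k > 0" using c1 gmax C1 by (simp add: k_def add_pos_pos)
  \<comment> \<open>The last two members keep the quadratic terms below half of the linear one.\<close>
  define \<sigma> where "\<sigma> = Min {\<delta> / 2, d0, 1 / (2 * c1), e0 / (2 * k)}"
  have \<sigma>: "\<sigma> > 0" "\<sigma> \<le> \<delta> / 2" "\<sigma> \<le> d0" "\<sigma> \<le> 1 / (2 * c1)" "\<sigma> \<le> e0 / (2 * k)"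
    using \<delta> d0 c1 e0 k by (auto simp: \<sigma>_def)
  have \<sigma>': "2 * \<sigma> * c1 \<le> 1" "\<sigma> * k \<le> e0 / 2" using \<sigma> c1 k by (auto simp: field_simps)
  have "(\<lambda>m. T / real m) \<longlonglongrightarrow> 0" by real_asymp
  then have "eventually (\<lambda>m. T / real m < gmin) sequentially"
    using gmin by (intro order_tendstoD(2)) auto
  then obtain M where M: "\<And>m. m \<ge> M \<Longrightarrow> T / real m < gmin" unfolding eventually_sequentially by blast
  show ?thesis
  proof (rule that[of "\<sigma> * e0 / 6" M])
    show "\<sigma> * e0 / 6 > 0" using \<sigma> e0 by simp
    fix m r \<beta> x assume m: "m \<ge> M" "m > 0" and \<beta>: "\<beta> = real r / real m" "\<beta> \<in> {b1..b2}"
      and x: "x \<in> K" and zeros: "\<And>z. F m r z = 0 \<Longrightarrow> \<delta> / real m \<le> dist x z"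
    have r: "0 < r" "r < m" using ratio_in_interval[OF b12(1,3) m(2) \<beta>] by auto
    have b: "0 < \<beta>" "\<beta> < 1" using \<beta>(2) b12 by auto
    have m1: "real m \<ge> 1" using m by simp
    have div_le: "y / real m \<le> y" if "y \<ge> 0" for y
      using divide_left_mono[of 1 "real m" y] m1 that by simp
    define bf where "bf = binom_factor m r"
    have "\<bar>bf - sqrt ((1 - \<beta>) / \<beta>)\<bar> \<le> T / real m"
      using T(2)[OF m(2) \<beta>] unfolding stirling_error_1[OF r] bf_def \<beta>(1) by (simp only: norm_of_real power_one_right real_norm_def)
    moreover have "sqrt ((1 - b2) / b2) \<le> sqrt ((1 - \<beta>) / \<beta>)" "sqrt ((1 - \<beta>) / \<beta>) \<le> sqrt ((1 - b1) / b1)"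
      using \<beta>(2) b12 b by (auto intro!: real_sqrt_le_mono frac_le)
    moreover have "T / real m \<le> T" by (rule div_le[OF T(1)])
    ultimately have bf: "gmin \<le> bf" "bf \<le> gmax"
      using M[OF m(1)] unfolding gmin_def gmax_def by linarith+
    define d where "d = \<sigma> / real m"
    have d: "d > 0" "d \<le> \<sigma>" using \<sigma> m1 div_le[of \<sigma>] by (auto simp: d_def)
    have inS: "y \<in> S" if "y \<in> cball x d" for y
      using S(3)[OF x] that d \<sigma> by (auto simp: subset_iff)
    then have slit: "y \<in> slit_plane" if "y \<in> cball x d" for y using that S by auto
    have xd: "x \<in> cball x d" using d by simp
    define g where "g y = of_nat m * of_real bf / (1 + y)" for y :: complex
    have gy: "norm (g y) = real m * bf * norm (1 / (1 + y))" for y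
      using bf gmin by (simp add: g_def norm_mult norm_divide)
    have "d * (norm (g x) - 2 * d * (real m * c1) * (real m * (gmax * C1)) - gmax * C1\<^sup>2 * \<sigma>)
        \<le> 3 * norm (scaled_F m r x)"
    proof (rule nonvanishing_solution_lower_bound[OF d(1), where p = "\<lambda>y. of_nat m * deriv (radicand \<beta>) y" and g = g])
      fix y assume y: "y \<in> cball x d"
      note nz = slit_plane_nonzero[OF slit[OF y]] slit_plane_nonzero[OF slit[OF xd]]
      show "(scaled_F m r has_field_derivative of_nat m * deriv (radicand \<beta>) y * scaled_F m r y - g y) (at y)"
        unfolding g_def bf_def \<beta>(1) by (rule has_field_derivative_scaled_F[OF r slit[OF y]])
      show "scaled_F m r y \<noteq> 0"
      proof -
        have "dist x y < \<delta> / real m"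
        proof -
          have "dist x y \<le> d" using y by simp
          also have "d \<le> (\<delta> / 2) / real m" unfolding d_def using \<sigma> m1 by (intro divide_right_mono) auto
          also have "\<dots> < \<delta> / real m" using \<delta> m1 by (intro divide_strict_right_mono) auto
          finally show ?thesis .
        qed
        then have "F m r y \<noteq> 0" using zeros[of y] by force
        then show ?thesis using nz m by (simp add: scaled_F_def)
      qed
      show "norm (of_nat m * deriv (radicand \<beta>) y) \<le> real m * c1"
        using c1(2)[OF \<beta>(2) inS[OF y]] by (simp add: norm_mult mult_left_mono)
      have "bf * norm (1 / (1 + y)) \<le> gmax * C1"
        using C1(2)[OF inS[OF y]] bf gmax by (intro mult_mono) auto
      then show "norm (g y) \<le> real m * (gmax * C1)"
        unfolding gy using m1 by (simp add: mult.assoc mult_left_mono)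
      have "g y - g x = of_nat m * of_real bf * ((x - y) * (1 / (1 + y)) * (1 / (1 + x)))"
        using nz by (simp add: g_def field_simps)
      then have "norm (g y - g x) = real m * bf * (norm (x - y) * norm (1 / (1 + y)) * norm (1 / (1 + x)))"
        using bf gmin by (simp add: norm_mult norm_divide)
      also have "\<dots> \<le> real m * gmax * (d * C1 * C1)"
        using C1(2)[OF inS[OF y]] C1(2)[OF inS[OF xd]] bf gmin gmax y C1(1) m1 d
        by (intro mult_mono mult_nonneg_nonneg) (auto simp: dist_norm)
      also have "\<dots> = gmax * C1\<^sup>2 * \<sigma>" using m by (simp add: d_def power2_eq_square)
      finally show "norm (g y - g x) \<le> gmax * C1\<^sup>2 * \<sigma>" .
    next
      show "2 * d * (real m * c1) \<le> 1" using \<sigma>'(1) m by (simp add: d_def)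
    qed
    moreover have "\<sigma> * e0 / 2 \<le> d * (norm (g x) - 2 * d * (real m * c1) * (real m * (gmax * C1)) - gmax * C1\<^sup>2 * \<sigma>)"
    proof -
      have "1 / B \<le> norm (1 / (1 + x))"
        using B(2)[OF x] B(1) slit_plane_nonzero(2)[OF slit[OF xd]]
        by (simp add: norm_divide frac_le)
      then have "gmin * (1 / B) \<le> bf * norm (1 / (1 + x))" using bf gmin B by (intro mult_mono) auto
      then have "real m * (gmin * (1 / B)) \<le> real m * (bf * norm (1 / (1 + x)))"
        by (rule mult_left_mono) simp
      then have lead: "real m * e0 \<le> norm (g x)" by (simp add: gy e0_def mult.assoc)
      have prod: "2 * d * (real m * c1) * (real m * (gmax * C1)) = real m * (\<sigma> * (2 * c1 * (gmax * C1)))"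
        using m by (simp add: d_def)
      have quad: "gmax * C1\<^sup>2 * \<sigma> \<le> real m * (gmax * C1\<^sup>2 * \<sigma>)"
        using mult_right_mono[OF m1, of "gmax * C1\<^sup>2 * \<sigma>"] gmax \<sigma> by simp
      have budget: "real m * (\<sigma> * k) \<le> real m * (e0 / 2)" using \<sigma>'(2) by (intro mult_left_mono) auto
      have "real m * (e0 / 2) \<le> norm (g x) - 2 * d * (real m * c1) * (real m * (gmax * C1)) - gmax * C1\<^sup>2 * \<sigma>"
      proof -
        have "real m * (\<sigma> * k) = real m * (\<sigma> * (2 * c1 * (gmax * C1))) + real m * (gmax * C1\<^sup>2 * \<sigma>)"
          by (simp add: k_def algebra_simps)
        moreover have "real m * e0 = real m * (e0 / 2) + real m * (e0 / 2)" by simp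
        ultimately show ?thesis using lead prod quad budget by linarith
      qed
      then have "d * (real m * (e0 / 2)) \<le> d * (norm (g x) - 2 * d * (real m * c1) * (real m * (gmax * C1)) - gmax * C1\<^sup>2 * \<sigma>)"
        using d by (intro mult_left_mono) auto
      then show ?thesis using m by (simp add: d_def)
    qed
    ultimately show "\<sigma> * e0 / 6 \<le> norm (scaled_F m r x)" by simp
  qed
qed

text \<open>
  The remainder of order \<open>1 / m\<close> is small relative to the lower bound for the sum itself.
\<close>

lemma uniform_asymptotics_away_from_zeros:
  assumes b12: "0 < b1" "b1 \<le> b2" "b2 < 1" and K: "compact K" "K \<subseteq> slit_plane"
    and \<delta>: "0 < \<delta>" and \<epsilon>: "0 < \<epsilon>"
  shows "\<exists>M. \<forall>m\<ge>M. \<forall>r \<beta>. m > 0 \<and> \<beta> = real r / real m \<and> \<beta> \<in> {b1..b2} \<longrightarrow>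
           (\<forall>x\<in>K. (\<forall>z. F m r z = 0 \<longrightarrow> \<delta> / real m \<le> dist x z) \<longrightarrow>
              (\<exists>\<eta>. norm \<eta> \<le> \<epsilon> \<and> F m r x = approx m \<beta> x (A \<beta> x) * (1 + \<eta>)))"
proof -
  obtain l M1 where l: "l > 0"
    "\<And>m r \<beta> x. m \<ge> M1 \<Longrightarrow> m > 0 \<Longrightarrow> \<beta> = real r / real m \<Longrightarrow> \<beta> \<in> {b1..b2} \<Longrightarrow> x \<in> K \<Longrightarrow>
       (\<And>z. F m r z = 0 \<Longrightarrow> \<delta> / real m \<le> dist x z) \<Longrightarrow> l \<le> norm (scaled_F m r x)"
    using scaled_F_lower_bound[OF b12 K \<delta>] by blast
  obtain C where C: "C \<ge> 0"
    "\<And>m r \<beta> x. m > 0 \<Longrightarrow> \<beta> = real r / real m \<Longrightarrow> \<beta> \<in> {b1..b2} \<Longrightarrow> x \<in> K \<Longrightarrow>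
       \<exists>R. norm R \<le> C / real m ^ 1 \<and>
         F m r x = approx m \<beta> x ((\<Sum>k<1. expansion_coeff k \<beta> x / of_nat m ^ k) + R)"
    using uniform_expansion[OF b12(1,3) K, of 1] by blast
  have "(\<lambda>m. C / real m) \<longlonglongrightarrow> 0" by real_asymp
  then have "eventually (\<lambda>m. C / real m < min (l / 2) (\<epsilon> * (l / 2))) sequentially"
    using \<epsilon> l by (intro order_tendstoD(2)) auto
  then obtain M2 where M2: "\<And>m. m \<ge> M2 \<Longrightarrow> C / real m < l / 2 \<and> C / real m < \<epsilon> * (l / 2)"
    unfolding eventually_sequentially by auto
  show ?thesis
  proof (rule exI[of _ "max M1 M2"], intro allI impI ballI)
    fix m r \<beta> x
    assume m: "max M1 M2 \<le> m" and H: "m > 0 \<and> \<beta> = real r / real m \<and> \<beta> \<in> {b1..b2}"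
      and x: "x \<in> K" and zeros: "\<forall>z. F m r z = 0 \<longrightarrow> \<delta> / real m \<le> dist x z"
    have "\<beta> \<in> {b1..b2}" using H by blast
    then have b: "0 < \<beta>" "\<beta> < 1" using b12 by auto
    have xs: "x \<in> slit_plane" using x K by auto
    have m0: "m > 0" using H by simp
    obtain R where R: "norm R \<le> C / real m" "F m r x = approx m \<beta> x (A \<beta> x + R)"
      using C(2)[of m \<beta> r x] H x expansion_coeff_0[OF b xs] by auto
    let ?Z = "scaled_erfc m \<beta> x + A \<beta> x"
    have "scaled_F m r x = ?Z + R"
      using R(2) approx_eq_scaled[OF b xs m0, of "A \<beta> x + R"] slit_plane_nonzero[OF xs] m0 H
      by (simp add: scaled_F_def add.assoc)
    then have "norm (scaled_F m r x) \<le> norm ?Z + norm R" by (simp only: norm_triangle_ineq)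
    moreover have "l \<le> norm (scaled_F m r x)" using l(2)[of m \<beta> r x] m H x zeros by auto
    moreover have small: "C / real m < l / 2" "C / real m < \<epsilon> * (l / 2)" using M2[of m] m by auto
    ultimately have Z: "norm ?Z \<ge> l / 2"
      using R(1) by linarith
    have "\<epsilon> * (l / 2) \<le> \<epsilon> * norm ?Z" using Z \<epsilon> by (intro mult_left_mono) auto
    then have "norm R \<le> \<epsilon> * norm ?Z" using R(1) small by linarith
    moreover have "?Z \<noteq> 0" using Z l(1) by auto
    ultimately show "\<exists>\<eta>. norm \<eta> \<le> \<epsilon> \<and> F m r x = approx m \<beta> x (A \<beta> x) * (1 + \<eta>)"
      by (intro relative_error[OF b xs m0 R(2)])
  qed
qed

theorem proposition16:
  shows
    "(\<forall>\<beta> x \<epsilon>. 0 < \<beta> \<and> \<beta> < 1 \<and> x \<in> slit_plane \<and> 0 < \<epsilon> \<longrightarrow>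
        (\<exists>M. \<forall>m\<ge>M. \<forall>r. m > 0 \<and> \<beta> = real r / real m \<longrightarrow>
           (\<exists>\<eta>. norm \<eta> \<le> \<epsilon> \<and> F m r x = approx m \<beta> x (A \<beta> x) * (1 + \<eta>))))
     \<and>
     (\<forall>b1 b2 K \<delta> \<epsilon>. 0 < b1 \<and> b1 \<le> b2 \<and> b2 < 1 \<and> compact K \<and> K \<subseteq> slit_plane \<and> 0 < \<delta> \<and> 0 < \<epsilon> \<longrightarrow>
        (\<exists>M. \<forall>m\<ge>M. \<forall>r \<beta>. m > 0 \<and> \<beta> = real r / real m \<and> \<beta> \<in> {b1..b2} \<longrightarrow>
           (\<forall>x\<in>K. (\<forall>z. F m r z = 0 \<longrightarrow> \<delta> / real m \<le> dist x z) \<longrightarrow>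
              (\<exists>\<eta>. norm \<eta> \<le> \<epsilon> \<and> F m r x = approx m \<beta> x (A \<beta> x) * (1 + \<eta>)))))
     \<and>
     (\<exists>a :: nat \<Rightarrow> real \<Rightarrow> complex \<Rightarrow> complex.
        (\<forall>\<beta> x. 0 < \<beta> \<and> \<beta> < 1 \<and> x \<in> slit_plane \<longrightarrow> a 0 \<beta> x = A \<beta> x) \<and>
        (\<forall>b1 b2 K N. 0 < b1 \<and> b1 \<le> b2 \<and> b2 < 1 \<and> compact K \<and> K \<subseteq> slit_plane \<longrightarrow>
           (\<exists>C M. \<forall>m\<ge>M. \<forall>r \<beta>. m > 0 \<and> \<beta> = real r / real m \<and> \<beta> \<in> {b1..b2} \<longrightarrow>
              (\<forall>x\<in>K. \<exists>R. norm R \<le> C / real m ^ N \<and>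
                 F m r x = approx m \<beta> x ((\<Sum>k<N. a k \<beta> x / of_nat m ^ k) + R)))))"
proof (rule conjI[OF _ conjI[OF _ exI[of _ expansion_coeff]]], goal_cases)
  case 1
  show ?case by (intro allI impI pointwise_asymptotics) auto
next
  case 2
  show ?case by (intro allI impI, elim conjE) (rule uniform_asymptotics_away_from_zeros)
next
  case 3
  show ?case
  proof (intro conjI allI impI)
    show "expansion_coeff 0 \<beta> x = A \<beta> x" if "0 < \<beta> \<and> \<beta> < 1 \<and> x \<in> slit_plane" for \<beta> x
      using that expansion_coeff_0 by blast
    fix b1 b2 :: real and K N
    assume H: "0 < b1 \<and> b1 \<le> b2 \<and> b2 < 1 \<and> compact K \<and> K \<subseteq> slit_plane"
    then have "0 < b1" "b2 < 1" "compact K" "K \<subseteq> slit_plane" by blast+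
    from uniform_expansion[OF this, of N]
    obtain C where C: "\<And>m r \<beta> x. m > 0 \<Longrightarrow> \<beta> = real r / real m \<Longrightarrow> \<beta> \<in> {b1..b2} \<Longrightarrow> x \<in> K \<Longrightarrow>
       \<exists>R. norm R \<le> C / real m ^ N \<and>
         F m r x = approx m \<beta> x ((\<Sum>k<N. expansion_coeff k \<beta> x / of_nat m ^ k) + R)"
      by metis
    show "\<exists>C M. \<forall>m\<ge>M. \<forall>r \<beta>. m > 0 \<and> \<beta> = real r / real m \<and> \<beta> \<in> {b1..b2} \<longrightarrow>
              (\<forall>x\<in>K. \<exists>R. norm R \<le> C / real m ^ N \<and>
                 F m r x = approx m \<beta> x ((\<Sum>k<N. expansion_coeff k \<beta> x / of_nat m ^ k) + R))"
      by (rule exI[of _ C], rule exI[of _ 0], intro allI impI ballI, elim conjE) (rule C)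
  qed
qed

end
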